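(* Let $\lessdot$ be a shuffle order on $\mathcal{A}$ and $I$ a two-sided ideal of $\mathcal{U}$. (i) In $\mathcal{U}[[x_1,x_2,\dots]]$, \[ \Omega^\lessdot(\mathbf{x},\mathbf{u})=\sum_{\text{colored words } w}Q_{\mathrm{Des}_\lessdot(w)}(\mathbf{x})\,w=\sum_{\text{weak compositions }\alpha}\mathbf{x}^\alpha h^\lessdot_\alpha(\mathbf{u}), \] where $h^\lessdot_\alpha(\mathbf{u})=h^\lessdot_{\alpha_1}(\mathbf{u})h^\lessdot_{\alpha_2}(\mathbf{u})\cdots$. Consequently $F^\lessdot_\gamma(\mathbf{x})=\langle\Omega^\lessdot(\mathbf{x},\mathbf{u}),\gamma\rangle$ for every $\gamma\in\mathcal{U}$. (ii) $e^\lessdot_k(\mathbf{u})e^\lessdot_l(\mathbf{u})=e^\lessdot_l(\mathbf{u})e^\lessdot_k(\mathbf{u})$ in $\mathcal{U}/I$ for all $k,l$ if and only if $h^\lessdot_k(\mathbf{u})h^\lessdot_l(\mathbf{u})=h^\lessdot_l(\mathbf{u})h^\lessdot_k(\mathbf{u})$ in $\mathcal{U}/I$ for all $k,l$. (iii) If $h^\lessdot_k(\mathbf{u})h^\lessdot_l(\mathbf{u})=h^\lessdot_l(\mathbf{u})h^\lessdot_k(\mathbf{u})$ in $\mathcal{U}/I$ for all $k,l$, then \[ \Omega^\lessdot(\mathbf{x},\mathbf{u})=\sum_\nu m_\nu(\mathbf{x})h^\lessdot_\nu(\mathbf{u})=\sum_\nu s_\nu(\mathbf{x})\mathfrak{J}^\lessdot_\nu(\mathbf{u})\quad\text{in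 }(\mathcal{U}/I)[[x_1,x_2,\dots]], \] the sums over all partitions $\nu$; hence for every $\gamma\in I^\perp$, $F^\lessdot_\gamma(\mathbf{x})=\langle\Omega^\lessdot(\mathbf{x},\mathbf{u}),\gamma\rangle=\sum_\nu s_\nu(\mathbf{x})\langle\mathfrak{J}^\lessdot_\nu(\mathbf{u}),\gamma\rangle$.
   Context: $\mathcal{A}=\{1,\dots,N\}\sqcup\{\bar1,\dots,\bar N\}$ (unbarred/barred letters); colored words are finite words in $\mathcal{A}$. A shuffle order is a total order $\lessdot$ on $\mathcal{A}$ with $1\lessdot\cdots\lessdot N$, $\bar1\lessdot\cdots\lessdot\bar N$. $\mathcal{U}$: free associative $\mathbb{Z}$-algebra on noncommuting $u_x$ ($x\in\mathcal{A}$), monomials identified with colored words; $\langle\cdot,\cdot\rangle$ makes colored words orthonormal (extended coefficientwise to power series in $\mathbf{x}$); $I^\perp$ is the orthogonal complement of $I$ in $\mathcal{U}$. The variables $x_1,x_2,\dots$ commute with each other and with all $u_z$. For $z\in\mathcal{A}$, $c_z(x_j)=(1-u_zx_j)^{-1}$ if $z$ is unbarred and $c_z(x_j)=1+u_zx_j$ if $z$ is barred. With $z_1\lessdot z_2\lessdot\cdots\lessdot z_{2N}$ the elements of $\mathcal{A}$, $\Omega^\lessdot(\mathbf{x},\mathbf{u})=\prod_{j=1}^{\infty}\big(c_{z_1}(x_j)c_{z_2}(x_j)\cdots c_{z_{2N}}(x_j)\big)$, the product over $j$ taken in increasing order from left to right. $y\preceq^\lessdot_{\mathrm{row}}z$ means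 $y\lessdot z$ or $y,z$ equal unbarred letters; $h^\lessdot_k(\mathbf{u})=\sum u_{z_1}\cdots u_{z_k}$ over $z_1\preceq^\lessdot_{\mathrm{row}}\cdots\preceq^\lessdot_{\mathrm{row}}z_k$ ($k\ge1$), $h^\lessdot_0=1$, $h^\lessdot_k=0$ for $k<0$. $y\succeq^\lessdot_{\mathrm{col}}x$ means $x\lessdot y$ or $x,y$ equal barred letters; $e^\lessdot_k(\mathbf{u})=\sum u_{z_1}\cdots u_{z_k}$ over $z_1\succeq^\lessdot_{\mathrm{col}}\cdots\succeq^\lessdot_{\mathrm{col}}z_k$, $e^\lessdot_0=1$, $e^\lessdot_k=0$ ($k<0$). $\mathfrak{J}^\lessdot_\nu(\mathbf{u})=\sum_{\pi\in S_{\nu_1}}\mathrm{sgn}(\pi)\prod_{i=1}^{\nu_1}e^\lessdot_{\nu'_i+\pi(i)-i}(\mathbf{u})$ (product in increasing $i$; $\nu'$ the conjugate partition). $\mathrm{Des}_\lessdot(w)=\{i\in[t-1]:w_{i+1}\lessdot w_i\text{ or }w_i,w_{i+1}\text{ equal barred letters}\}$ for $w=w_1\cdots w_t$; $Q_D(\mathbf{x})=\sum x_{i_1}\cdots x_{i_t}$ over $1\le i_1\le\cdots\le i_t$ with $i_j<i_{j+1}$ for $j\in D$; for $\gamma=\sum_w\gamma_ww\in\mathcal{U}$, $F^\lessdot_\gamma(\mathbf{x})=\sum_w\gamma_wQ_{\mathrm{Des}_\lessdot(w)}(\mathbf{x})$. $m_\nu$ and $s_\nu$ denote the monomial and Schur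 symmetric functions; $\mathbf{x}^\alpha=x_1^{\alpha_1}x_2^{\alpha_2}\cdots$. *)

theory Defs
  imports
    "HOL-Algebra.QuotRing"
    "HOL-Algebra.IntRing"
    "HOL-Combinatorics.Permutations"
    "HOL-Library.Multiset"
    "HOL-Library.Poly_Mapping"
begin

section \<open>Colored words and shuffle orders\<close>

datatype letter = Unbarred nat | Barred nat

fun barred :: "letter \<Rightarrow> bool" where
  "barred (Unbarred i) = False"
| "barred (Barred i) = True"

definition alphabet :: "nat \<Rightarrow> letter set" where
  "alphabet N = Unbarred ` {1..N} \<union> Barred ` {1..N}"

abbreviation colored_words :: "nat \<Rightarrow> letter list set" where
  "colored_words N \<equiv> lists (alphabet N)"

definition shuffle_order :: "nat \<Rightarrow> (letter \<Rightarrow> letter \<Rightarrow> bool) \<Rightarrow> bool" where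
  "shuffle_order N lt \<longleftrightarrow>
     irreflp_on (alphabet N) lt \<and> transp_on (alphabet N) lt \<and> totalp_on (alphabet N) lt \<and>
     (\<forall>i\<in>{1..N}. \<forall>j\<in>{1..N}. i < j \<longrightarrow>
        lt (Unbarred i) (Unbarred j) \<and> lt (Barred i) (Barred j))"

text \<open>The list \<open>[z\<^sub>1, \<dots>, z\<^sub>2\<^sub>N]\<close> of all letters in increasing order.\<close>

definition ordered_letters :: "nat \<Rightarrow> (letter \<Rightarrow> letter \<Rightarrow> bool) \<Rightarrow> letter list" where
  "ordered_letters N lt = (THE zs. set zs = alphabet N \<and> sorted_wrt lt zs)"

lemma ex1_ordered_letters:
  assumes "shuffle_order N lt"
  shows "\<exists>!zs. set zs = alphabet N \<and> sorted_wrt lt zs"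
proof -
  have irr: "irreflp_on (alphabet N) lt" and tr: "transp_on (alphabet N) lt"
    and tot: "totalp_on (alphabet N) lt"
    using assms by (auto simp: shuffle_order_def)
  have ex: "\<exists>zs. set zs = A \<and> sorted_wrt lt zs" if "finite A" "A \<subseteq> alphabet N" for A
    using that
  proof (induction A rule: finite_induct)
    case (insert x A)
    then obtain zs where zs: "set zs = A" "sorted_wrt lt zs" by auto
    have "set (filter (\<lambda>y. lt y x) zs @ x # filter (\<lambda>y. lt x y) zs) = insert x A"
      using insert.prems insert.hyps(2) zs(1) totalp_onD[OF tot] by auto
    moreover have "sorted_wrt lt (filter (\<lambda>y. lt y x) zs @ x # filter (\<lambda>y. lt x y) zs)"
    proof -
      have "lt a b" if "lt a x" "lt x b" "a \<in> A" "b \<in> A" for a b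
        using transp_onD[OF tr _ _ _ that(1,2)] that insert.prems by blast
      then show ?thesis
        using zs by (simp add: sorted_wrt_append sorted_wrt_filter)
    qed
    ultimately show ?case by blast
  qed simp
  have uniq: "xs = ys" if "set xs = set ys" "set xs \<subseteq> alphabet N" "sorted_wrt lt xs" "sorted_wrt lt ys"
    for xs ys
    using that
  proof (induction xs arbitrary: ys)
    case (Cons x xs)
    then obtain y ys' where ys: "ys = y # ys'" by (cases ys) auto
    have "x = y"
    proof (rule ccontr)
      assume "x \<noteq> y"
      then have "lt x y" "lt y x" "x \<in> alphabet N" "y \<in> alphabet N"
        using Cons.prems ys by auto
      then show False
        using transp_onD[OF tr, of x y x] irreflp_onD[OF irr, of x] by blast
    qed
    moreover have "x \<in> alphabet N" using Cons.prems(2) by simp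
    with irreflp_onD[OF irr] \<open>x = y\<close> have "\<not> lt x x" "\<not> lt y y" by auto
    then have "x \<notin> set xs" "y \<notin> set ys'"
      using Cons.prems(3,4) ys by auto
    ultimately have "set xs = set ys'" using Cons.prems(1) ys by auto
    then show ?case using Cons ys \<open>x = y\<close> by simp
  qed auto
  have "finite (alphabet N)" by (simp add: alphabet_def)
  with ex[of "alphabet N"] uniq show ?thesis by (intro ex_ex1I) auto
qed

definition row_le :: "(letter \<Rightarrow> letter \<Rightarrow> bool) \<Rightarrow> letter \<Rightarrow> letter \<Rightarrow> bool" where
  "row_le lt y z \<longleftrightarrow> lt y z \<or> (y = z \<and> \<not> barred y)"

definition col_ge :: "(letter \<Rightarrow> letter \<Rightarrow> bool) \<Rightarrow> letter \<Rightarrow> letter \<Rightarrow> bool" where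
  "col_ge lt y x \<longleftrightarrow> lt x y \<or> (x = y \<and> barred y)"

text \<open>Descent positions are counted from 1, whereas list indices start at 0.\<close>

definition Des :: "(letter \<Rightarrow> letter \<Rightarrow> bool) \<Rightarrow> letter list \<Rightarrow> nat set" where
  "Des lt w = {i. 1 \<le> i \<and> i < length w \<and>
     (lt (w ! i) (w ! (i - 1)) \<or> (w ! (i - 1) = w ! i \<and> barred (w ! i)))}"


section \<open>The free associative algebra\<close>

text \<open>Words form a monoid under concatenation, and finitely supported integer functions on words,
  with the convolution product of \<^theory>\<open>HOL-Library.Poly_Mapping\<close>, are its monoid ring.
  The monomial \<open>u\<^sub>w\<close> is \<^term>\<open>frag_of w\<close>.\<close>

instantiation list :: (type) monoid_add
begin

definition zero_list :: "'a list" where "zero_list = []"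

definition plus_list :: "'a list \<Rightarrow> 'a list \<Rightarrow> 'a list" where "plus_list = append"

instance
  by standard (simp_all add: zero_list_def plus_list_def)

end

type_synonym word_alg = "letter list \<Rightarrow>\<^sub>0 int"

definition \<U> :: "nat \<Rightarrow> word_alg ring" where
  "\<U> N = \<lparr>carrier = {\<gamma>. Poly_Mapping.keys \<gamma> \<subseteq> colored_words N},
           mult = (*), one = 1, zero = 0, add = (+)\<rparr>"

lemma ring_\<U>: "ring (\<U> N)"
proof (rule ringI)
  show "abelian_group (\<U> N)"
  proof (rule abelian_groupI)
    fix x assume "x \<in> carrier (\<U> N)"
    then show "\<exists>y\<in>carrier (\<U> N). y \<oplus>\<^bsub>\<U> N\<^esub> x = \<zero>\<^bsub>\<U> N\<^esub>"
      by (intro bexI[of _ "- x"]) (auto simp: \<U>_def)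
  qed (auto simp: \<U>_def algebra_simps dest: set_mp[OF Poly_Mapping.keys_add])
  have "Poly_Mapping.keys (x * y) \<subseteq> colored_words N"
    if "Poly_Mapping.keys x \<subseteq> colored_words N" "Poly_Mapping.keys y \<subseteq> colored_words N" for x y :: word_alg
    using that keys_mult[of x y] by (fastforce simp: plus_list_def)
  then show "Group.monoid (\<U> N)"
    by (intro monoidI) (auto simp: \<U>_def algebra_simps zero_list_def)
qed (auto simp: \<U>_def algebra_simps)

definition residue_class :: "nat \<Rightarrow> word_alg set \<Rightarrow> word_alg \<Rightarrow> word_alg set" where
  "residue_class N I a = I +>\<^bsub>\<U> N\<^esub> a"

definition commute_mod :: "nat \<Rightarrow> word_alg set \<Rightarrow> (int \<Rightarrow> word_alg) \<Rightarrow> bool" where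
  "commute_mod N I a \<longleftrightarrow> (\<forall>k l.
     residue_class N I (a k) \<otimes>\<^bsub>\<U> N Quot I\<^esub> residue_class N I (a l) =
     residue_class N I (a l) \<otimes>\<^bsub>\<U> N Quot I\<^esub> residue_class N I (a k))"

definition pairing :: "word_alg \<Rightarrow> word_alg \<Rightarrow> int" where
  "pairing a b = (\<Sum>w\<in>Poly_Mapping.keys a. Poly_Mapping.lookup a w * Poly_Mapping.lookup b w)"

definition perp :: "nat \<Rightarrow> word_alg set \<Rightarrow> word_alg set" where
  "perp N I = {\<gamma> \<in> carrier (\<U> N). \<forall>a\<in>I. pairing a \<gamma> = 0}"


section \<open>Power series in countably many commuting variables\<close>

text \<open>Exponent vectors, i.e. weak compositions \<open>\<alpha> = (\<alpha>\<^sub>1, \<alpha>\<^sub>2, \<dots>)\<close>, are finitely supported functions.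
  The variables are numbered from 0 here: index \<open>j\<close> stands for \<open>x\<^bsub>j+1\<^esub>\<close>, so that
  \<open>\<alpha>\<^bsub>j+1\<^esub>\<close> is \<^term>\<open>Poly_Mapping.lookup \<alpha> j\<close>.
  A power series is the function sending an exponent vector to its coefficient.\<close>

type_synonym expvec = "nat \<Rightarrow>\<^sub>0 nat"

definition PS :: "('c, 'd) ring_scheme \<Rightarrow> (expvec \<Rightarrow> 'c) ring" where
  "PS R = \<lparr>carrier = {f. \<forall>\<alpha>. f \<alpha> \<in> carrier R},
     mult = (\<lambda>f g \<alpha>. \<Oplus>\<^bsub>R\<^esub>p\<in>{p. fst p + snd p = \<alpha>}. f (fst p) \<otimes>\<^bsub>R\<^esub> g (snd p)),
     one = (\<lambda>\<alpha>. if \<alpha> = 0 then \<one>\<^bsub>R\<^esub> else \<zero>\<^bsub>R\<^esub>),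
     zero = (\<lambda>\<alpha>. \<zero>\<^bsub>R\<^esub>),
     add = (\<lambda>f g \<alpha>. f \<alpha> \<oplus>\<^bsub>R\<^esub> g \<alpha>)\<rparr>"

text \<open>The product \<open>p(x) a\<close> of an integer power series and a constant \<open>a \<in> R\<close>.\<close>

definition ps_times :: "('c, 'd) ring_scheme \<Rightarrow> (expvec \<Rightarrow> int) \<Rightarrow> 'c \<Rightarrow> expvec \<Rightarrow> 'c" where
  "ps_times R p a = (\<lambda>\<alpha>. [p \<alpha>] \<cdot>\<^bsub>R\<^esub> a)"

text \<open>The power series \<open>S\<close> is the (possibly infinite) formal sum of the family \<open>f\<close>: each exponent
  vector receives nonzero contributions from only finitely many members, which add up to the
  coefficient of \<open>S\<close>.\<close>

definition has_formal_sum ::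
  "('c, 'd) ring_scheme \<Rightarrow> ('i \<Rightarrow> expvec \<Rightarrow> 'c) \<Rightarrow> 'i set \<Rightarrow> (expvec \<Rightarrow> 'c) \<Rightarrow> bool" where
  "has_formal_sum R f A S \<longleftrightarrow>
     (\<forall>\<alpha>. finite {i\<in>A. f i \<alpha> \<noteq> \<zero>\<^bsub>R\<^esub>} \<and>
          S \<alpha> = (\<Oplus>\<^bsub>R\<^esub>i\<in>{i\<in>A. f i \<alpha> \<noteq> \<zero>\<^bsub>R\<^esub>}. f i \<alpha>))"

lemma finite_antidiagonal: "finite {p. fst p + snd p = (\<alpha> :: expvec)}"
proof -
  let ?B = "{\<beta> :: expvec. \<forall>j. Poly_Mapping.lookup \<beta> j \<le> Poly_Mapping.lookup \<alpha> j}"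
  define M where "M = Max (insert 0 (Poly_Mapping.lookup \<alpha> ` Poly_Mapping.keys \<alpha>))"
  have M: "Poly_Mapping.lookup \<alpha> j \<le> M" if "j \<in> Poly_Mapping.keys \<alpha>" for j
    using that by (auto simp: M_def intro!: Max_ge)
  have "Poly_Mapping.lookup ` ?B \<subseteq>
      {f. \<forall>j. (j \<in> Poly_Mapping.keys \<alpha> \<longrightarrow> f j \<in> {..M}) \<and> (j \<notin> Poly_Mapping.keys \<alpha> \<longrightarrow> f j = 0)}"
  proof clarify
    fix \<beta> :: expvec and j
    assume *: "\<forall>j. Poly_Mapping.lookup \<beta> j \<le> Poly_Mapping.lookup \<alpha> j"
    show "(j \<in> Poly_Mapping.keys \<alpha> \<longrightarrow> Poly_Mapping.lookup \<beta> j \<in> {..M}) \<and>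
          (j \<notin> Poly_Mapping.keys \<alpha> \<longrightarrow> Poly_Mapping.lookup \<beta> j = 0)"
      using *[rule_format, of j] M[of j] by (cases "j \<in> Poly_Mapping.keys \<alpha>") (simp_all add: in_keys_iff)
  qed
  then have "finite (Poly_Mapping.lookup ` ?B)"
    by (rule finite_subset) (intro finite_set_of_finite_funs; simp)
  then have "finite ?B"
    by (rule finite_imageD) (simp add: inj_on_def)
  moreover have "{p. fst p + snd p = \<alpha>} \<subseteq> ?B \<times> ?B"
    by (auto simp: lookup_add)
  ultimately show ?thesis
    by (meson finite_SigmaI rev_finite_subset)
qed

text \<open>Limit of a sequence of power series whose coefficients are eventually constant.\<close>

definition formal_lim :: "(nat \<Rightarrow> expvec \<Rightarrow> 'c) \<Rightarrow> expvec \<Rightarrow> 'c" where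
  "formal_lim P = (\<lambda>\<alpha>. THE c. \<forall>\<^sub>F n in sequentially. P n \<alpha> = c)"

definition list_prod :: "('c, 'd) monoid_scheme \<Rightarrow> 'c list \<Rightarrow> 'c" where
  "list_prod G fs = foldr (\<otimes>\<^bsub>G\<^esub>) fs \<one>\<^bsub>G\<^esub>"

definition xpow :: "expvec \<Rightarrow> expvec \<Rightarrow> int" where
  "xpow \<alpha> = (\<lambda>\<beta>. if \<beta> = \<alpha> then 1 else 0)"

definition seq_expvec :: "nat list \<Rightarrow> expvec" where
  "seq_expvec is = (\<Sum>i\<leftarrow>is. Poly_Mapping.single i 1)"


section \<open>The series \<open>\<Omega>\<close>\<close>

definition ux :: "nat \<Rightarrow> letter \<Rightarrow> nat \<Rightarrow> expvec \<Rightarrow> word_alg" where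
  "ux N z j = ps_times (\<U> N) (xpow (Poly_Mapping.single j 1)) (frag_of [z])"

definition c_factor :: "nat \<Rightarrow> letter \<Rightarrow> nat \<Rightarrow> expvec \<Rightarrow> word_alg" where
  "c_factor N z j =
     (if barred z then \<one>\<^bsub>PS (\<U> N)\<^esub> \<oplus>\<^bsub>PS (\<U> N)\<^esub> ux N z j
      else inv\<^bsub>PS (\<U> N)\<^esub> (\<one>\<^bsub>PS (\<U> N)\<^esub> \<ominus>\<^bsub>PS (\<U> N)\<^esub> ux N z j))"

definition \<Omega> :: "nat \<Rightarrow> (letter \<Rightarrow> letter \<Rightarrow> bool) \<Rightarrow> expvec \<Rightarrow> word_alg" where
  "\<Omega> N lt = formal_lim (\<lambda>n. list_prod (PS (\<U> N))
     (map (\<lambda>j. list_prod (PS (\<U> N)) (map (\<lambda>z. c_factor N z j) (ordered_letters N lt))) [0..<n]))"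


section \<open>Noncommutative symmetric functions\<close>

definition h_poly :: "nat \<Rightarrow> (letter \<Rightarrow> letter \<Rightarrow> bool) \<Rightarrow> int \<Rightarrow> word_alg" where
  "h_poly N lt k = (if k < 0 then 0 else
     \<Sum>w\<in>{w \<in> colored_words N. int (length w) = k \<and> successively (row_le lt) w}. frag_of w)"

definition e_poly :: "nat \<Rightarrow> (letter \<Rightarrow> letter \<Rightarrow> bool) \<Rightarrow> int \<Rightarrow> word_alg" where
  "e_poly N lt k = (if k < 0 then 0 else
     \<Sum>w\<in>{w \<in> colored_words N. int (length w) = k \<and> successively (col_ge lt) w}. frag_of w)"

definition h_list :: "nat \<Rightarrow> (letter \<Rightarrow> letter \<Rightarrow> bool) \<Rightarrow> nat list \<Rightarrow> word_alg" where
  "h_list N lt \<alpha> = (\<Prod>k\<leftarrow>\<alpha>. h_poly N lt (int k))"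

text \<open>All entries of \<open>\<alpha>\<close> at indices from \<^term>\<open>Poly_Mapping.degree \<alpha>\<close> on vanish, so the omitted
  factors are \<open>h\<^sub>0 = 1\<close>.\<close>

definition h_comp :: "nat \<Rightarrow> (letter \<Rightarrow> letter \<Rightarrow> bool) \<Rightarrow> expvec \<Rightarrow> word_alg" where
  "h_comp N lt \<alpha> = h_list N lt (map (Poly_Mapping.lookup \<alpha>) [0..<Poly_Mapping.degree \<alpha>])"

definition partitions :: "nat list set" where
  "partitions = {\<nu>. sorted_wrt (\<ge>) \<nu> \<and> 0 \<notin> set \<nu>}"

definition first_part :: "nat list \<Rightarrow> nat" where
  "first_part \<nu> = (case \<nu> of [] \<Rightarrow> 0 | p # _ \<Rightarrow> p)"

definition conj_part :: "nat list \<Rightarrow> nat \<Rightarrow> nat" where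
  "conj_part \<nu> i = length (filter (\<lambda>p. i \<le> p) \<nu>)"

definition J_poly :: "nat \<Rightarrow> (letter \<Rightarrow> letter \<Rightarrow> bool) \<Rightarrow> nat list \<Rightarrow> word_alg" where
  "J_poly N lt \<nu> = (\<Sum>\<pi>\<in>{\<pi>. \<pi> permutes {1..first_part \<nu>}}.
     of_int (sign \<pi>) *
     (\<Prod>i\<leftarrow>[1..<Suc (first_part \<nu>)]. e_poly N lt (int (conj_part \<nu> i) + int (\<pi> i) - int i)))"


section \<open>Integer power series\<close>

text \<open>\<open>Q_series\<close> and \<open>schur\<close> are sums of monomials indexed by sequences and by tableaux; their
  coefficients count the indices with the given exponent vector. The set \<open>D\<close> is a subset of
  \<open>{1, \<dots>, t - 1}\<close>, counted from 1 like \<^const>\<open>Des\<close>.\<close>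

definition Q_series :: "nat \<Rightarrow> nat set \<Rightarrow> expvec \<Rightarrow> int" where
  "Q_series t D \<alpha> = int (card {is. length is = t \<and> sorted is \<and>
      (\<forall>j\<in>D. is ! (j - 1) < is ! j) \<and> seq_expvec is = \<alpha>})"

definition F_series :: "(letter \<Rightarrow> letter \<Rightarrow> bool) \<Rightarrow> word_alg \<Rightarrow> expvec \<Rightarrow> int" where
  "F_series lt \<gamma> \<alpha> = (\<Sum>w\<in>Poly_Mapping.keys \<gamma>. Poly_Mapping.lookup \<gamma> w * Q_series (length w) (Des lt w) \<alpha>)"

definition monomial_sf :: "nat list \<Rightarrow> expvec \<Rightarrow> int" where
  "monomial_sf \<nu> \<alpha> =
     (if image_mset (Poly_Mapping.lookup \<alpha>) (mset_set (Poly_Mapping.keys \<alpha>)) = mset \<nu> then 1 else 0)"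

text \<open>Semistandard tableaux of shape \<open>\<nu>\<close>, as lists of rows.\<close>

definition SSYT :: "nat list \<Rightarrow> nat list list set" where
  "SSYT \<nu> = {T. map length T = \<nu> \<and> (\<forall>r\<in>set T. sorted r) \<and>
     (\<forall>i j. Suc i < length T \<and> j < length (T ! Suc i) \<longrightarrow> T ! i ! j < T ! Suc i ! j)}"

definition schur :: "nat list \<Rightarrow> expvec \<Rightarrow> int" where
  "schur \<nu> \<alpha> = int (card {T \<in> SSYT \<nu>. seq_expvec (concat T) = \<alpha>})"

end

theory Submission
  imports Defs "Jordan_Normal_Form.Determinant"
begin

text \<open>
  Coefficientwise, both expansions in (i) say that a word contributes to \<open>x\<^sup>\<alpha>\<close> exactly if it can be
  cut into row words of lengths \<open>\<alpha>\<^sub>1, \<alpha>\<^sub>2, \<dots>\<close>. For (ii), the alternating sums of \<open>h\<^bsub>k-i\<^esub> e\<^sub>i\<close> vanish already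
  in the free algebra, so that the \<open>h\<^sub>k\<close> and the \<open>e\<^sub>k\<close> generate the same subring. For (iii), if the \<open>h\<^sub>k\<close>
  commute modulo the ideal, then \<open>h\<^sub>\<alpha>\<close> is the image of a monomial of the commutative polynomial ring
  in \<open>h\<^sub>1, h\<^sub>2, \<dots>\<close>. There a Pieri rule for the determinants of the \<open>e\<^sub>k\<close>, iterated along the
  entries of a tableau, gives \<open>h\<^sub>\<alpha> = \<Sum>\<^sub>\<nu> K\<^sub>\<nu>\<^sub>\<alpha> J\<^sub>\<nu>\<close> with the Kostka numbers \<open>K\<^sub>\<nu>\<^sub>\<alpha>\<close>, the
  coefficients of \<open>s\<^sub>\<nu>\<close>.
\<close>

section \<open>A Pieri rule for determinants\<close>

text \<open>The obstacle is that \<open>J_poly\<close> is a signed sum of ordered products in a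
  noncommutative quotient, while determinants are formed over a type of class
  \<open>comm_ring_1\<close>; the subring generated by the residue classes of the \<open>h_k\<close>
  is only a carrier set. So every determinant is computed once in a free commutative ring. The map
  back to the free algebra has to choose an order of the factors; it is additive, and multiplicative
  only modulo the ideal.

  The determinants are those of the \<open>e_k\<close>, so multiplication by \<open>h_k\<close> adds
  a vertical strip to the row parameters \<mu>, which play the role of the conjugate shape. Summed
  over all \<open>k\<close>-subsets of the rows this is an exact identity; terms that are not
  partitions have two equal rows and vanish one by one, without any cancellation to organise. On the
  tableau side, such a strip is the set of columns that contain a given entry. The size
  \<open>n\<close> is kept independent of the shape, which is possible because the determinant is
  stable once \<open>n\<close> reaches the number of rows with a nonzero parameter.\<close>

lemma det_add_rows:
  fixes a b :: "nat \<Rightarrow> nat \<Rightarrow> 'a::comm_ring_1"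
  shows "det (mat n n (\<lambda>(i,j). a i j + b i j)) =
    (\<Sum>S\<in>Pow {0..<n}. det (mat n n (\<lambda>(i,j). if i \<in> S then b i j else a i j)))"
proof -
  have "(\<Prod>i = 0..<n. a i (p i) + b i (p i)) =
      (\<Sum>S\<in>Pow {0..<n}. \<Prod>i = 0..<n. if i \<in> S then b i (p i) else a i (p i))" for p
  proof -
    have "(\<Prod>i = 0..<n. b i (p i) + a i (p i)) =
        (\<Sum>S\<in>Pow {0..<n}. (\<Prod>i\<in>S. b i (p i)) * (\<Prod>i\<in>{0..<n} - S. a i (p i)))"
      by (rule prod_add) simp
    also have "\<dots> = (\<Sum>S\<in>Pow {0..<n}. \<Prod>i = 0..<n. if i \<in> S then b i (p i) else a i (p i))"
    proof (rule sum.cong[OF refl])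
      fix S assume "S \<in> Pow {0..<n}"
      then show "(\<Prod>i\<in>S. b i (p i)) * (\<Prod>i\<in>{0..<n} - S. a i (p i)) =
          (\<Prod>i = 0..<n. if i \<in> S then b i (p i) else a i (p i))"
        by (subst prod.If_cases) (auto simp: Int_absorb1 Diff_eq Collect_mem_eq)
    qed
    finally show ?thesis by (simp add: add.commute)
  qed
  moreover have "{p. p permutes {0..<n}} \<subseteq> {p. \<forall>i<n. p i < n}"
    by (auto dest: permutes_in_image)
  ultimately show ?thesis
    by (subst (1 2) det_def')
      (auto simp: sum_distrib_left sum.swap[of _ "Pow {0..<n}"] subset_eq
        intro!: sum.cong[OF refl] prod.cong[OF refl] arg_cong2[of _ _ _ _ "(*)"])
qed

lemma det_scale_rows:
  fixes a :: "nat \<Rightarrow> nat \<Rightarrow> 'a::comm_ring_1"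
  assumes "S \<subseteq> {0..<n}"
  shows "det (mat n n (\<lambda>(i,j). if i \<in> S then c * a i j else a i j)) =
    c ^ card S * det (mat n n (\<lambda>(i,j). a i j))"
proof -
  have "(\<Prod>i = 0..<n. if i \<in> S then c * a i (p i) else a i (p i)) =
      c ^ card S * (\<Prod>i = 0..<n. a i (p i))" for p
  proof -
    have "(\<Prod>i = 0..<n. if i \<in> S then c * a i (p i) else a i (p i)) =
        (\<Prod>i = 0..<n. (if i \<in> S then c else 1) * a i (p i))"
      by (intro prod.cong) auto
    also have "\<dots> = c ^ card S * (\<Prod>i = 0..<n. a i (p i))"
      using assms by (simp add: prod.distrib prod.If_cases Int_absorb1)
    finally show ?thesis .
  qed
  moreover have "{p. p permutes {0..<n}} \<subseteq> {p. \<forall>i<n. p i < n}"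
    by (auto dest: permutes_in_image)
  ultimately show ?thesis
    by (subst (1 2) det_def')
      (auto simp: sum_distrib_left subset_eq algebra_simps
        intro!: sum.cong[OF refl] prod.cong[OF refl] arg_cong2[of _ _ _ _ "(*)"])
qed

lemma cofactor_mat_last_row:
  "cofactor (mat (Suc n) (Suc n) f) n j =
    (- 1) ^ (n + j) * det (mat n n (\<lambda>(i,l). f (i, if l < j then l else Suc l)))"
proof -
  have "mat_delete (mat (Suc n) (Suc n) f) n j = mat n n (\<lambda>(i,l). f (i, if l < j then l else Suc l))"
    by (rule eq_matI) (auto simp: mat_delete_def)
  then show ?thesis
    by (simp add: cofactor_def)
qed

lemma comm_ring_hom_const_poly: "comm_ring_hom (\<lambda>a::'a::comm_ring_1. [:a:])"
  by unfold_locales (auto simp: one_pCons)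

lemma det_const_poly: "det (mat n n (\<lambda>(i,j). [:a i j:])) = [:det (mat n n (\<lambda>(i,j). a i j)):]"
proof -
  interpret comm_ring_hom "\<lambda>a::'a. [:a:]" by (rule comm_ring_hom_const_poly)
  have "map_mat (\<lambda>a. [:a:]) (mat n n (\<lambda>(i,j). a i j)) = mat n n (\<lambda>(i,j). [:a i j:])"
    by (rule eq_matI) auto
  then show ?thesis by (metis hom_det)
qed

text \<open>If \<open>t\<close> marks the shifted rows, the sum over all \<open>S\<close> is the determinant with columns \<open>C\<^sub>j + t C\<^bsub>j+1\<^esub>\<close>.
  Column operations turn it into that of the matrix bordered below by the row of the \<open>(-t)\<^bsup>n-j\<^esup>\<close>.\<close>

lemma sum_det_shift_rows:
  fixes f :: "nat \<Rightarrow> nat \<Rightarrow> 'a::comm_ring_1"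
  assumes "k \<le> n"
  shows "(\<Sum>S | S \<subseteq> {0..<n} \<and> card S = k.
      det (mat n n (\<lambda>(i,j). f i (if i \<in> S then Suc j else j)))) =
    (- 1) ^ k * cofactor (mat (Suc n) (Suc n) (\<lambda>(i,j). f i j)) n (n - k)"
proof -
  define t :: "'a poly" where "t = monom 1 1"
  define M where "M = mat (Suc n) (Suc n) (\<lambda>(i,j). f i j)"
  define P where "P = mat (Suc n) (Suc n) (\<lambda>(i,j). if i < n then [:f i j:] else (- t) ^ (n - j))"
  \<comment> \<open>Right multiplication by the unitriangular \<open>T\<close> adds \<open>t\<close>
    times column \<open>j + 1\<close> to every column \<open>j < n\<close> at once.\<close>
  define T where "T = mat (Suc n) (Suc n) (\<lambda>(i,j). if i = j then 1 else if i = Suc j then t else 0)"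
  have t_pow: "(- t) ^ p = monom ((- 1) ^ p) p" "t ^ p = monom 1 p" for p
    by (induction p) (simp_all add: t_def mult_monom minus_monom)
  have carrier: "M \<in> carrier_mat (Suc n) (Suc n)" "P \<in> carrier_mat (Suc n) (Suc n)"
      "T \<in> carrier_mat (Suc n) (Suc n)"
    by (auto simp: M_def P_def T_def)
  have "det T = prod_list (diag_mat T)"
    by (rule det_lower_triangular[OF _ carrier(3)]) (auto simp: T_def)
  also have "diag_mat T = map (\<lambda>_. 1) [0..<Suc n]"
    unfolding diag_mat_def by (rule map_cong) (auto simp: T_def)
  also have "prod_list \<dots> = 1"
    by (induction n) auto
  finally have "det T = 1" .
  have PT: "(P * T) $$ (i, j) = (if j < n then P $$ (i, j) + t * P $$ (i, Suc j) else P $$ (i, n))"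
    if "i < Suc n" "j < Suc n" for i j
  proof -
    have "(P * T) $$ (i, j) = (\<Sum>l<Suc n. P $$ (i, l) * T $$ (l, j))"
      using carrier that unfolding times_mat_def scalar_prod_def
      by (auto intro!: sum.cong simp: lessThan_atLeast0)
    also have "\<dots> = (\<Sum>l<Suc n. if l = j then P $$ (i, l) else if l = Suc j then t * P $$ (i, l) else 0)"
      using that by (intro sum.cong) (auto simp: T_def)
    also have "\<dots> = (\<Sum>l\<in>{l. l < Suc n \<and> (l = j \<or> l = Suc j)}. if l = j then P $$ (i, l) else t * P $$ (i, l))"
      by (intro sum.mono_neutral_cong_right) auto
    also have "{l. l < Suc n \<and> (l = j \<or> l = Suc j)} = (if j < n then {j, Suc j} else {n})"
      using that by auto
    finally show ?thesis using that by auto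
  qed
  \<comment> \<open>This is why the border is a geometric progression:
    \<open>(-t)^(n-j) + t * (-t)^(n-j-1) = 0\<close>, so only the corner entry survives.\<close>
  have last: "(P * T) $$ (n, j) = (if j = n then 1 else 0)" if "j < Suc n" for j
  proof (cases "j < n")
    case True
    then have "n - j = Suc (n - Suc j)" by simp
    then show ?thesis using True PT[of n j] by (simp add: P_def)
  next
    case False
    then show ?thesis using that PT[of n j] by (simp add: P_def)
  qed
  have PT_eq: "P * T = mat (Suc n) (Suc n) (\<lambda>ij. (P * T) $$ ij)"
    by (rule eq_matI) (use carrier in auto)
  have "det P = det (P * T)"
    using det_mult[OF carrier(2,3)] \<open>det T = 1\<close> by simp
  also have "\<dots> = (\<Sum>j<Suc n. (P * T) $$ (n, j) * cofactor (P * T) n j)"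
    by (rule laplace_expansion_row) (use carrier in auto)
  also have "\<dots> = (\<Sum>j<Suc n. if j = n then cofactor (P * T) n j else 0)"
    by (intro sum.cong) (auto simp: last)
  also have "\<dots> = cofactor (P * T) n n"
    by simp
  also have "\<dots> = det (mat n n (\<lambda>(i,l). (P * T) $$ (i, if l < n then l else Suc l)))"
    by (subst PT_eq, subst cofactor_mat_last_row) (simp flip: mult_2)
  also have "mat n n (\<lambda>(i,l). (P * T) $$ (i, if l < n then l else Suc l)) =
      mat n n (\<lambda>(i,j). [:f i j:] + t * [:f i (Suc j):])"
    using carrier by (intro eq_matI) (auto simp: PT simp del: index_mult_mat, auto simp: P_def)
  also have "det \<dots> = (\<Sum>S\<in>Pow {0..<n}. det (mat n n (\<lambda>(i,j). if i \<in> S then t * [:f i (Suc j):] else [:f i j:])))"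
    by (rule det_add_rows)
  also have "\<dots> = (\<Sum>S\<in>Pow {0..<n}. t ^ card S * [:det (mat n n (\<lambda>(i,j). f i (if i \<in> S then Suc j else j))):])"
  proof (rule sum.cong[OF refl])
    fix S assume "S \<in> Pow {0..<n}"
    then have "S \<subseteq> {0..<n}" by simp
    have "mat n n (\<lambda>(i,j). if i \<in> S then t * [:f i (Suc j):] else [:f i j:]) =
        mat n n (\<lambda>(i,j). if i \<in> S then t * [:f i (if i \<in> S then Suc j else j):]
          else [:f i (if i \<in> S then Suc j else j):])"
      by (rule eq_matI) auto
    then show "det (mat n n (\<lambda>(i,j). if i \<in> S then t * [:f i (Suc j):] else [:f i j:])) =
        t ^ card S * [:det (mat n n (\<lambda>(i,j). f i (if i \<in> S then Suc j else j))):]"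
      using det_scale_rows[OF \<open>S \<subseteq> {0..<n}\<close>, of t "\<lambda>i j. [:f i (if i \<in> S then Suc j else j):]"]
      by (simp add: det_const_poly)
  qed
  \<comment> \<open>The exponent of \<open>t\<close> is the size of \<open>S\<close>, so the
    coefficient of \<open>t^k\<close> selects the subsets of size \<open>k\<close>.\<close>
  finally have "coeff (det P) k = (\<Sum>S\<in>Pow {0..<n}.
      if card S = k then det (mat n n (\<lambda>(i,j). f i (if i \<in> S then Suc j else j))) else 0)"
    by (simp add: coeff_sum t_pow coeff_monom smult_monom if_distrib mult.commute cong: if_cong)
  also have "\<dots> = (\<Sum>S | S \<subseteq> {0..<n} \<and> card S = k. det (mat n n (\<lambda>(i,j). f i (if i \<in> S then Suc j else j))))"
    by (intro sum.mono_neutral_cong_right) auto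
  finally have coeff1: "coeff (det P) k = \<dots>" .
  \<comment> \<open>Cofactors of the border row omit the only row that contains \<open>t\<close>, so
    they are constants. Expanding \<open>det P\<close> along the border gives its second
    evaluation.\<close>
  have cof: "cofactor P n j = [:cofactor M n j:]" for j
  proof -
    have "mat n n (\<lambda>(i,l). if i < n then [:f i (if l < j then l else Suc l):] else (- t) ^ (n - (if l < j then l else Suc l)))
        = mat n n (\<lambda>(i,l). [:f i (if l < j then l else Suc l):])"
      by (rule eq_matI) auto
    then show ?thesis
      unfolding P_def M_def cofactor_mat_last_row
      by (cases "even (n + j)") (simp_all add: det_const_poly)
  qed
  have "det P = (\<Sum>j<Suc n. P $$ (n, j) * cofactor P n j)"
    by (rule laplace_expansion_row) (use carrier in auto)
  also have "\<dots> = (\<Sum>j<Suc n. monom ((- 1) ^ (n - j) * cofactor M n j) (n - j))"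
    unfolding cof by (intro sum.cong) (auto simp: P_def t_pow smult_monom mult.commute)
  finally have "coeff (det P) k = (\<Sum>j<Suc n. if n - j = k then (- 1) ^ k * cofactor M n j else 0)"
    by (auto simp: coeff_sum intro!: sum.cong)
  also have "\<dots> = (\<Sum>j\<in>{n - k}. (- 1) ^ k * cofactor M n j)"
    using assms by (intro sum.mono_neutral_cong_right) auto
  finally show ?thesis
    using coeff1 by (simp add: M_def)
qed

section \<open>Determinants of dual Jacobi-Trudi type\<close>

text \<open>The dual Jacobi-Trudi matrix with indices from 0, \<mu> being the conjugate of the
  shape. Neither monotonicity of \<mu> nor a link between \<open>n\<close> and \<mu> is built in,
  since the Pieri rule passes through parameters that are not partitions.\<close>

definition e_mat :: "(int \<Rightarrow> 'a::comm_ring_1) \<Rightarrow> nat \<Rightarrow> (nat \<Rightarrow> nat) \<Rightarrow> 'a mat" where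
  "e_mat e n \<mu> = mat n n (\<lambda>(i,j). e (int (\<mu> i) - int i + int j))"

lemma e_mat_carrier [simp]: "e_mat e n \<mu> \<in> carrier_mat n n"
  by (simp add: e_mat_def)

text \<open>The relation says that the generating functions satisfy
  \<open>E(-t) H(t) = 1\<close>.\<close>

locale eh_pair =
  fixes e h :: "int \<Rightarrow> 'a::comm_ring_1"
  assumes e_neg: "\<And>k. k < 0 \<Longrightarrow> e k = 0" and e_0: "e 0 = 1" and h_0: "h 0 = 1"
    and eh: "\<And>k. k > 0 \<Longrightarrow> (\<Sum>i\<le>k. (- 1) ^ i * e (int i) * h (int (k - i))) = 0"
begin

text \<open>The cofactors of the last row are orthogonal to the rows \<open>m, \<dots>, n - 1\<close>, which consist of the
  shifted sequence \<open>e\<^sub>0, e\<^sub>1, \<dots>\<close>; this is the recursion that defines \<open>h\<close>.\<close>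

lemma cofactor_e_mat:
  assumes "\<And>i. i \<ge> m \<Longrightarrow> \<mu> i = 0" "m + k \<le> n"
  shows "cofactor (e_mat e (Suc n) \<mu>) n (n - k) = (- 1) ^ k * h (int k) * det (e_mat e (Suc n) \<mu>)"
  using assms(2)
proof (induction k rule: less_induct)
  case (less k)
  let ?M = "e_mat e (Suc n) \<mu>"
  \<comment> \<open>\<open>m + k \<le> n\<close> puts row \<open>n - k\<close> where \<mu> vanishes,
    so that \<open>e 0\<close> stands on the diagonal.\<close>
  have M': "?M $$ (n - k, j) = e (int j - int (n - k))" if "j < Suc n" for j
    using that less.prems assms(1)[of "n - k"] by (simp add: e_mat_def algebra_simps)
  have M_0: "?M $$ (n - k, j) = 0" if "j < n - k" for j
    using that by (subst M') (auto intro: e_neg)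
  have M: "?M $$ (n - k, j) = e (int (j - (n - k)))" if "n - k \<le> j" "j \<le> n" for j
    using that by (simp only: M' less_Suc_eq_le of_nat_diff)
  \<comment> \<open>The adjugate identity, read at row \<open>n - k\<close> against the cofactors of
    row \<open>n\<close>.\<close>
  have "(\<Sum>j<Suc n. ?M $$ (n - k, j) * cofactor ?M n j) = (?M * adj_mat ?M) $$ (n - k, n)"
    unfolding times_mat_def scalar_prod_def adj_mat_def
    by (auto simp: e_mat_def lessThan_atLeast0 intro!: sum.cong)
  also have "\<dots> = (if k = 0 then det ?M else 0)"
    using less.prems by (subst adj_mat(2)[of _ "Suc n"]) auto
  also have "(\<Sum>j<Suc n. ?M $$ (n - k, j) * cofactor ?M n j) =
      (\<Sum>j\<in>{n - k..n}. e (int (j - (n - k))) * cofactor ?M n j)"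
    by (intro sum.mono_neutral_cong_right) (auto simp: M M_0 simp del: lessThan_Suc)
  also have "\<dots> = (\<Sum>l\<le>k. e (int l) * cofactor ?M n (n - (k - l)))"
    by (rule sum.reindex_bij_witness[of _ "\<lambda>l. n - (k - l)" "\<lambda>j. j - (n - k)"]) (use less.prems in auto)
  also have "\<dots> = cofactor ?M n (n - k) + (\<Sum>l = 1..k. e (int l) * cofactor ?M n (n - (k - l)))"
    by (simp add: atMost_atLeast0 sum.atLeast_Suc_atMost e_0)
  also have "(\<Sum>l = 1..k. e (int l) * cofactor ?M n (n - (k - l))) =
      (\<Sum>l = 1..k. e (int l) * ((- 1) ^ (k - l) * h (int (k - l)) * det ?M))"
    using less.prems by (intro sum.cong arg_cong2[of _ _ _ _ "(*)"] less.IH) auto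
  also have "\<dots> = (\<Sum>l = 1..k. (- 1) ^ l * e (int l) * h (int (k - l))) * (- 1) ^ k * det ?M"
    unfolding sum_distrib_right
    by (intro sum.cong[OF refl]) (auto simp: power_diff_conv_inverse minus_one_power_iff algebra_simps)
  finally have *: "cofactor ?M n (n - k) + (\<Sum>l = 1..k. (- 1) ^ l * e (int l) * h (int (k - l))) * (- 1) ^ k * det ?M =
      (if k = 0 then det ?M else 0)" .
  show ?case
  proof (cases "k = 0")
    case True
    then show ?thesis using * by (simp add: h_0)
  next
    case False
    then have "h (int k) + (\<Sum>l = 1..k. (- 1) ^ l * e (int l) * h (int (k - l))) = 0"
      using eh[of k] by (simp add: atMost_atLeast0 sum.atLeast_Suc_atMost e_0)
    then have "(\<Sum>l = 1..k. (- 1) ^ l * e (int l) * h (int (k - l))) = - h (int k)"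
      by (simp add: add_eq_0_iff)
    then show ?thesis using * False by (simp add: algebra_simps)
  qed
qed

text \<open>A zero parameter makes the last row \<open>(0, ..., 0, 1)\<close>, because its entries
  are \<open>e (j - n)\<close>.\<close>

lemma det_e_mat_Suc:
  assumes "\<mu> n = 0"
  shows "det (e_mat e (Suc n) \<mu>) = det (e_mat e n \<mu>)"
proof -
  let ?M = "e_mat e (Suc n) \<mu>"
  have M': "?M $$ (n, j) = e (int j - int n)" if "j < Suc n" for j
    using that assms by (simp add: e_mat_def)
  have M_0: "?M $$ (n, j) = 0" if "j < n" for j
    using that by (subst M') (auto intro: e_neg)
  have M: "?M $$ (n, n) = 1"
    by (subst M') (simp_all add: e_0)
  have "det ?M = (\<Sum>j<Suc n. ?M $$ (n, j) * cofactor ?M n j)"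
    by (rule laplace_expansion_row) auto
  also have "\<dots> = (\<Sum>j\<in>{n}. cofactor ?M n j)"
    by (intro sum.mono_neutral_cong_right) (auto simp: M M_0 e_0 less_Suc_eq)
  also have "\<dots> = det (e_mat e n \<mu>)"
    unfolding e_mat_def sum.insert_remove cofactor_mat_last_row
    by (auto simp flip: mult_2 intro!: arg_cong[of _ _ det])
  finally show ?thesis .
qed

lemma det_e_mat_stable:
  assumes "\<And>i. i \<ge> m \<Longrightarrow> \<mu> i = 0" "m \<le> n"
  shows "det (e_mat e n \<mu>) = det (e_mat e m \<mu>)"
  using assms(2) by (induction n rule: dec_induct) (simp_all add: det_e_mat_Suc assms(1))

text \<open>Raising \<open>\<mu> i\<close> by one shifts row \<open>i\<close> one column to the
  right, so the right-hand side is a sum of determinants with \<open>k\<close> shifted rows, that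
  is, a signed cofactor of the matrix of size \<open>n + 1\<close>. The bound
  \<open>m + k \<le> n\<close> leaves room for \<open>k\<close> new rows below the shape.\<close>

lemma sum_vertical_strips:
  assumes "\<And>i. i \<ge> m \<Longrightarrow> \<mu> i = 0" "m + k \<le> n"
  shows "h (int k) * det (e_mat e n \<mu>) =
    (\<Sum>S | S \<subseteq> {0..<n} \<and> card S = k. det (e_mat e n (\<lambda>i. \<mu> i + of_bool (i \<in> S))))"
proof -
  have "(\<Sum>S | S \<subseteq> {0..<n} \<and> card S = k. det (e_mat e n (\<lambda>i. \<mu> i + of_bool (i \<in> S)))) =
    (\<Sum>S | S \<subseteq> {0..<n} \<and> card S = k.
      det (mat n n (\<lambda>(i,j). e (int (\<mu> i) - int i + int (if i \<in> S then Suc j else j)))))"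
    unfolding e_mat_def by (intro sum.cong arg_cong[of _ _ det] eq_matI) (auto intro!: arg_cong[of _ _ e])
  also have "\<dots> = (- 1) ^ k * cofactor (e_mat e (Suc n) \<mu>) n (n - k)"
    unfolding e_mat_def using assms(2) by (intro sum_det_shift_rows) simp
  also have "\<dots> = h (int k) * det (e_mat e n \<mu>)"
    using cofactor_e_mat[OF assms] det_e_mat_Suc[of \<mu> n] assms
    by (simp flip: power_add mult_2 mult.assoc)
  finally show ?thesis by simp
qed

text \<open>If \<open>\<mu> (Suc i) = \<mu> i + 1\<close>, then \<open>\<mu> i - i\<close> agrees
  for both rows, so they are equal.\<close>

lemma det_e_mat_not_antimono:
  assumes "\<mu> i < \<mu> (Suc i)" "\<mu> (Suc i) \<le> Suc (\<mu> i)" "Suc i < n"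
  shows "det (e_mat e n \<mu>) = 0"
proof (rule det_identical_rows[OF e_mat_carrier])
  have "\<mu> (Suc i) = Suc (\<mu> i)" using assms by simp
  then have "e (int (\<mu> i) - int i + int j) = e (int (\<mu> (Suc i)) - int (Suc i) + int j)" for j
    by (intro arg_cong[of _ _ e]) simp
  then show "row (e_mat e n \<mu>) i = row (e_mat e n \<mu>) (Suc i)"
    using assms by (intro eq_vecI) (simp_all add: e_mat_def)
qed (use assms in auto)

text \<open>A row gains at most one box, so monotonicity can fail only by one, between rows that
  were equally long; there the determinant has two equal rows.\<close>

lemma pieri:
  assumes "\<And>i. i \<ge> m \<Longrightarrow> \<mu> i = 0" "m + k \<le> n" "antimono \<mu>"
  shows "h (int k) * det (e_mat e n \<mu>) =
    (\<Sum>S | S \<subseteq> {0..<n} \<and> card S = k \<and> antimono (\<lambda>i. \<mu> i + of_bool (i \<in> S)).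
      det (e_mat e n (\<lambda>i. \<mu> i + of_bool (i \<in> S))))"
proof -
  have "h (int k) * det (e_mat e n \<mu>) =
      (\<Sum>S | S \<subseteq> {0..<n} \<and> card S = k. det (e_mat e n (\<lambda>i. \<mu> i + of_bool (i \<in> S))))"
    by (rule sum_vertical_strips) (use assms in auto)
  also have "\<dots> = (\<Sum>S | S \<subseteq> {0..<n} \<and> card S = k \<and> antimono (\<lambda>i. \<mu> i + of_bool (i \<in> S)).
      det (e_mat e n (\<lambda>i. \<mu> i + of_bool (i \<in> S))))"
  proof (rule sum.mono_neutral_right)
    show "\<forall>S\<in>{S. S \<subseteq> {0..<n} \<and> card S = k} -
        {S. S \<subseteq> {0..<n} \<and> card S = k \<and> antimono (\<lambda>i. \<mu> i + of_bool (i \<in> S))}.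
        det (e_mat e n (\<lambda>i. \<mu> i + of_bool (i \<in> S))) = 0"
    proof
      fix S assume "S \<in> {S. S \<subseteq> {0..<n} \<and> card S = k} -
        {S. S \<subseteq> {0..<n} \<and> card S = k \<and> antimono (\<lambda>i. \<mu> i + of_bool (i \<in> S))}"
      then have S: "S \<subseteq> {0..<n}" "card S = k" "\<not> antimono (\<lambda>i. \<mu> i + of_bool (i \<in> S))"
        by auto
      then obtain i where i: "\<not> \<mu> (Suc i) + of_bool (Suc i \<in> S) \<le> \<mu> i + of_bool (i \<in> S)"
        using antimono_iff_le_Suc[of "\<lambda>i. \<mu> i + of_bool (i \<in> S)"] by blast
      moreover have "\<mu> (Suc i) \<le> \<mu> i" using assms(3) by (simp add: antimono_iff_le_Suc)
      ultimately have "Suc i \<in> S" "i \<notin> S" "\<mu> (Suc i) = \<mu> i"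
        by (auto simp: of_bool_def split: if_splits)
      then show "det (e_mat e n (\<lambda>i. \<mu> i + of_bool (i \<in> S))) = 0"
        using S(1) by (intro det_e_mat_not_antimono[of _ i]) auto
    qed
  qed auto
  finally show ?thesis .
qed

end

section \<open>Row words and the free algebra\<close>

lemma carrier_\<U>: "carrier (\<U> N) = {\<gamma>. Poly_Mapping.keys \<gamma> \<subseteq> colored_words N}"
  by (simp add: \<U>_def)

lemma \<U>_simps [simp]:
  "x \<otimes>\<^bsub>\<U> N\<^esub> y = x * y" "\<one>\<^bsub>\<U> N\<^esub> = 1" "\<zero>\<^bsub>\<U> N\<^esub> = 0" "x \<oplus>\<^bsub>\<U> N\<^esub> y = x + y"
  by (simp_all add: \<U>_def)

lemma finsum_\<U>:
  assumes "f \<in> A \<rightarrow> carrier (\<U> N)"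
  shows "finsum (\<U> N) f A = (\<Sum>i\<in>A. f i)"
proof -
  interpret ring "\<U> N" by (rule ring_\<U>)
  show ?thesis
    using assms
    by (induction A rule: infinite_finite_induct) (auto simp: finsum_infinite Pi_iff)
qed

text \<open>The \<open>h_k\<close>, the \<open>e_k\<close> and the products of the
  \<open>h_k\<close> have coefficients 0 and 1 only. Describing them by their supports turns
  identities between them into equalities of sets of words.\<close>

definition word_sum :: "letter list set \<Rightarrow> word_alg" where
  "word_sum A = (\<Sum>w\<in>A. frag_of w)"

lemma lookup_sum_pm: "Poly_Mapping.lookup (\<Sum>i\<in>A. f i) w = (\<Sum>i\<in>A. Poly_Mapping.lookup (f i) w)"
  by (induction A rule: infinite_finite_induct) (simp_all add: lookup_add)

lemma lookup_word_sum: "finite A \<Longrightarrow> Poly_Mapping.lookup (word_sum A) w = of_bool (w \<in> A)"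
  by (simp add: word_sum_def lookup_sum_pm)

lemma keys_word_sum: "finite A \<Longrightarrow> Poly_Mapping.keys (word_sum A) = A"
  by (auto simp: in_keys_iff lookup_word_sum)

lemma word_sum_singleton [simp]: "word_sum {w} = frag_of w" "word_sum {} = 0"
  by (simp_all add: word_sum_def)

lemma frag_of_Nil: "frag_of [] = (1 :: 'a list \<Rightarrow>\<^sub>0 int)"
  by (simp flip: single_one add: zero_list_def)

text \<open>The common length of the left factors fixes the cut, so no word arises from two
  different pairs.\<close>

lemma word_sum_mult:
  assumes "\<And>u. u \<in> A \<Longrightarrow> length u = k"
  shows "word_sum A * word_sum B = word_sum {u @ v | u v. u \<in> A \<and> v \<in> B}"
proof -
  have "{u @ v | u v. u \<in> A \<and> v \<in> B} = (\<lambda>(u, v). u @ v) ` (A \<times> B)" by auto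
  moreover have "inj_on (\<lambda>(u, v). u @ v) (A \<times> B)"
    using assms by (auto simp: inj_on_def)
  moreover have "word_sum A * word_sum B = (\<Sum>(u, v)\<in>A \<times> B. frag_of (u @ v))"
    by (simp add: word_sum_def sum_product mult_single plus_list_def sum.cartesian_product)
  ultimately show ?thesis
    by (simp add: word_sum_def sum.reindex case_prod_unfold)
qed

lemma finite_alphabet: "finite (alphabet N)"
  by (simp add: alphabet_def)

lemma finite_words_length: "finite {w \<in> colored_words N. length w = k \<and> P w}"
  by (rule finite_subset[OF _ finite_lists_length_eq[OF finite_alphabet[of N], of k]])
    (auto simp: lists_eq_set)

lemma h_poly_eq_word_sum:
  "h_poly N lt (int k) = word_sum {w \<in> colored_words N. length w = k \<and> successively (row_le lt) w}"
  by (simp add: h_poly_def word_sum_def)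

lemma e_poly_eq_word_sum:
  "e_poly N lt (int k) = word_sum {w \<in> colored_words N. length w = k \<and> successively (col_ge lt) w}"
  by (simp add: e_poly_def word_sum_def)

lemma h_poly_carrier: "h_poly N lt k \<in> carrier (\<U> N)"
proof (cases "k < 0")
  case False
  then obtain n where "k = int n" by (metis nonneg_int_cases not_less)
  then show ?thesis by (auto simp: carrier_\<U> h_poly_eq_word_sum keys_word_sum finite_words_length)
qed (simp add: carrier_\<U> h_poly_def)

lemma e_poly_carrier: "e_poly N lt k \<in> carrier (\<U> N)"
proof (cases "k < 0")
  case False
  then obtain n where "k = int n" by (metis nonneg_int_cases not_less)
  then show ?thesis by (auto simp: carrier_\<U> e_poly_eq_word_sum keys_word_sum finite_words_length)
qed (simp add: carrier_\<U> e_poly_def)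

lemma h_poly_0 [simp]: "h_poly N lt 0 = 1"
proof -
  have "{w \<in> colored_words N. length w = 0 \<and> successively (row_le lt) w} = {[]}" by auto
  then show ?thesis using h_poly_eq_word_sum[of N lt 0] by (simp add: frag_of_Nil)
qed

lemma e_poly_0 [simp]: "e_poly N lt 0 = 1"
proof -
  have "{w \<in> colored_words N. length w = 0 \<and> successively (col_ge lt) w} = {[]}" by auto
  then show ?thesis using e_poly_eq_word_sum[of N lt 0] by (simp add: frag_of_Nil)
qed

text \<open>The prescribed lengths leave only one candidate for the cut, which is why this is a
  predicate and not a count.\<close>

fun splits :: "(letter \<Rightarrow> letter \<Rightarrow> bool) \<Rightarrow> nat list \<Rightarrow> letter list \<Rightarrow> bool" where
  "splits lt [] w \<longleftrightarrow> w = []"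
| "splits lt (k # ks) w \<longleftrightarrow> k \<le> length w \<and> successively (row_le lt) (take k w) \<and> splits lt ks (drop k w)"

lemma splits_length: "splits lt ks w \<Longrightarrow> length w = sum_list ks"
  by (induction ks arbitrary: w) fastforce+

lemma finite_splits: "finite {w \<in> colored_words N. splits lt ks w}"
  by (rule finite_subset[OF _ finite_words_length[of N "sum_list ks" "\<lambda>_. True"]])
    (auto dest: splits_length)

lemma h_list_eq_word_sum: "h_list N lt ks = word_sum {w \<in> colored_words N. splits lt ks w}"
proof (induction ks)
  case Nil
  have "{w \<in> colored_words N. splits lt [] w} = {[]}" by auto
  then show ?case by (simp add: h_list_def frag_of_Nil)
next
  case (Cons k ks)
  let ?A = "{w \<in> colored_words N. length w = k \<and> successively (row_le lt) w}"
  let ?B = "{w \<in> colored_words N. splits lt ks w}"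
  have "h_list N lt (k # ks) = word_sum ?A * word_sum ?B"
    using Cons by (simp add: h_list_def h_poly_eq_word_sum)
  also have "\<dots> = word_sum {u @ v | u v. u \<in> ?A \<and> v \<in> ?B}"
    by (rule word_sum_mult) auto
  also have "{u @ v | u v. u \<in> ?A \<and> v \<in> ?B} = {w \<in> colored_words N. splits lt (k # ks) w}"
  proof (rule Set.set_eqI, rule iffI)
    fix w assume "w \<in> {w \<in> colored_words N. splits lt (k # ks) w}"
    then have "w = take k w @ drop k w" "take k w \<in> ?A" "drop k w \<in> ?B"
      by (auto simp: lists_eq_set dest: in_set_takeD in_set_dropD)
    then show "w \<in> {u @ v | u v. u \<in> ?A \<and> v \<in> ?B}" by blast
  qed auto
  finally show ?case .
qed

text \<open>The cuts just before and just after the last letter of the longest row prefix have opposite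
  signs and are valid simultaneously; no other cut is valid.\<close>

lemma alternating_cut_sum:
  assumes "w \<noteq> []" "\<And>a b. a \<in> set w \<Longrightarrow> b \<in> set w \<Longrightarrow> R a b \<longleftrightarrow> \<not> C a b"
  shows "(\<Sum>m\<le>length w. (- 1) ^ m * of_bool (successively R (take m w) \<and> successively C (drop m w))) = (0::int)"
  using assms
proof (induction w rule: induct_list012)
  case (3 a b w)
  define f :: "nat \<Rightarrow> 'a list \<Rightarrow> int" where
    "f m w = (- 1) ^ m * of_bool (successively R (take m w) \<and> successively C (drop m w))" for m w
  \<comment> \<open>The cuts 0 and 1 both restrict to the cut 0 of \<open>b # w\<close>. If
    \<open>C a b\<close>, they cancel and all later cuts are invalid; if \<open>R a b\<close>, the
    cut 0 is invalid and the rest is minus the sum for \<open>b # w\<close>.\<close>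
  have f: "f 0 (a # b # w) = (if C a b then f 0 (b # w) else 0)"
    "f (Suc 0) (a # b # w) = - f 0 (b # w)"
    "f (Suc (Suc m)) (a # b # w) = (if R a b then - f (Suc m) (b # w) else 0)" for m
    by (auto simp: f_def)
  have "(\<Sum>m\<le>length (b # w). f m (b # w)) = 0"
    unfolding f_def by (rule 3(2)) (use 3(4) in auto)
  then have IH: "f 0 (b # w) + (\<Sum>m\<le>length w. f (Suc m) (b # w)) = 0"
    by (simp add: sum.atMost_Suc_shift del: sum.atMost_Suc)
  have "(\<Sum>m\<le>length (a # b # w). f m (a # b # w)) =
      f 0 (a # b # w) + (f (Suc 0) (a # b # w) + (\<Sum>m\<le>length w. f (Suc (Suc m)) (a # b # w)))"
    by (simp add: sum.atMost_Suc_shift del: sum.atMost_Suc)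
  also have "\<dots> = 0"
    using IH 3(4)[of a b] unfolding f by (auto simp: sum_negf)
  finally show ?case unfolding f_def .
qed simp_all

lemma lookup_minus_one_power_mult:
  "Poly_Mapping.lookup ((- 1) ^ i * x :: word_alg) w = (- 1) ^ i * Poly_Mapping.lookup x w"
  by (cases "even i") simp_all

context
  fixes N :: nat and lt :: "letter \<Rightarrow> letter \<Rightarrow> bool"
  assumes so: "shuffle_order N lt"
begin

lemma lt_irrefl: "a \<in> alphabet N \<Longrightarrow> \<not> lt a a"
  using so by (auto simp: shuffle_order_def irreflp_on_def)

lemma lt_trans: "lt a b \<Longrightarrow> lt b c \<Longrightarrow> a \<in> alphabet N \<Longrightarrow> b \<in> alphabet N \<Longrightarrow> c \<in> alphabet N \<Longrightarrow> lt a c"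
  using so by (auto simp: shuffle_order_def dest: transp_onD)

lemma lt_linear: "a \<in> alphabet N \<Longrightarrow> b \<in> alphabet N \<Longrightarrow> lt a b \<or> a = b \<or> lt b a"
  using so by (auto simp: shuffle_order_def dest: totalp_onD)

text \<open>Distinct letters are decided by totality and asymmetry, equal ones by their bar. Both
  the alternating identity and the description of descents rest on this complementarity.\<close>

lemma row_le_iff_not_col_ge: "a \<in> alphabet N \<Longrightarrow> b \<in> alphabet N \<Longrightarrow> row_le lt a b \<longleftrightarrow> \<not> col_ge lt a b"
  using lt_irrefl lt_trans lt_linear by (auto simp: row_le_def col_ge_def) blast+

text \<open>The coefficient of a word of length \<open>k\<close> is, up to the global sign
  \<open>(-1)^k\<close>, the alternating sum over its cuts at \<open>m = k - i\<close> into a row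
  word and a column word.\<close>

lemma h_e_alternating:
  assumes "k > 0"
  shows "(\<Sum>i\<le>k. (- 1) ^ i * (h_poly N lt (int (k - i)) * e_poly N lt (int i))) = 0"
proof (rule poly_mapping_eqI)
  fix w
  have he: "h_poly N lt (int (k - i)) * e_poly N lt (int i) =
      word_sum {w \<in> colored_words N. length w = k \<and>
        successively (row_le lt) (take (k - i) w) \<and> successively (col_ge lt) (drop (k - i) w)}"
    if "i \<le> k" for i
  proof -
    let ?A = "{w \<in> colored_words N. length w = k - i \<and> successively (row_le lt) w}"
    let ?B = "{w \<in> colored_words N. length w = i \<and> successively (col_ge lt) w}"
    let ?C = "{w \<in> colored_words N. length w = k \<and>
        successively (row_le lt) (take (k - i) w) \<and> successively (col_ge lt) (drop (k - i) w)}"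
    have "h_poly N lt (int (k - i)) * e_poly N lt (int i) = word_sum {u @ v | u v. u \<in> ?A \<and> v \<in> ?B}"
      unfolding h_poly_eq_word_sum e_poly_eq_word_sum by (rule word_sum_mult) auto
    also have "{u @ v | u v. u \<in> ?A \<and> v \<in> ?B} = ?C"
    proof (rule Set.set_eqI, rule iffI)
      fix w assume "w \<in> ?C"
      then have "w = take (k - i) w @ drop (k - i) w" "take (k - i) w \<in> ?A" "drop (k - i) w \<in> ?B"
        using that by (auto simp: lists_eq_set dest: in_set_takeD in_set_dropD)
      then show "w \<in> {u @ v | u v. u \<in> ?A \<and> v \<in> ?B}" by blast
    qed (use that in auto)
    finally show ?thesis .
  qed
  let ?f = "\<lambda>m. (- 1) ^ m * of_bool (successively (row_le lt) (take m w) \<and>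
      successively (col_ge lt) (drop m w)) :: int"
  have "Poly_Mapping.lookup (\<Sum>i\<le>k. (- 1) ^ i * (h_poly N lt (int (k - i)) * e_poly N lt (int i))) w =
      (\<Sum>i\<le>k. (- 1) ^ k * of_bool (w \<in> colored_words N \<and> length w = k) * ?f (k - i))"
    unfolding lookup_sum_pm
  proof (rule sum.cong[OF refl])
    fix i assume "i \<in> {..k}"
    then have "i \<le> k" by simp
    have "Poly_Mapping.lookup ((- 1) ^ i * (h_poly N lt (int (k - i)) * e_poly N lt (int i))) w =
        (- 1) ^ i * of_bool (w \<in> colored_words N \<and> length w = k \<and>
          successively (row_le lt) (take (k - i) w) \<and> successively (col_ge lt) (drop (k - i) w))"
      by (simp only: lookup_minus_one_power_mult he[OF \<open>i \<le> k\<close>] lookup_word_sum finite_words_length mem_Collect_eq)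
    moreover have "(- 1) ^ i = (- 1) ^ k * (- 1 :: int) ^ (k - i)"
      using \<open>i \<le> k\<close> by (auto simp: minus_one_power_iff)
    ultimately show "Poly_Mapping.lookup ((- 1) ^ i * (h_poly N lt (int (k - i)) * e_poly N lt (int i))) w =
        (- 1) ^ k * of_bool (w \<in> colored_words N \<and> length w = k) * ?f (k - i)"
      by (simp add: of_bool_conj)
  qed
  also have "\<dots> = (\<Sum>m\<le>k. (- 1) ^ k * of_bool (w \<in> colored_words N \<and> length w = k) * ?f m)"
    by (rule sum.reindex_bij_witness[of _ "\<lambda>m. k - m" "\<lambda>m. k - m"]) auto
  also have "\<dots> = (- 1) ^ k * of_bool (w \<in> colored_words N \<and> length w = k) * (\<Sum>m\<le>k. ?f m)"
    by (simp only: sum_distrib_left)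
  also have "\<dots> = 0"
  proof (cases "w \<in> colored_words N \<and> length w = k")
    case True
    then have "(\<Sum>m\<le>length w. ?f m) = 0"
      using assms by (intro alternating_cut_sum) (auto simp: row_le_iff_not_col_ge lists_eq_set subset_eq)
    then show ?thesis using True by simp
  qed simp
  finally show "Poly_Mapping.lookup (\<Sum>i\<le>k. (- 1) ^ i * (h_poly N lt (int (k - i)) * e_poly N lt (int i))) w =
      Poly_Mapping.lookup 0 w" by simp
qed


text \<open>A descent is the relation \<open>col_ge\<close> between neighbours, hence the failure of
  \<open>row_le\<close>.\<close>

lemma Des_iff:
  assumes "w \<in> colored_words N"
  shows "j \<in> Des lt w \<longleftrightarrow> 1 \<le> j \<and> j < length w \<and> \<not> row_le lt (w ! (j - 1)) (w ! j)"
proof (cases "1 \<le> j \<and> j < length w")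
  case True
  then have "w ! (j - 1) \<in> alphabet N" "w ! j \<in> alphabet N"
    using assms by (auto simp: lists_eq_set subset_eq)
  then have "lt (w ! j) (w ! (j - 1)) \<or> (w ! (j - 1) = w ! j \<and> barred (w ! j)) \<longleftrightarrow>
      \<not> row_le lt (w ! (j - 1)) (w ! j)"
    by (auto simp: row_le_iff_not_col_ge col_ge_def)
  then show ?thesis using True by (simp add: Des_def)
qed (auto simp: Des_def)

end

section \<open>Fundamental quasisymmetric functions as indicators of cuts\<close>

text \<open>For increasing \<open>ms\<close> this is the weakly increasing index sequence in which
  each \<open>j\<close> of \<open>ms\<close> occurs \<open>f j\<close> times.\<close>

definition expand :: "(nat \<Rightarrow> nat) \<Rightarrow> nat list \<Rightarrow> nat list" where
  "expand f ms = concat (map (\<lambda>j. replicate (f j) j) ms)"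

lemma set_expand: "set (expand f ms) \<subseteq> set ms"
  by (auto simp: expand_def)

lemma sorted_expand: "sorted ms \<Longrightarrow> sorted (expand f ms)"
  by (induction ms) (auto simp: expand_def sorted_append)

lemma count_list_expand: "distinct ms \<Longrightarrow> count_list (expand f ms) i = (if i \<in> set ms then f i else 0)"
  by (induction ms) (auto simp: expand_def count_list_eq_length_filter filter_replicate)

text \<open>The blocks of \<open>w\<close> lie over the constant runs of the index sequence. Inside
  a run the index does not increase, so \<open>row_le\<close> is forced; between runs it increases,
  and no condition on the letters remains.\<close>

lemma splits_iff_successively:
  assumes "sorted_wrt (<) ms"
  shows "splits lt (map f ms) w \<longleftrightarrow> length (expand f ms) = length w \<and>
    successively (\<lambda>(a, x) (b, y). row_le lt a b \<or> x < y) (zip w (expand f ms))"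
  using assms
proof (induction ms arbitrary: w)
  case (Cons m ms)
  let ?P = "\<lambda>(a, x::nat) (b, y). row_le lt a b \<or> x < y"
  have expand: "expand f (m # ms) = replicate (f m) m @ expand f ms"
    by (simp add: expand_def)
  show ?case
  proof (cases "f m \<le> length w")
    case True
    have zip: "zip w (expand f (m # ms)) = map (\<lambda>a. (a, m)) (take (f m) w) @ zip (drop (f m) w) (expand f ms)"
      using True by (simp add: expand zip_append2 zip_replicate2)
    \<comment> \<open>The junction of two runs is harmless: indices after the first run come from
      \<open>ms\<close> and exceed \<open>m\<close>.\<close>
    have "?P (last (map (\<lambda>a. (a, m)) (take (f m) w))) (hd (zip (drop (f m) w) (expand f ms)))"
      if "map (\<lambda>a. (a, m)) (take (f m) w) \<noteq> []" "zip (drop (f m) w) (expand f ms) \<noteq> []"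
    proof -
      obtain b y where hd: "hd (zip (drop (f m) w) (expand f ms)) = (b, y)" by fastforce
      then have "(b, y) \<in> set (zip (drop (f m) w) (expand f ms))"
        using that(2) by (metis hd_in_set)
      then have "y \<in> set ms" using set_expand[of f ms] set_zip_rightD by fast
      then have "m < y" using Cons.prems by simp
      then show ?thesis
        using that(1) by (simp add: last_map hd)
    qed
    then have "successively ?P (zip w (expand f (m # ms))) \<longleftrightarrow>
        successively (row_le lt) (take (f m) w) \<and> successively ?P (zip (drop (f m) w) (expand f ms))"
      unfolding zip successively_append_iff successively_map by auto
    then show ?thesis
      using Cons.IH[of "drop (f m) w"] Cons.prems True by (auto simp: expand)
  qed (auto simp: expand)
qed (auto simp: expand_def)

lemma lookup_seq_expvec: "Poly_Mapping.lookup (seq_expvec xs) i = count_list xs i"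
  by (induction xs) (auto simp: seq_expvec_def lookup_add lookup_single when_def)

text \<open>A sorted list is determined by its multiplicities, and every index of nonzero exponent
  lies below the degree.\<close>

lemma sorted_seq_expvec_iff:
  "sorted is \<and> seq_expvec is = \<alpha> \<longleftrightarrow> is = expand (Poly_Mapping.lookup \<alpha>) [0..<Poly_Mapping.degree \<alpha>]"
proof -
  let ?is = "expand (Poly_Mapping.lookup \<alpha>) [0..<Poly_Mapping.degree \<alpha>]"
  have count: "count_list ?is i = Poly_Mapping.lookup \<alpha> i" for i
    by (simp add: count_list_expand beyond_degree_lookup_zero)
  have "is = ?is" if "sorted is" "seq_expvec is = \<alpha>"
  proof -
    have "mset is = mset ?is"
      using that by (intro multiset_eqI) (metis count count_mset lookup_seq_expvec)
    then show ?thesis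
      using that sorted_expand[of "[0..<Poly_Mapping.degree \<alpha>]"] by (metis properties_for_sort sorted_upt)
  qed
  moreover have "seq_expvec ?is = \<alpha>"
    by (rule poly_mapping_eqI) (simp add: lookup_seq_expvec count)
  ultimately show ?thesis using sorted_expand[of "[0..<Poly_Mapping.degree \<alpha>]"] by auto
qed

text \<open>The only index sequence with exponent vector \<alpha> is the expanded one, so the count
  is 0 or 1. Its strict increases at the descents say exactly that \<open>w\<close> splits into row
  words.\<close>

lemma Q_series_Des:
  assumes "shuffle_order N lt" "w \<in> colored_words N"
  shows "Q_series (length w) (Des lt w) \<alpha> =
    of_bool (splits lt (map (Poly_Mapping.lookup \<alpha>) [0..<Poly_Mapping.degree \<alpha>]) w)"
proof -
  let ?is = "expand (Poly_Mapping.lookup \<alpha>) [0..<Poly_Mapping.degree \<alpha>]"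
  have "(\<forall>j\<in>Des lt w. ?is ! (j - 1) < ?is ! j) \<longleftrightarrow>
      successively (\<lambda>(a, x) (b, y). row_le lt a b \<or> x < y) (zip w ?is)" if len: "length ?is = length w"
  proof -
    have "(\<forall>j\<in>Des lt w. ?is ! (j - 1) < ?is ! j) \<longleftrightarrow>
        (\<forall>i. Suc i < length w \<longrightarrow> row_le lt (w ! i) (w ! Suc i) \<or> ?is ! i < ?is ! Suc i)"
      (is "?L \<longleftrightarrow> ?R")
    proof
      assume L: ?L
      show ?R
      proof (intro allI impI)
        fix i assume "Suc i < length w"
        then show "row_le lt (w ! i) (w ! Suc i) \<or> ?is ! i < ?is ! Suc i"
          using bspec[OF L, of "Suc i"] Des_iff[OF assms, of "Suc i"] by (simp del: upt_Suc) blast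
      qed
    next
      assume R: ?R
      show ?L
      proof
        fix j assume "j \<in> Des lt w"
        then have j: "1 \<le> j" "j < length w" "\<not> row_le lt (w ! (j - 1)) (w ! j)"
          using Des_iff[OF assms] by blast+
        then obtain i where "j = Suc i" by (metis Suc_le_D One_nat_def)
        then show "?is ! (j - 1) < ?is ! j"
          using R[rule_format, of i] j by simp
      qed
    qed
    then show ?thesis
      unfolding successively_conv_nth using len by simp
  qed
  then have "length ?is = length w \<and> (\<forall>j\<in>Des lt w. ?is ! (j - 1) < ?is ! j) \<longleftrightarrow>
      splits lt (map (Poly_Mapping.lookup \<alpha>) [0..<Poly_Mapping.degree \<alpha>]) w"
    by (subst splits_iff_successively) (auto simp: sorted_wrt_upt)
  moreover have "{is. length is = length w \<and> sorted is \<and> (\<forall>j\<in>Des lt w. is ! (j - 1) < is ! j) \<and> seq_expvec is = \<alpha>} =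
      {is. is = ?is \<and> length is = length w \<and> (\<forall>j\<in>Des lt w. is ! (j - 1) < is ! j)}"
    by (rule Collect_cong) (use sorted_seq_expvec_iff[of _ \<alpha>] in blast)
  moreover have "{is. is = x \<and> P is} = (if P x then {x} else {})" for x :: "nat list" and P
    by auto
  ultimately show ?thesis unfolding Q_series_def by simp
qed

section \<open>The series \<open>\<Omega>\<close>\<close>

lemma PS_simps:
  "carrier (PS R) = {f. \<forall>\<alpha>. f \<alpha> \<in> carrier R}"
  "\<one>\<^bsub>PS R\<^esub> = (\<lambda>\<alpha>. if \<alpha> = 0 then \<one>\<^bsub>R\<^esub> else \<zero>\<^bsub>R\<^esub>)"
  "\<zero>\<^bsub>PS R\<^esub> = (\<lambda>\<alpha>. \<zero>\<^bsub>R\<^esub>)"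
  "f \<oplus>\<^bsub>PS R\<^esub> g = (\<lambda>\<alpha>. f \<alpha> \<oplus>\<^bsub>R\<^esub> g \<alpha>)"
  by (simp_all add: PS_def)

lemma PS_carrier_iff: "f \<in> carrier (PS (\<U> N)) \<longleftrightarrow> (\<forall>\<alpha>. f \<alpha> \<in> carrier (\<U> N))"
  by (simp add: PS_simps)

lemma \<U>_closed:
  "x \<in> carrier (\<U> N) \<Longrightarrow> y \<in> carrier (\<U> N) \<Longrightarrow> x * y \<in> carrier (\<U> N)"
  "x \<in> carrier (\<U> N) \<Longrightarrow> y \<in> carrier (\<U> N) \<Longrightarrow> x + y \<in> carrier (\<U> N)"
  "x \<in> carrier (\<U> N) \<Longrightarrow> y \<in> carrier (\<U> N) \<Longrightarrow> x - y \<in> carrier (\<U> N)"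
  "x \<in> carrier (\<U> N) \<Longrightarrow> - x \<in> carrier (\<U> N)"
  "0 \<in> carrier (\<U> N)" "1 \<in> carrier (\<U> N)"
proof -
  interpret ring "\<U> N" by (rule ring_\<U>)
  show "x \<in> carrier (\<U> N) \<Longrightarrow> y \<in> carrier (\<U> N) \<Longrightarrow> x * y \<in> carrier (\<U> N)"
    "x \<in> carrier (\<U> N) \<Longrightarrow> y \<in> carrier (\<U> N) \<Longrightarrow> x + y \<in> carrier (\<U> N)"
    "0 \<in> carrier (\<U> N)" "1 \<in> carrier (\<U> N)"
    using m_closed[of x y] a_closed[of x y] zero_closed one_closed by simp_all
  show "x \<in> carrier (\<U> N) \<Longrightarrow> y \<in> carrier (\<U> N) \<Longrightarrow> x - y \<in> carrier (\<U> N)"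
    "x \<in> carrier (\<U> N) \<Longrightarrow> - x \<in> carrier (\<U> N)"
    using keys_diff[of x y] by (auto simp: carrier_\<U>)
qed

lemma \<U>_sum_closed: "(\<And>i. i \<in> A \<Longrightarrow> f i \<in> carrier (\<U> N)) \<Longrightarrow> (\<Sum>i\<in>A. f i) \<in> carrier (\<U> N)"
  by (induction A rule: infinite_finite_induct) (auto intro: \<U>_closed)

lemma PS_mult:
  assumes "f \<in> carrier (PS (\<U> N))" "g \<in> carrier (PS (\<U> N))"
  shows "(f \<otimes>\<^bsub>PS (\<U> N)\<^esub> g) \<alpha> = (\<Sum>p | fst p + snd p = \<alpha>. f (fst p) * g (snd p))"
  using assms by (simp add: PS_def) (rule finsum_\<U>, auto intro: \<U>_closed)

lemma PS_mult_closed: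
  assumes "f \<in> carrier (PS (\<U> N))" "g \<in> carrier (PS (\<U> N))"
  shows "f \<otimes>\<^bsub>PS (\<U> N)\<^esub> g \<in> carrier (PS (\<U> N))"
  using assms unfolding PS_carrier_iff PS_mult[OF assms] by (auto intro!: \<U>_sum_closed \<U>_closed)

text \<open>Needed to evaluate the inverse in \<open>c_factor\<close>: two-sided inverses are unique
  in a monoid.\<close>

lemma monoid_PS: "Group.monoid (PS (\<U> N))"
proof (rule monoidI)
  fix f g h
  assume fgh: "f \<in> carrier (PS (\<U> N))" "g \<in> carrier (PS (\<U> N))" "h \<in> carrier (PS (\<U> N))"
  let ?anti = "\<lambda>\<alpha>::expvec. {p. fst p + snd p = \<alpha>}"
  show "f \<otimes>\<^bsub>PS (\<U> N)\<^esub> g \<otimes>\<^bsub>PS (\<U> N)\<^esub> h = f \<otimes>\<^bsub>PS (\<U> N)\<^esub> (g \<otimes>\<^bsub>PS (\<U> N)\<^esub> h)"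
  proof
    fix \<alpha>
    have "(f \<otimes>\<^bsub>PS (\<U> N)\<^esub> g \<otimes>\<^bsub>PS (\<U> N)\<^esub> h) \<alpha> =
        (\<Sum>p\<in>?anti \<alpha>. \<Sum>q\<in>?anti (fst p). f (fst q) * g (snd q) * h (snd p))"
      using fgh by (simp add: PS_mult PS_mult_closed sum_distrib_right)
    also have "\<dots> = (\<Sum>(p, q)\<in>Sigma (?anti \<alpha>) (\<lambda>p. ?anti (fst p)). f (fst q) * g (snd q) * h (snd p))"
      by (rule sum.Sigma) (simp_all add: finite_antidiagonal)
    \<comment> \<open>Both double sums run over the triples of exponent vectors with sum \<alpha>,
      bracketed differently.\<close>
    also have "\<dots> = (\<Sum>(p, q)\<in>Sigma (?anti \<alpha>) (\<lambda>p. ?anti (snd p)). f (fst p) * g (fst q) * h (snd q))"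
      by (rule sum.reindex_bij_witness[of _ "\<lambda>(p, q). ((fst p + fst q, snd q), (fst p, fst q))"
            "\<lambda>(p, q). ((fst q, snd q + snd p), (snd q, snd p))"]) (auto simp: add.assoc)
    also have "\<dots> = (\<Sum>p\<in>?anti \<alpha>. \<Sum>q\<in>?anti (snd p). f (fst p) * g (fst q) * h (snd q))"
      by (rule sum.Sigma[symmetric]) (simp_all add: finite_antidiagonal)
    also have "\<dots> = (f \<otimes>\<^bsub>PS (\<U> N)\<^esub> (g \<otimes>\<^bsub>PS (\<U> N)\<^esub> h)) \<alpha>"
      using fgh by (simp add: PS_mult PS_mult_closed sum_distrib_left mult.assoc)
    finally show "(f \<otimes>\<^bsub>PS (\<U> N)\<^esub> g \<otimes>\<^bsub>PS (\<U> N)\<^esub> h) \<alpha> =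
        (f \<otimes>\<^bsub>PS (\<U> N)\<^esub> (g \<otimes>\<^bsub>PS (\<U> N)\<^esub> h)) \<alpha>" .
  qed
next
  show one: "\<one>\<^bsub>PS (\<U> N)\<^esub> \<in> carrier (PS (\<U> N))"
    by (simp add: PS_simps \<U>_closed)
  fix f assume f: "f \<in> carrier (PS (\<U> N))"
  show "\<one>\<^bsub>PS (\<U> N)\<^esub> \<otimes>\<^bsub>PS (\<U> N)\<^esub> f = f"
  proof
    fix \<alpha>
    have "(\<one>\<^bsub>PS (\<U> N)\<^esub> \<otimes>\<^bsub>PS (\<U> N)\<^esub> f) \<alpha> = (\<Sum>p\<in>{(0 :: expvec, \<alpha>)}. f (snd p))"
      unfolding PS_mult[OF one f]
      by (rule sum.mono_neutral_cong_right) (auto simp: finite_antidiagonal PS_simps split: if_splits)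
    then show "(\<one>\<^bsub>PS (\<U> N)\<^esub> \<otimes>\<^bsub>PS (\<U> N)\<^esub> f) \<alpha> = f \<alpha>" by simp
  qed
  show "f \<otimes>\<^bsub>PS (\<U> N)\<^esub> \<one>\<^bsub>PS (\<U> N)\<^esub> = f"
  proof
    fix \<alpha>
    have "(f \<otimes>\<^bsub>PS (\<U> N)\<^esub> \<one>\<^bsub>PS (\<U> N)\<^esub>) \<alpha> = (\<Sum>p\<in>{(\<alpha>, 0 :: expvec)}. f (fst p))"
      unfolding PS_mult[OF f one]
      by (rule sum.mono_neutral_cong_right) (auto simp: finite_antidiagonal PS_simps split: if_splits)
    then show "(f \<otimes>\<^bsub>PS (\<U> N)\<^esub> \<one>\<^bsub>PS (\<U> N)\<^esub>) \<alpha> = f \<alpha>" by simp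
  qed
qed (rule PS_mult_closed)

lemma abelian_group_PS: "abelian_group (PS (\<U> N))"
proof (rule abelian_groupI)
  fix f assume "f \<in> carrier (PS (\<U> N))"
  then show "\<exists>g\<in>carrier (PS (\<U> N)). g \<oplus>\<^bsub>PS (\<U> N)\<^esub> f = \<zero>\<^bsub>PS (\<U> N)\<^esub>"
    by (intro bexI[of _ "\<lambda>\<alpha>. - f \<alpha>"]) (auto simp: PS_simps \<U>_closed)
qed (auto simp: PS_simps \<U>_closed algebra_simps)

lemma PS_minus:
  assumes "f \<in> carrier (PS (\<U> N))" "g \<in> carrier (PS (\<U> N))"
  shows "f \<ominus>\<^bsub>PS (\<U> N)\<^esub> g = (\<lambda>\<alpha>. f \<alpha> - g \<alpha>)"
proof -
  interpret abelian_group "PS (\<U> N)" by (rule abelian_group_PS)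
  have "\<ominus>\<^bsub>PS (\<U> N)\<^esub> g = (\<lambda>\<alpha>. - g \<alpha>)"
    by (rule minus_equality) (use assms in \<open>auto simp: PS_simps \<U>_closed\<close>)
  then show ?thesis by (simp add: a_minus_def PS_simps)
qed

section \<open>Series in a single variable\<close>

text \<open>The series \<open>\<Sum>k. a k * x^k\<close> in the variable \<open>x\<close> of index
  \<open>j\<close>. All factors of \<open>\<Omega>\<close> belonging to one variable have this form,
  and their products are Cauchy products of coefficient sequences.\<close>

definition var_series :: "nat \<Rightarrow> (nat \<Rightarrow> word_alg) \<Rightarrow> expvec \<Rightarrow> word_alg" where
  "var_series j a \<alpha> = (if Poly_Mapping.keys \<alpha> \<subseteq> {j} then a (Poly_Mapping.lookup \<alpha> j) else 0)"

lemma var_series_carrier: "(\<And>k. a k \<in> carrier (\<U> N)) \<Longrightarrow> var_series j a \<in> carrier (PS (\<U> N))"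
  by (simp add: PS_carrier_iff var_series_def \<U>_closed)

lemma keys_add_expvec: "Poly_Mapping.keys (\<alpha> + \<beta> :: expvec) = Poly_Mapping.keys \<alpha> \<union> Poly_Mapping.keys \<beta>"
  by (auto simp: in_keys_iff lookup_add)

lemma keys_subset_singleton_iff:
  "Poly_Mapping.keys (\<alpha> :: expvec) \<subseteq> {j} \<longleftrightarrow> \<alpha> = Poly_Mapping.single j (Poly_Mapping.lookup \<alpha> j)"
  by (auto simp: poly_mapping_eq_iff fun_eq_iff lookup_single in_keys_iff when_def)

lemma var_series_mult:
  assumes "\<And>k. a k \<in> carrier (\<U> N)" "\<And>k. b k \<in> carrier (\<U> N)"
  shows "var_series j a \<otimes>\<^bsub>PS (\<U> N)\<^esub> var_series j b = var_series j (\<lambda>k. \<Sum>i\<le>k. a i * b (k - i))"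
proof
  fix \<alpha> :: expvec
  note mult = PS_mult[OF var_series_carrier[of a, OF assms(1)] var_series_carrier[of b, OF assms(2)]]
  show "(var_series j a \<otimes>\<^bsub>PS (\<U> N)\<^esub> var_series j b) \<alpha> = var_series j (\<lambda>k. \<Sum>i\<le>k. a i * b (k - i)) \<alpha>"
  proof (cases "Poly_Mapping.keys \<alpha> \<subseteq> {j}")
    case True
    define k where "k = Poly_Mapping.lookup \<alpha> j"
    have \<alpha>: "\<alpha> = Poly_Mapping.single j k" using True by (simp add: keys_subset_singleton_iff k_def)
    have "(var_series j a \<otimes>\<^bsub>PS (\<U> N)\<^esub> var_series j b) \<alpha> =
        (\<Sum>p | fst p + snd p = \<alpha>. a (Poly_Mapping.lookup (fst p) j) * b (Poly_Mapping.lookup (snd p) j))"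
      unfolding mult using True by (intro sum.cong) (auto simp: var_series_def keys_add_expvec)
    also have "\<dots> = (\<Sum>i\<le>k. a i * b (k - i))"
    proof (rule sum.reindex_bij_witness[of _ "\<lambda>i. (Poly_Mapping.single j i, Poly_Mapping.single j (k - i))"
          "\<lambda>p. Poly_Mapping.lookup (fst p) j"])
      fix p :: "expvec \<times> expvec" assume p: "p \<in> {p. fst p + snd p = \<alpha>}"
      then have "Poly_Mapping.keys (fst p) \<subseteq> {j}" "Poly_Mapping.keys (snd p) \<subseteq> {j}"
        using True by (auto simp: keys_add_expvec)
      moreover have "Poly_Mapping.lookup (fst p) j + Poly_Mapping.lookup (snd p) j = k"
        using p by (auto simp: k_def lookup_add)
      ultimately show "(Poly_Mapping.single j (Poly_Mapping.lookup (fst p) j),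
          Poly_Mapping.single j (k - Poly_Mapping.lookup (fst p) j)) = p"
        "Poly_Mapping.lookup (fst p) j \<in> {..k}"
        "a (Poly_Mapping.lookup (fst p) j) * b (k - Poly_Mapping.lookup (fst p) j) =
          a (Poly_Mapping.lookup (fst p) j) * b (Poly_Mapping.lookup (snd p) j)"
        by (auto simp: keys_subset_singleton_iff prod_eq_iff)
    qed (auto simp: \<alpha> simp flip: single_add)
    finally show ?thesis using True by (simp add: var_series_def k_def)
  next
    case False
    have "(var_series j a \<otimes>\<^bsub>PS (\<U> N)\<^esub> var_series j b) \<alpha> = 0"
      unfolding mult
    proof (rule sum.neutral, rule ballI)
      fix p :: "expvec \<times> expvec" assume "p \<in> {p. fst p + snd p = \<alpha>}"
      then have "\<not> (Poly_Mapping.keys (fst p) \<subseteq> {j} \<and> Poly_Mapping.keys (snd p) \<subseteq> {j})"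
        using False by (auto simp: keys_add_expvec)
      then show "var_series j a (fst p) * var_series j b (snd p) = 0"
        by (auto simp: var_series_def)
    qed
    then show ?thesis using False by (simp add: var_series_def)
  qed
qed

lemma var_series_one: "\<one>\<^bsub>PS (\<U> N)\<^esub> = var_series j (\<lambda>k. if k = 0 then 1 else 0)"
proof
  fix \<alpha> :: expvec
  have "Poly_Mapping.keys \<alpha> \<subseteq> {j} \<and> Poly_Mapping.lookup \<alpha> j = 0 \<longleftrightarrow> \<alpha> = 0"
    by (auto simp: keys_subset_singleton_iff)
  then show "\<one>\<^bsub>PS (\<U> N)\<^esub> \<alpha> = var_series j (\<lambda>k. if k = 0 then 1 else 0) \<alpha>"
    by (auto simp: PS_simps var_series_def)
qed

lemma frag_of_carrier: "frag_of w \<in> carrier (\<U> N) \<longleftrightarrow> w \<in> colored_words N"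
  by (simp add: carrier_\<U>)

lemma add_pow_\<U>:
  assumes "x \<in> carrier (\<U> N)"
  shows "[k] \<cdot>\<^bsub>\<U> N\<^esub> x = of_int k * x"
proof -
  interpret ring "\<U> N" by (rule ring_\<U>)
  have nat: "[n] \<cdot>\<^bsub>\<U> N\<^esub> x = of_nat n * x" for n :: nat
    by (induction n) (auto simp: add.nat_pow_Suc algebra_simps)
  have minus: "\<ominus>\<^bsub>\<U> N\<^esub> y = - y" if "y \<in> carrier (\<U> N)" for y
    by (rule minus_equality) (use that in \<open>auto simp: \<U>_closed\<close>)
  have closed: "of_nat n * x \<in> carrier (\<U> N)" for n :: nat
    using add.nat_pow_closed[OF assms, of n] unfolding nat .
  show ?thesis
  proof (cases "k \<ge> 0")
    case True
    then show ?thesis by (simp add: add_pow_int_ge nat)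
  next
    case False
    then have "[k] \<cdot>\<^bsub>\<U> N\<^esub> x = - (of_nat (nat (- k)) * x)"
      by (simp only: add_pow_int_lt nat minus[OF closed] not_le)
    also have "(of_nat (nat (- k)) :: word_alg) = - of_int k"
      using False by simp
    finally show ?thesis by simp
  qed
qed

lemma ux_eq_var_series:
  assumes "z \<in> alphabet N"
  shows "ux N z j = var_series j (\<lambda>k. if k = 1 then frag_of [z] else 0)"
proof
  fix \<alpha> :: expvec
  have "frag_of [z] \<in> carrier (\<U> N)" using assms by (simp add: frag_of_carrier)
  moreover have "\<alpha> = Poly_Mapping.single j 1 \<longleftrightarrow> Poly_Mapping.keys \<alpha> \<subseteq> {j} \<and> Poly_Mapping.lookup \<alpha> j = 1"
    by (auto simp: keys_subset_singleton_iff)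
  ultimately show "ux N z j \<alpha> = var_series j (\<lambda>k. if k = 1 then frag_of [z] else 0) \<alpha>"
    by (auto simp: ux_def ps_times_def xpow_def add_pow_\<U> var_series_def)
qed

definition c_coeff :: "letter \<Rightarrow> nat \<Rightarrow> word_alg" where
  "c_coeff z k = (if barred z \<and> k > 1 then 0 else frag_of (replicate k z))"

lemma c_coeff_carrier: "z \<in> alphabet N \<Longrightarrow> c_coeff z k \<in> carrier (\<U> N)"
  by (auto simp: c_coeff_def frag_of_carrier \<U>_closed lists_eq_set)

lemma c_factor_eq_var_series:
  assumes z: "z \<in> alphabet N"
  shows "c_factor N z j = var_series j (c_coeff z)"
proof (cases "barred z")
  case True
  have "c_coeff z k = (if k = 0 then 1 else 0) + (if k = 1 then frag_of [z] else 0)" for k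
  proof -
    consider "k = 0" | "k = 1" | "k > 1" by linarith
    then show ?thesis using True by cases (simp_all add: c_coeff_def frag_of_Nil)
  qed
  then show ?thesis
    using True by (auto simp: c_factor_def ux_eq_var_series[OF z] var_series_one[of _ j] PS_simps(4) var_series_def fun_eq_iff)
next
  case False
  interpret Group.monoid "PS (\<U> N)" by (rule monoid_PS)
  let ?d = "\<lambda>k::nat. (if k = 0 then 1 else 0) - (if k = 1 then frag_of [z] else 0) :: word_alg"
  have d: "?d k \<in> carrier (\<U> N)" for k
    using z by (auto intro!: \<U>_closed simp: frag_of_carrier)
  have c: "c_coeff z k \<in> carrier (\<U> N)" for k
    by (rule c_coeff_carrier[OF z])
  have "\<one>\<^bsub>PS (\<U> N)\<^esub> \<ominus>\<^bsub>PS (\<U> N)\<^esub> ux N z j = var_series j ?d"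
    using z by (subst PS_minus)
      (auto simp: ux_eq_var_series var_series_one[of _ j] var_series_def fun_eq_iff frag_of_carrier \<U>_closed intro!: var_series_carrier)
  moreover have "inv\<^bsub>PS (\<U> N)\<^esub> (var_series j ?d) = var_series j (c_coeff z)"
  proof (rule inv_char)
    \<comment> \<open>For \<open>k > 0\<close> only \<open>1 * u^k\<close> and
      \<open>- u * u^(k-1)\<close> survive, and they cancel. Both sides are checked because the
      coefficients do not commute.\<close>
    have conv: "(\<Sum>i\<le>k. ?d i * c_coeff z (k - i)) = (if k = 0 then 1 else 0)"
      "(\<Sum>i\<le>k. c_coeff z i * ?d (k - i)) = (if k = 0 then 1 else 0)" for k
    proof -
      have "(\<Sum>i\<le>k. ?d i * c_coeff z (k - i)) = (\<Sum>i\<in>{i. i \<le> k \<and> i \<le> 1}. ?d i * c_coeff z (k - i))"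
        by (rule sum.mono_neutral_right) auto
      also have "{i. i \<le> k \<and> i \<le> 1} = (if k = 0 then {0} else {0, 1})" by auto
      finally show "(\<Sum>i\<le>k. ?d i * c_coeff z (k - i)) = (if k = 0 then 1 else 0)"
        using False by (cases k) (auto simp: c_coeff_def frag_of_Nil mult_single plus_list_def)
      have "(\<Sum>i\<le>k. c_coeff z i * ?d (k - i)) = (\<Sum>i\<in>{i. i \<le> k \<and> k - i \<le> 1}. c_coeff z i * ?d (k - i))"
        by (rule sum.mono_neutral_right) auto
      also have "{i. i \<le> k \<and> k - i \<le> 1} = (if k = 0 then {0} else {k - 1, k})" by auto
      finally show "(\<Sum>i\<le>k. c_coeff z i * ?d (k - i)) = (if k = 0 then 1 else 0)"
        using False by (cases k) (auto simp: c_coeff_def frag_of_Nil mult_single plus_list_def replicate_append_same)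
    qed
    show "var_series j ?d \<otimes>\<^bsub>PS (\<U> N)\<^esub> var_series j (c_coeff z) = \<one>\<^bsub>PS (\<U> N)\<^esub>"
      "var_series j (c_coeff z) \<otimes>\<^bsub>PS (\<U> N)\<^esub> var_series j ?d = \<one>\<^bsub>PS (\<U> N)\<^esub>"
      unfolding var_series_mult[OF d c] var_series_mult[OF c d] conv by (rule var_series_one[symmetric])+
  qed (use var_series_carrier d c in auto)
  ultimately show ?thesis using False by (simp add: c_factor_def)
qed

section \<open>The product over the alphabet and over the variables\<close>

lemma word_sum_UN:
  assumes "finite I" "\<And>i. i \<in> I \<Longrightarrow> finite (A i)" "\<And>i j. i \<in> I \<Longrightarrow> j \<in> I \<Longrightarrow> i \<noteq> j \<Longrightarrow> A i \<inter> A j = {}"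
  shows "(\<Sum>i\<in>I. word_sum (A i)) = word_sum (\<Union>i\<in>I. A i)"
  unfolding word_sum_def by (rule sum.UNION_disjoint[symmetric]) (use assms in auto)

text \<open>The support of \<open>h_k\<close> with the letters restricted to \<open>zs\<close>; the
  restriction allows induction along the ordered alphabet.\<close>

definition row_words :: "(letter \<Rightarrow> letter \<Rightarrow> bool) \<Rightarrow> letter list \<Rightarrow> nat \<Rightarrow> letter list set" where
  "row_words lt zs k = {w \<in> lists (set zs). length w = k \<and> successively (row_le lt) w}"

lemma finite_row_words: "finite (row_words lt zs k)"
  by (rule finite_subset[OF _ finite_lists_length_eq[OF finite_set[of zs], of k]])
    (auto simp: lists_eq_set row_words_def)

context
  fixes N :: nat and lt :: "letter \<Rightarrow> letter \<Rightarrow> bool"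
  assumes so: "shuffle_order N lt"
begin

text \<open>As \<open>z\<close> is the least letter, no other letter can precede it in a row word.
  Its occurrences therefore form an initial block, of length at most one if \<open>z\<close> is
  barred.\<close>

lemma row_word_Cons_split:
  assumes "sorted_wrt lt (z # zs)" "set (z # zs) \<subseteq> alphabet N"
    and "w \<in> lists (set (z # zs))" "successively (row_le lt) w"
  shows "\<exists>i v. w = replicate i z @ v \<and> v \<in> lists (set zs) \<and> successively (row_le lt) v \<and> (barred z \<longrightarrow> i \<le> 1)"
  using assms(3,4)
proof (induction w rule: list.induct)
  case (Cons a w)
  have "w \<in> lists (set (z # zs))" "successively (row_le lt) w"
    using Cons.prems by (auto simp: successively_Cons)
  from Cons.IH[OF this] obtain i v where w: "w = replicate i z @ v" "v \<in> lists (set zs)"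
      "successively (row_le lt) v" "barred z \<longrightarrow> i \<le> 1"
    by blast
  have step: "w = [] \<or> row_le lt a (hd w)"
    using Cons.prems by (auto simp: successively_Cons)
  show ?case
  proof (cases "a = z")
    case True
    have "i = 0" if "barred z"
    proof (rule ccontr)
      assume "i \<noteq> 0"
      then have "row_le lt z z" using step w(1) True by (cases i) auto
      then show False using that assms(2) lt_irrefl[OF so, of z] by (auto simp: row_le_def)
    qed
    then show ?thesis
      using w True by (intro exI[of _ "Suc i"] exI[of _ v]) auto
  next
    case False
    then have "a \<in> set zs" using Cons.prems by auto
    then have "lt z a" "a \<in> alphabet N" "z \<in> alphabet N" using assms(1,2) by auto
    have "i = 0"
    proof (rule ccontr)
      assume "i \<noteq> 0"
      then have "row_le lt a z" using step w(1) by (cases i) auto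
      then have "lt a z" using False by (simp add: row_le_def)
      then show False
        using lt_trans[OF so \<open>lt a z\<close> \<open>lt z a\<close>] lt_irrefl[OF so, of a] \<open>a \<in> alphabet N\<close> \<open>z \<in> alphabet N\<close> by blast
    qed
    then show ?thesis
      using w Cons.prems \<open>a \<in> set zs\<close> by (intro exI[of _ 0] exI[of _ "a # v"]) auto
  qed
qed simp

lemma row_word_Cons_join:
  assumes "sorted_wrt lt (z # zs)"
    and "v \<in> lists (set zs)" "successively (row_le lt) v" "barred z \<longrightarrow> i \<le> 1"
  shows "successively (row_le lt) (replicate i z @ v)"
  using assms(4)
proof (induction i)
  case (Suc i)
  have "row_le lt z (hd v)" if "v \<noteq> []"
    using assms(1,2) that by (cases v) (auto simp: row_le_def)
  then show ?case
    using Suc by (cases i) (auto simp: successively_Cons row_le_def)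
qed (use assms in simp)

text \<open>Row words are sorted by the length \<open>i\<close> of their initial block of
  \<open>z\<close>; \<open>c_coeff z i\<close> is zero exactly for the block lengths forbidden by a
  bar.\<close>

lemma row_words_conv:
  assumes "sorted_wrt lt (z # zs)" "set (z # zs) \<subseteq> alphabet N"
  shows "(\<Sum>i\<le>k. c_coeff z i * word_sum (row_words lt zs (k - i))) = word_sum (row_words lt (z # zs) k)"
proof -
  define A where "A i = (if barred z \<and> i > 1 then {} else {replicate i z @ v | v. v \<in> row_words lt zs (k - i)})" for i
  have z: "z \<notin> set zs"
    using assms lt_irrefl[OF so, of z] by auto
  have "c_coeff z i * word_sum (row_words lt zs (k - i)) = word_sum (A i)" for i
    using word_sum_mult[of "{replicate i z}" i "row_words lt zs (k - i)"]
    by (auto simp: c_coeff_def A_def)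
  moreover have "A i \<inter> A j = {}" if "i \<noteq> j" for i j
  proof -
    \<comment> \<open>Since \<open>z\<close> does not occur in \<open>v\<close>, the block length
      can be recovered from the word, so the sets \<open>A i\<close> are disjoint.\<close>
    have "length (takeWhile (\<lambda>x. x = z) w) = i" if "w \<in> A i" for w i
    proof -
      have "w \<in> {replicate i z @ v | v. v \<in> row_words lt zs (k - i)}"
        using that by (simp add: A_def split: if_splits)
      then obtain v where v: "w = replicate i z @ v" "v \<in> row_words lt zs (k - i)" by blast
      then have "takeWhile (\<lambda>x. x = z) v = []"
        using z by (cases v) (auto simp: row_words_def)
      moreover have "takeWhile (\<lambda>x. x = z) (replicate i z @ v) = replicate i z @ takeWhile (\<lambda>x. x = z) v"
        by (rule takeWhile_append2) simp
      ultimately show ?thesis by (simp add: v(1))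
    qed
    then show ?thesis using that by blast
  qed
  moreover have "finite (A i)" for i
    using finite_row_words by (auto simp: A_def)
  moreover have "(\<Union>i\<in>{..k}. A i) = row_words lt (z # zs) k"
  proof (rule Set.set_eqI, rule iffI)
    fix w assume "w \<in> (\<Union>i\<in>{..k}. A i)"
    then obtain i v where "i \<le> k" "w = replicate i z @ v" "v \<in> row_words lt zs (k - i)" "barred z \<longrightarrow> i \<le> 1"
      by (auto simp: A_def split: if_splits)
    then show "w \<in> row_words lt (z # zs) k"
      using row_word_Cons_join[OF assms(1), of v i] by (auto simp: row_words_def lists_eq_set)
  next
    fix w assume w: "w \<in> row_words lt (z # zs) k"
    then obtain i v where iv: "w = replicate i z @ v" "v \<in> lists (set zs)" "successively (row_le lt) v" "barred z \<longrightarrow> i \<le> 1"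
      using row_word_Cons_split[OF assms, of w] by (auto simp: row_words_def)
    moreover have "length w = k" using w by (simp add: row_words_def)
    ultimately have "i \<le> k" "w \<in> A i"
      by (auto simp: A_def row_words_def)
    then show "w \<in> (\<Union>i\<in>{..k}. A i)" by blast
  qed
  ultimately show ?thesis
    by (simp add: word_sum_UN)
qed

lemma row_words_carrier: "set zs \<subseteq> alphabet N \<Longrightarrow> word_sum (row_words lt zs k) \<in> carrier (\<U> N)"
  by (auto simp: carrier_\<U> keys_word_sum finite_row_words) (auto simp: row_words_def lists_eq_set)

lemma list_prod_c_factor:
  assumes "sorted_wrt lt zs" "set zs \<subseteq> alphabet N"
  shows "list_prod (PS (\<U> N)) (map (\<lambda>z. c_factor N z j) zs) = var_series j (\<lambda>k. word_sum (row_words lt zs k))"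
  using assms
proof (induction zs)
  case Nil
  have "row_words lt [] k = (if k = 0 then {[]} else {})" for k
    by (auto simp: row_words_def)
  then have "word_sum (row_words lt [] k) = (if k = 0 then 1 else 0)" for k
    by (simp add: frag_of_Nil)
  then show ?case by (simp add: list_prod_def var_series_one[of _ j])
next
  case (Cons z zs)
  have "list_prod (PS (\<U> N)) (map (\<lambda>z. c_factor N z j) (z # zs)) =
      var_series j (c_coeff z) \<otimes>\<^bsub>PS (\<U> N)\<^esub> var_series j (\<lambda>k. word_sum (row_words lt zs k))"
    using Cons by (simp add: list_prod_def c_factor_eq_var_series)
  also have "\<dots> = var_series j (\<lambda>k. \<Sum>i\<le>k. c_coeff z i * word_sum (row_words lt zs (k - i)))"
    by (rule var_series_mult) (use Cons.prems c_coeff_carrier row_words_carrier in auto)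
  finally show ?case
    by (simp add: row_words_conv[OF Cons.prems])
qed

lemma ordered_letters: "set (ordered_letters N lt) = alphabet N" "sorted_wrt lt (ordered_letters N lt)"
  using theI'[OF ex1_ordered_letters[OF so]] by (auto simp: ordered_letters_def)

lemma list_prod_ordered_letters:
  "list_prod (PS (\<U> N)) (map (\<lambda>z. c_factor N z j) (ordered_letters N lt)) =
    var_series j (\<lambda>k. h_poly N lt (int k))"
  using list_prod_c_factor[OF ordered_letters(2)]
  by (simp add: ordered_letters(1) row_words_def h_poly_eq_word_sum)

lemma h_list_carrier: "h_list N lt ks \<in> carrier (\<U> N)"
  by (auto simp: h_list_eq_word_sum carrier_\<U> keys_word_sum finite_splits)

text \<open>The lower bound \<open>m\<close> varies so that the leftmost variable can be peeled off.
  An exponent vector splits in only one way into its part at \<open>m\<close> and its part beyond,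
  so each coefficient of the convolution is a single product.\<close>

lemma list_prod_var_series_h:
  "list_prod (PS (\<U> N)) (map (\<lambda>j. var_series j (\<lambda>k. h_poly N lt (int k))) [m..<n]) =
    (\<lambda>\<alpha>. if Poly_Mapping.keys \<alpha> \<subseteq> {m..<n} then h_list N lt (map (Poly_Mapping.lookup \<alpha>) [m..<n]) else 0)"
proof (cases "m \<le> n")
  case True
  then show ?thesis
  proof (induction rule: inc_induct)
    case base
    show ?case by (auto simp: list_prod_def PS_simps h_list_def fun_eq_iff)
  next
    case (step m)
    let ?H = "\<lambda>m \<alpha>. if Poly_Mapping.keys \<alpha> \<subseteq> {m..<n} then h_list N lt (map (Poly_Mapping.lookup \<alpha>) [m..<n]) else 0"
    let ?v = "var_series m (\<lambda>k. h_poly N lt (int k))"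
    have carrier: "?v \<in> carrier (PS (\<U> N))" "?H (Suc m) \<in> carrier (PS (\<U> N))"
      using var_series_carrier h_poly_carrier h_list_carrier by (auto simp: PS_carrier_iff \<U>_closed)
    have "list_prod (PS (\<U> N)) (map (\<lambda>j. var_series j (\<lambda>k. h_poly N lt (int k))) [m..<n]) =
        ?v \<otimes>\<^bsub>PS (\<U> N)\<^esub> ?H (Suc m)"
      using step by (simp add: upt_conv_Cons list_prod_def)
    also have "\<dots> = ?H m"
    proof
      fix \<alpha> :: expvec
      define \<beta> where "\<beta> = Poly_Mapping.single m (Poly_Mapping.lookup \<alpha> m)"
      define \<gamma> where "\<gamma> = \<alpha> - \<beta>"
      have \<gamma>: "Poly_Mapping.lookup \<gamma> j = (if j = m then 0 else Poly_Mapping.lookup \<alpha> j)" for j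
        by (auto simp: \<gamma>_def \<beta>_def lookup_minus lookup_single when_def)
      have sum: "\<beta> + \<gamma> = \<alpha>"
        by (auto simp: poly_mapping_eq_iff fun_eq_iff lookup_add \<gamma> \<beta>_def lookup_single when_def)
      have zero: "?v (fst p) * ?H (Suc m) (snd p) = 0" if "fst p + snd p = \<alpha>" "p \<noteq> (\<beta>, \<gamma>)" for p
      proof (rule ccontr)
        assume "?v (fst p) * ?H (Suc m) (snd p) \<noteq> 0"
        then have p: "Poly_Mapping.keys (fst p) \<subseteq> {m}" "Poly_Mapping.keys (snd p) \<subseteq> {Suc m..<n}"
          by (auto simp: var_series_def split: if_splits)
        then have "Poly_Mapping.lookup (snd p) m = 0" by (auto simp: in_keys_iff subset_iff)
        then have "Poly_Mapping.lookup (fst p) m = Poly_Mapping.lookup \<alpha> m"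
          using that(1) by (auto simp: lookup_add)
        then have "fst p = \<beta>"
          using p(1) by (simp add: keys_subset_singleton_iff \<beta>_def)
        moreover from this have "snd p = \<gamma>" using that(1) by (auto simp: \<gamma>_def)
        ultimately show False using that(2) by (simp add: prod_eq_iff)
      qed
      have "(?v \<otimes>\<^bsub>PS (\<U> N)\<^esub> ?H (Suc m)) \<alpha> = (\<Sum>p\<in>{(\<beta>, \<gamma>)}. ?v (fst p) * ?H (Suc m) (snd p))"
        unfolding PS_mult[OF carrier]
        by (rule sum.mono_neutral_right) (use zero sum finite_antidiagonal in auto)
      also have "\<dots> = h_poly N lt (int (Poly_Mapping.lookup \<alpha> m)) * ?H (Suc m) \<gamma>"
        by (auto simp: var_series_def \<beta>_def)
      also have "\<dots> = ?H m \<alpha>"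
      proof -
        have "Poly_Mapping.keys \<gamma> \<subseteq> {Suc m..<n} \<longleftrightarrow> Poly_Mapping.keys \<alpha> \<subseteq> {m..<n}"
          using step(2) by (auto simp: in_keys_iff subset_iff \<gamma> Suc_le_eq) (metis nat_less_le)+
        moreover have "map (Poly_Mapping.lookup \<gamma>) [Suc m..<n] = map (Poly_Mapping.lookup \<alpha>) [Suc m..<n]"
          by (simp add: \<gamma>)
        moreover have "h_list N lt (map (Poly_Mapping.lookup \<alpha>) [m..<n]) =
            h_poly N lt (int (Poly_Mapping.lookup \<alpha> m)) * h_list N lt (map (Poly_Mapping.lookup \<alpha>) [Suc m..<n])"
          using step(2) by (simp add: upt_conv_Cons h_list_def)
        ultimately show ?thesis by (simp only: mult_zero_right simp_thms split: if_split) blast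
      qed
      finally show "(?v \<otimes>\<^bsub>PS (\<U> N)\<^esub> ?H (Suc m)) \<alpha> = ?H m \<alpha>" .
    qed
    finally show ?case .
  qed
qed (auto simp: list_prod_def PS_simps h_list_def fun_eq_iff)

lemma h_comp_eq_h_list:
  assumes "Poly_Mapping.degree \<alpha> \<le> n"
  shows "h_list N lt (map (Poly_Mapping.lookup \<alpha>) [0..<n]) = h_comp N lt \<alpha>"
  using assms
proof (induction n rule: dec_induct)
  case (step n)
  then show ?case by (simp add: h_list_def beyond_degree_lookup_zero)
qed (simp add: h_comp_def)

text \<open>Partial products have a constant coefficient at \<alpha> from
  \<open>degree \<alpha>\<close> variables on, as further variables contribute only factors
  \<open>h_0 = 1\<close>; this constant is the limit.\<close>

lemma \<Omega>_eq_h_comp: "\<Omega> N lt = h_comp N lt"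
proof
  fix \<alpha> :: expvec
  let ?P = "\<lambda>n. list_prod (PS (\<U> N))
    (map (\<lambda>j. list_prod (PS (\<U> N)) (map (\<lambda>z. c_factor N z j) (ordered_letters N lt))) [0..<n]) \<alpha>"
  have "?P n = h_comp N lt \<alpha>" if "n \<ge> Poly_Mapping.degree \<alpha>" for n
  proof -
    have "Poly_Mapping.keys \<alpha> \<subseteq> {0..<n}"
      using that in_keys_less_degree by fastforce
    then show ?thesis
      by (simp add: list_prod_ordered_letters list_prod_var_series_h h_comp_eq_h_list[OF that])
  qed
  then have ev: "\<forall>\<^sub>F n in sequentially. ?P n = h_comp N lt \<alpha>"
    unfolding eventually_sequentially by blast
  moreover have "c = h_comp N lt \<alpha>" if "\<forall>\<^sub>F n in sequentially. ?P n = c" for c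
    using eventually_conj[OF that ev] by (auto simp: eventually_sequentially)
  ultimately show "\<Omega> N lt \<alpha> = h_comp N lt \<alpha>"
    unfolding \<Omega>_def formal_lim_def by (rule the_equality)
qed

end

section \<open>Tableaux as chains of vertical strips\<close>

lemma finite_downset_nat:
  fixes D :: "nat set"
  assumes "finite D" "\<And>a b. a \<in> D \<Longrightarrow> b \<le> a \<Longrightarrow> b \<in> D"
  shows "D = {..<card D}"
proof (rule card_subset_eq[symmetric])
  show "{..<card D} \<subseteq> D"
  proof
    fix a assume "a \<in> {..<card D}"
    show "a \<in> D"
    proof (rule ccontr)
      assume "a \<notin> D"
      then have "D \<subseteq> {..<a}" using assms(2) by (metis lessThan_iff not_le subsetI)
      then have "card D \<le> a" using card_mono[of "{..<a}" D] by simp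
      with \<open>a \<in> {..<card D}\<close> show False by simp
    qed
  qed
qed (use assms in auto)

text \<open>Positions of elements below \<open>i\<close> form an initial segment of the sorted list.
  This translates between comparisons of tableau entries and the counts by which
  \<open>strips\<close> is defined.\<close>

lemma nth_sorted_list_of_set_less_iff:
  fixes A :: "nat set"
  assumes "finite A" "a < card A"
  shows "sorted_list_of_set A ! a < i \<longleftrightarrow> a < card (A \<inter> {..<i})"
proof -
  let ?xs = "sorted_list_of_set A"
  have len: "length ?xs = card A" by simp
  have sorted: "sorted ?xs" "distinct ?xs" "set ?xs = A" using assms by auto
  define D where "D = {b. b < card A \<and> ?xs ! b < i}"
  have "D = {..<card D}"
  proof (rule finite_downset_nat)
    fix b c assume "b \<in> D" "c \<le> b"
    then show "c \<in> D"
      using sorted_nth_mono[OF sorted(1), of c b] by (auto simp: D_def)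
  qed (simp add: D_def)
  moreover have "bij_betw ((!) ?xs) D (A \<inter> {..<i})"
  proof (rule bij_betw_imageI)
    show "inj_on ((!) ?xs) D"
      using sorted(2) len by (auto simp: D_def inj_on_def nth_eq_iff_index_eq)
    show "(!) ?xs ` D = A \<inter> {..<i}"
    proof
      show "(!) ?xs ` D \<subseteq> A \<inter> {..<i}"
      proof
        fix x assume "x \<in> (!) ?xs ` D"
        then obtain b where "b < length ?xs" "?xs ! b < i" "x = ?xs ! b"
          unfolding D_def len by blast
        then show "x \<in> A \<inter> {..<i}"
          using nth_mem[of b ?xs] sorted(3) by simp
      qed
      show "A \<inter> {..<i} \<subseteq> (!) ?xs ` D"
      proof
        fix x assume x: "x \<in> A \<inter> {..<i}"
        then obtain b where "b < length ?xs" "?xs ! b = x"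
          using sorted(3) by (metis IntD1 in_set_conv_nth)
        then show "x \<in> (!) ?xs ` D"
          using x unfolding D_def len by blast
      qed
    qed
  qed
  then have "card D = card (A \<inter> {..<i})" by (rule bij_betw_same_card)
  ultimately have "a \<in> D \<longleftrightarrow> a < card (A \<inter> {..<i})" by auto
  then show ?thesis using assms by (simp add: D_def)
qed

text \<open>The shape is not fixed, because a chain of strips with given sizes may end in any shape
  of that degree.\<close>

definition tableau :: "nat list list \<Rightarrow> bool" where
  "tableau T \<longleftrightarrow> map length T \<in> partitions \<and> T \<in> SSYT (map length T)"

text \<open>Entries equal to \<open>i\<close> lie in distinct columns, so their cells are recorded
  faithfully by the column indices. Under transposition these become the rows of a vertical
  strip.\<close>

definition strip :: "nat list list \<Rightarrow> nat \<Rightarrow> nat set" where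
  "strip T i = {j. \<exists>a<length T. j < length (T ! a) \<and> T ! a ! j = i}"

definition column :: "(nat \<Rightarrow> nat set) \<Rightarrow> nat \<Rightarrow> nat set" where
  "column S j = {i. j \<in> S i}"

definition column_length :: "nat list list \<Rightarrow> nat \<Rightarrow> nat" where
  "column_length T j = card {a. a < length T \<and> j < length (T ! a)}"

definition row_length :: "(nat \<Rightarrow> nat set) \<Rightarrow> nat \<Rightarrow> nat" where
  "row_length S a = card {j. a < card (column S j)}"

text \<open>A chain of vertical strips of sizes \<open>\<alpha> 0, \<dots>, \<alpha> (r - 1)\<close> inside \<open>n\<close> rows; it encodes the
  tableau of conjugate shape whose columns are the sets \<^const>\<open>column\<close>.\<close>

definition strips :: "nat \<Rightarrow> nat \<Rightarrow> (nat \<Rightarrow> nat) \<Rightarrow> (nat \<Rightarrow> nat set) set" where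
  "strips n r \<alpha> = {S. (\<forall>i<r. S i \<subseteq> {0..<n} \<and> card (S i) = \<alpha> i) \<and> (\<forall>i\<ge>r. S i = {}) \<and>
     (\<forall>i\<le>r. antimono (\<lambda>j. card (column S j \<inter> {..<i})))}"

definition tableau_of :: "(nat \<Rightarrow> nat set) \<Rightarrow> nat list list" where
  "tableau_of S =
     map (\<lambda>a. map (\<lambda>j. sorted_list_of_set (column S j) ! a) [0..<row_length S a])
       [0..<card (column S 0)]"

context
  fixes T :: "nat list list"
  assumes T: "tableau T"
begin

lemma tableau_length_antimono: "a \<le> b \<Longrightarrow> b < length T \<Longrightarrow> length (T ! b) \<le> length (T ! a)"
  using T unfolding tableau_def partitions_def
  by (cases "a = b") (auto simp: sorted_wrt_map sorted_wrt_iff_nth_less)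

lemma tableau_row_nonempty: "a < length T \<Longrightarrow> 0 < length (T ! a)"
  using T unfolding tableau_def partitions_def by (auto simp: in_set_conv_nth image_iff)

lemma tableau_row_sorted: "a < length T \<Longrightarrow> sorted (T ! a)"
  using T unfolding tableau_def SSYT_def by auto

lemma tableau_column_strict: "a < b \<Longrightarrow> b < length T \<Longrightarrow> j < length (T ! b) \<Longrightarrow> T ! a ! j < T ! b ! j"
proof (induction b)
  case (Suc b)
  have "T ! b ! j < T ! Suc b ! j"
    using Suc.prems T unfolding tableau_def SSYT_def by auto
  moreover have "j < length (T ! b)"
    using tableau_length_antimono[of b "Suc b"] Suc.prems by simp
  ultimately show ?case
    using Suc by (cases "a = b") (auto intro: less_trans)
qed simp

lemma tableau_column_inj:
  assumes "a < length T" "b < length T" "j < length (T ! a)" "j < length (T ! b)" "T ! a ! j = T ! b ! j"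
  shows "a = b"
  using tableau_column_strict[of a b j] tableau_column_strict[of b a j] assms
  by (cases a b rule: linorder_cases) auto

lemma less_column_length_iff: "a < column_length T j \<longleftrightarrow> a < length T \<and> j < length (T ! a)"
proof -
  have "{a. a < length T \<and> j < length (T ! a)} = {..<column_length T j}"
    unfolding column_length_def
    by (rule finite_downset_nat) (use tableau_length_antimono in \<open>force+\<close>)
  then show ?thesis by blast
qed

lemma column_strip: "column (strip T) j = (\<lambda>a. T ! a ! j) ` {..<column_length T j}"
  by (auto simp: column_def strip_def less_column_length_iff)

lemma sorted_list_of_column_strip:
  "sorted_list_of_set (column (strip T) j) = map (\<lambda>a. T ! a ! j) [0..<column_length T j]"
proof -
  let ?xs = "map (\<lambda>a. T ! a ! j) [0..<column_length T j]"
  have "sorted_wrt (<) ?xs"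
    using tableau_column_strict by (simp add: sorted_wrt_iff_nth_less) (metis less_column_length_iff less_trans)
  then have "sorted ?xs" "distinct ?xs"
    unfolding strict_sorted_iff by auto
  then have "sorted_list_of_set (set ?xs) = ?xs"
    by (rule sorted_list_of_set.idem_if_sorted_distinct)
  moreover have "set ?xs = column (strip T) j"
    by (auto simp: column_strip)
  ultimately show ?thesis by simp
qed

lemma card_column_strip: "card (column (strip T) j) = column_length T j"
  by (metis length_map length_upt minus_nat.diff_0 sorted_list_of_column_strip
      sorted_list_of_set.length_sorted_key_list_of_set)

lemma tableau_of_strip: "tableau_of (strip T) = T"
proof (rule nth_equalityI)
  have "column_length T 0 = length T"
    using less_column_length_iff[of _ 0] tableau_row_nonempty
    by (metis linorder_neqE_nat order.irrefl)
  then show len: "length (tableau_of (strip T)) = length T"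
    by (simp add: tableau_of_def card_column_strip)
  fix a assume "a < length (tableau_of (strip T))"
  then have a: "a < length T" by (simp add: len)
  have "{j. a < column_length T j} = {..<length (T ! a)}"
    using a by (auto simp: less_column_length_iff)
  then have "row_length (strip T) a = length (T ! a)"
    by (simp add: row_length_def card_column_strip)
  then have row: "tableau_of (strip T) ! a =
      map (\<lambda>j. map (\<lambda>b. T ! b ! j) [0..<column_length T j] ! a) [0..<length (T ! a)]"
    using a \<open>column_length T 0 = length T\<close>
    by (simp add: tableau_of_def card_column_strip sorted_list_of_column_strip)
  show "tableau_of (strip T) ! a = T ! a"
    unfolding row using a by (intro nth_equalityI) (auto simp: less_column_length_iff)
qed

lemma count_list_concat_tableau: "count_list (concat T) i = card (strip T i)"
proof -
  have count: "count_list (concat U) i = (\<Sum>a<length U. card {j. j < length (U ! a) \<and> U ! a ! j = i})" for U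
  proof (induction U rule: rev_induct)
    case (snoc r U)
    have "count_list r i = card {j. j < length r \<and> r ! j = i}"
      by (simp add: count_list_eq_length_filter length_filter_conv_card eq_commute)
    moreover have "(\<Sum>a<length U. card {j. j < length ((U @ [r]) ! a) \<and> (U @ [r]) ! a ! j = i}) =
        (\<Sum>a<length U. card {j. j < length (U ! a) \<and> U ! a ! j = i})"
      by (intro sum.cong) (auto simp: nth_append)
    ultimately show ?case using snoc by simp
  qed simp
  have "strip T i = (\<Union>a\<in>{..<length T}. {j. j < length (T ! a) \<and> T ! a ! j = i})"
    by (auto simp: strip_def)
  also have "card \<dots> = (\<Sum>a<length T. card {j. j < length (T ! a) \<and> T ! a ! j = i})"
    by (rule card_UN_disjoint) (auto dest: tableau_column_inj)
  finally show ?thesis using count[of T] by simp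
qed

text \<open>Rows increase weakly, so a cell with entry below \<open>i\<close> has only such entries
  to its left: the entries below \<open>i\<close> fill a partition shape.\<close>

lemma antimono_card_column_strip: "antimono (\<lambda>j. card (column (strip T) j \<inter> {..<i}))"
  unfolding antimono_iff_le_Suc
proof
  fix j
  have card: "card (column (strip T) j \<inter> {..<i}) = card {a. a < column_length T j \<and> T ! a ! j < i}" for j
  proof -
    have "column (strip T) j \<inter> {..<i} = (\<lambda>a. T ! a ! j) ` {a. a < column_length T j \<and> T ! a ! j < i}"
      by (auto simp: column_strip)
    moreover have "inj_on (\<lambda>a. T ! a ! j) {a. a < column_length T j \<and> T ! a ! j < i}"
      by (auto simp: inj_on_def less_column_length_iff dest: tableau_column_inj)
    ultimately show ?thesis by (simp add: card_image)
  qed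
  have "T ! a ! j < i" if "a < column_length T (Suc j)" "T ! a ! Suc j < i" for a
    using that tableau_row_sorted[of a] sorted_nth_mono[of "T ! a" j "Suc j"]
    by (auto simp: less_column_length_iff)
  then show "card (column (strip T) (Suc j) \<inter> {..<i}) \<le> card (column (strip T) j \<inter> {..<i})"
    unfolding card by (intro card_mono) (auto simp: less_column_length_iff)
qed

text \<open>No row is longer than the number of cells, which is the sum of the exponents; hence
  every column index is below \<open>n\<close>.\<close>

lemma strip_mem_strips:
  assumes "seq_expvec (concat T) = \<alpha>" "Poly_Mapping.keys \<alpha> \<subseteq> {..<r}"
    and "(\<Sum>i<r. Poly_Mapping.lookup \<alpha> i) \<le> n"
  shows "strip T \<in> strips n r (Poly_Mapping.lookup \<alpha>)"
proof -
  have card: "card (strip T i) = Poly_Mapping.lookup \<alpha> i" for i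
    using assms(1) by (simp flip: count_list_concat_tableau add: lookup_seq_expvec[symmetric])
  have finite: "finite (strip T i)" for i
    by (rule finite_subset[of _ "\<Union>a<length T. {..<length (T ! a)}"]) (auto simp: strip_def)
  have empty: "strip T i = {}" if "i \<ge> r" for i
  proof -
    have "Poly_Mapping.lookup \<alpha> i = 0"
      using that assms(2) by (meson in_keys_iff lessThan_iff not_le subsetD)
    then show ?thesis using card[of i] finite[of i] by simp
  qed
  have "set (concat T) \<subseteq> {..<r}"
  proof
    fix i assume "i \<in> set (concat T)"
    then have "i \<in> Poly_Mapping.keys \<alpha>"
      using assms(1) by (metis count_list_0_iff lookup_seq_expvec in_keys_iff)
    then show "i \<in> {..<r}" using assms(2) by blast
  qed
  then have "length (concat T) = (\<Sum>i<r. Poly_Mapping.lookup \<alpha> i)"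
    using sum_count_set[of "concat T" "{..<r}"] assms(1) by (simp flip: lookup_seq_expvec)
  moreover have "length (T ! a) \<le> length (concat T)" if "a < length T" for a
    using that member_le_sum_list[of "length (T ! a)" "map length T"] by (auto simp: length_concat)
  ultimately have "strip T i \<subseteq> {0..<n}" for i
    using assms(3) by (force simp: strip_def)
  then show ?thesis
    using card empty antimono_card_column_strip by (auto simp: strips_def)
qed

text \<open>\<open>Suc\<close> passes from columns numbered from 0 to conjugate parts numbered from
  1.\<close>

lemma conj_part_tableau: "conj_part (map length T) (Suc j) = card (column (strip T) j)"
  by (auto simp: conj_part_def filter_map length_filter_conv_card card_column_strip column_length_def Suc_le_eq)

end

context
  fixes S :: "nat \<Rightarrow> nat set" and n r :: nat and \<alpha> :: "nat \<Rightarrow> nat"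
  assumes S: "S \<in> strips n r \<alpha>"
begin

lemma column_subset: "column S j \<subseteq> {..<r}"
  using S by (auto simp: column_def strips_def) (metis empty_iff not_le)

lemma finite_column: "finite (column S j)"
  by (rule finite_subset[OF column_subset]) simp

lemma antimono_column_below: "antimono (\<lambda>j. card (column S j \<inter> {..<i}))"
proof (cases "i \<le> r")
  case False
  then have "column S j \<inter> {..<i} = column S j \<inter> {..<r}" for j
    using column_subset[of j] by auto
  then show ?thesis using S by (simp add: strips_def)
qed (use S in \<open>simp add: strips_def\<close>)

lemma antimono_card_column: "antimono (\<lambda>j. card (column S j))"
  using antimono_column_below[of r] column_subset by (simp add: Int_absorb2)

text \<open>Column lengths decrease and vanish from \<open>n\<close> on, so the columns reaching row
  \<open>a\<close> form an initial segment.\<close>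

lemma less_row_length_iff: "j < row_length S a \<longleftrightarrow> a < card (column S j)"
proof -
  have "column S j = {}" if "j \<ge> n" for j
    using S that by (auto simp: column_def strips_def) (metis atLeastLessThan_iff empty_iff not_le subsetD)
  then have "{j. a < card (column S j)} \<subseteq> {..<n}"
    by (metis (mono_tags, lifting) card.empty lessThan_iff mem_Collect_eq not_le not_less_zero subsetI)
  then have "{j. a < card (column S j)} = {..<row_length S a}"
    unfolding row_length_def using antimono_card_column
    by (intro finite_downset_nat) (auto intro: finite_subset dest: antimonoD less_le_trans)
  then show ?thesis by blast
qed

text \<open>With \<open>?x\<close> the right-hand entry, more than \<open>a\<close> entries of
  column \<open>Suc j\<close> are at most \<open>?x\<close>. By monotonicity of the counts the same
  holds in column \<open>j\<close>, which bounds its entry number \<open>a\<close>.\<close>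

lemma nth_column_mono:
  assumes "a < card (column S (Suc j))"
  shows "sorted_list_of_set (column S j) ! a \<le> sorted_list_of_set (column S (Suc j)) ! a"
proof -
  let ?x = "sorted_list_of_set (column S (Suc j)) ! a"
  have "a < card (column S (Suc j) \<inter> {..<Suc ?x})"
    using assms nth_sorted_list_of_set_less_iff[OF finite_column assms, of "Suc ?x"] by simp
  also have "\<dots> \<le> card (column S j \<inter> {..<Suc ?x})"
    using antimono_column_below[of "Suc ?x"] by (simp add: antimono_iff_le_Suc)
  finally have *: "a < card (column S j \<inter> {..<Suc ?x})" .
  also have "\<dots> \<le> card (column S j)"
    by (intro card_mono finite_column) auto
  finally show ?thesis
    using * nth_sorted_list_of_set_less_iff[OF finite_column, of a j "Suc ?x"] by simp
qed

lemma tableau_tableau_of: "tableau (tableau_of S)"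
proof -
  let ?T = "tableau_of S"
  have len: "length ?T = card (column S 0)" by (simp add: tableau_of_def)
  have row: "?T ! a = map (\<lambda>j. sorted_list_of_set (column S j) ! a) [0..<row_length S a]"
    if "a < card (column S 0)" for a
    using that by (simp add: tableau_of_def)
  have "row_length S b \<le> row_length S a" if "a \<le> b" for a b
    using that by (metis le_less_trans less_row_length_iff not_le order.refl)
  moreover have "row_length S a \<noteq> 0" if "a < card (column S 0)" for a
    using less_row_length_iff[of 0 a] that by simp
  ultimately have "map length ?T \<in> partitions"
    by (auto simp: partitions_def sorted_wrt_iff_nth_less len row in_set_conv_nth)
  moreover have "sorted (?T ! a)" if "a < card (column S 0)" for a
  proof -
    have "a < card (column S j)" if "a < card (column S (Suc j))" for j
      using that antimono_card_column by (metis antimono_iff_le_Suc less_le_trans)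
    then show ?thesis
      using nth_column_mono by (simp add: row that sorted_iff_nth_Suc less_row_length_iff)
  qed
  moreover have "?T ! i ! j < ?T ! Suc i ! j" if "Suc i < length ?T" "j < length (?T ! Suc i)" for i j
  proof -
    have "Suc i < card (column S 0)" "j < row_length S (Suc i)"
      using that by (simp_all add: len row)
    moreover from this have "Suc i < card (column S j)"
      by (simp add: less_row_length_iff)
    moreover from this have "i < card (column S j)" by simp
    moreover have "sorted_list_of_set (column S j) ! i < sorted_list_of_set (column S j) ! Suc i"
      using \<open>Suc i < card (column S j)\<close>
      by (intro sorted_wrt_nth_less[OF strict_sorted_list_of_set]) auto
    ultimately show ?thesis
      using less_row_length_iff[of j i] by (simp add: row)
  qed
  ultimately show ?thesis
    by (auto simp: tableau_def SSYT_def len in_set_conv_nth)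
qed

lemma strip_tableau_of: "strip (tableau_of S) = S"
proof
  fix i
  have "strip (tableau_of S) i =
      {j. \<exists>a<card (column S 0). j < row_length S a \<and> sorted_list_of_set (column S j) ! a = i}"
    by (auto simp: strip_def tableau_of_def)
  also have "\<dots> = {j. \<exists>a<card (column S j). sorted_list_of_set (column S j) ! a = i}"
  proof -
    have "card (column S j) \<le> card (column S 0)" for j
      using antimonoD[OF antimono_card_column, of 0 j] by simp
    then have "a < card (column S 0) \<and> j < row_length S a \<longleftrightarrow> a < card (column S j)" for a j
      by (auto simp: less_row_length_iff intro: less_le_trans)
    then show ?thesis by (metis (no_types, lifting))
  qed
  also have "\<dots> = {j. i \<in> set (sorted_list_of_set (column S j))}"
    by (simp only: in_set_conv_nth) simp
  also have "\<dots> = S i"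
    using finite_column by (simp add: column_def)
  finally show "strip (tableau_of S) i = S i" .
qed

lemma count_tableau_of: "count_list (concat (tableau_of S)) i = card (S i)"
  using count_list_concat_tableau[OF tableau_tableau_of] strip_tableau_of by simp

end

lemma finite_strips: "finite (strips n r \<alpha>)"
proof (rule finite_subset)
  show "strips n r \<alpha> \<subseteq> {S. \<forall>i. (i \<in> {..<r} \<longrightarrow> S i \<in> Pow {0..<n}) \<and> (i \<notin> {..<r} \<longrightarrow> S i = {})}"
    by (auto simp: strips_def)
qed (intro finite_set_of_finite_funs; simp)

text \<open>The assumptions ensure that all entries are below \<open>r\<close> and that
  \<open>n\<close> columns hold every tableau of this content, whatever its shape.\<close>

lemma bij_betw_strip:
  assumes "Poly_Mapping.keys \<alpha> \<subseteq> {..<r}" "(\<Sum>i<r. Poly_Mapping.lookup \<alpha> i) \<le> n"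
  shows "bij_betw strip {T. tableau T \<and> seq_expvec (concat T) = \<alpha>} (strips n r (Poly_Mapping.lookup \<alpha>))"
proof (rule bij_betw_byWitness[where f' = tableau_of])
  show "tableau_of ` strips n r (Poly_Mapping.lookup \<alpha>) \<subseteq> {T. tableau T \<and> seq_expvec (concat T) = \<alpha>}"
  proof clarify
    fix S assume S: "S \<in> strips n r (Poly_Mapping.lookup \<alpha>)"
    have "card (S i) = Poly_Mapping.lookup \<alpha> i" for i
      using S assms(1) by (cases "i < r") (auto simp: strips_def in_keys_iff subset_iff)
    then have "seq_expvec (concat (tableau_of S)) = \<alpha>"
      by (intro poly_mapping_eqI) (simp add: lookup_seq_expvec count_tableau_of[OF S])
    then show "tableau (tableau_of S) \<and> seq_expvec (concat (tableau_of S)) = \<alpha>"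
      using tableau_tableau_of[OF S] by simp
  qed
  show "strip ` {T. tableau T \<and> seq_expvec (concat T) = \<alpha>} \<subseteq> strips n r (Poly_Mapping.lookup \<alpha>)"
    using strip_mem_strips[OF _ _ assms] by blast
qed (auto simp: tableau_of_strip strip_tableau_of)

lemma finite_tableaux: "finite {T. tableau T \<and> seq_expvec (concat T) = \<alpha>}"
proof -
  have "Poly_Mapping.keys \<alpha> \<subseteq> {..<Poly_Mapping.degree \<alpha>}"
    by (auto dest: in_keys_less_degree)
  from bij_betw_strip[OF this order.refl] show ?thesis
    using bij_betw_finite finite_strips by blast
qed

lemma finite_schur_support: "finite {\<nu>. \<nu> \<in> partitions \<and> schur \<nu> \<alpha> \<noteq> 0}"
proof (rule finite_surj[OF finite_tableaux])
  show "{\<nu>. \<nu> \<in> partitions \<and> schur \<nu> \<alpha> \<noteq> 0} \<subseteq> map length ` {T. tableau T \<and> seq_expvec (concat T) = \<alpha>}"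
  proof clarify
    fix \<nu> assume \<nu>: "\<nu> \<in> partitions" "schur \<nu> \<alpha> \<noteq> 0"
    then have "{T \<in> SSYT \<nu>. seq_expvec (concat T) = \<alpha>} \<noteq> {}"
      unfolding schur_def by force
    then obtain T where "T \<in> SSYT \<nu>" "seq_expvec (concat T) = \<alpha>" by auto
    then show "\<nu> \<in> map length ` {T. tableau T \<and> seq_expvec (concat T) = \<alpha>}"
      using \<nu>(1) by (intro image_eqI[of _ _ T]) (auto simp: tableau_def SSYT_def)
  qed
qed

text \<open>The largest entry \<open>r\<close> lengthens exactly the columns in \<open>B\<close> and
  leaves all earlier shapes untouched, so one entry of the tableau corresponds to one application of
  the Pieri rule.\<close>

lemma strips_Suc:
  "bij_betw (\<lambda>(S, B). S(r := B))
    (SIGMA S:strips n r \<alpha>. {B. B \<subseteq> {0..<n} \<and> card B = \<alpha> r \<and>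
      antimono (\<lambda>j. card (column S j) + of_bool (j \<in> B))})
    (strips n (Suc r) \<alpha>)"
proof (rule bij_betw_byWitness[where f' = "\<lambda>S. (S(r := {}), S r)"])
  have below: "column (S(r := B)) j \<inter> {..<i} = column S j \<inter> {..<i}" if "i \<le> r" for S B i j
    using that by (auto simp: column_def)
  have card: "card (column (S(r := B)) j \<inter> {..<Suc r}) = card (column S j) + of_bool (j \<in> B)"
    if "S \<in> strips n r \<alpha>" for S B j
  proof -
    have "column (S(r := B)) j \<inter> {..<Suc r} = (if j \<in> B then insert r (column S j) else column S j)"
      using column_subset[OF that, of j] by (auto simp: column_def)
    moreover have "r \<notin> column S j" using column_subset[OF that, of j] by auto
    ultimately show ?thesis using finite_column[OF that, of j] by simp
  qed
  show "(\<lambda>(S, B). S(r := B)) ` (SIGMA S:strips n r \<alpha>. {B. B \<subseteq> {0..<n} \<and> card B = \<alpha> r \<and>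
      antimono (\<lambda>j. card (column S j) + of_bool (j \<in> B))}) \<subseteq> strips n (Suc r) \<alpha>"
  proof clarify
    fix S B
    assume S: "S \<in> strips n r \<alpha>" and B: "B \<subseteq> {0..<n}" "card B = \<alpha> r"
      "antimono (\<lambda>j. card (column S j) + of_bool (j \<in> B))"
    have "antimono (\<lambda>j. card (column (S(r := B)) j \<inter> {..<i}))" if "i \<le> Suc r" for i
    proof (cases "i \<le> r")
      case True
      then show ?thesis using S by (simp add: below strips_def)
    next
      case False
      then have "i = Suc r" using that by simp
      then show ?thesis using B(3) card[OF S] by simp
    qed
    then show "S(r := B) \<in> strips n (Suc r) \<alpha>"
      using S B(1,2) by (auto simp: strips_def less_Suc_eq)
  qed
  show "(\<lambda>S. (S(r := {}), S r)) ` strips n (Suc r) \<alpha> \<subseteq>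
      (SIGMA S:strips n r \<alpha>. {B. B \<subseteq> {0..<n} \<and> card B = \<alpha> r \<and>
        antimono (\<lambda>j. card (column S j) + of_bool (j \<in> B))})"
  proof (rule image_subsetI)
    fix S assume S: "S \<in> strips n (Suc r) \<alpha>"
    have 1: "S(r := {}) \<in> strips n r \<alpha>"
      using S by (auto simp: strips_def below)
    moreover have "antimono (\<lambda>j. card (column (S(r := {})) j) + of_bool (j \<in> S r))"
    proof -
      have "antimono (\<lambda>j. card (column S j \<inter> {..<Suc r}))"
        using S by (simp add: strips_def)
      then show ?thesis using card[OF 1, of "S r"] by simp
    qed
    ultimately show "(S(r := {}), S r) \<in> (SIGMA S:strips n r \<alpha>. {B. B \<subseteq> {0..<n} \<and> card B = \<alpha> r \<and>
        antimono (\<lambda>j. card (column S j) + of_bool (j \<in> B))})"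
      using S by (auto simp: strips_def)
  qed
qed (auto simp: strips_def fun_eq_iff)

text \<open>If column \<open>j\<close> is nonempty, so are all columns before it, which takes more
  than \<open>j\<close> cells. This supplies the bound \<open>m\<close> in the Pieri rule.\<close>

lemma card_column_strips_eq_0:
  assumes S: "S \<in> strips n r \<alpha>" and j: "j \<ge> (\<Sum>i<r. \<alpha> i)"
  shows "card (column S j) = 0"
proof (rule ccontr)
  assume nz: "card (column S j) \<noteq> 0"
  have fin: "finite (S i)" for i
    using S by (cases "i < r") (auto simp: strips_def intro: finite_subset)
  have pos: "column S l \<noteq> {}" if "l \<le> j" for l
    using antimonoD[OF antimono_card_column[OF S] that] nz by auto
  have "{..j} \<subseteq> (\<Union>i<r. S i)"
  proof
    fix l assume "l \<in> {..j}"
    then obtain i where "i \<in> column S l" using pos by auto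
    then show "l \<in> (\<Union>i<r. S i)"
      using column_subset[OF S, of l] by (auto simp: column_def)
  qed
  then have "Suc j \<le> card (\<Union>i<r. S i)"
    using card_mono[of "\<Union>i<r. S i" "{..j}"] fin by simp
  also have "\<dots> \<le> (\<Sum>i<r. card (S i))"
    by (rule card_UN_le) simp
  also have "\<dots> = (\<Sum>i<r. \<alpha> i)"
    using S by (intro sum.cong) (auto simp: strips_def)
  finally show False using j by simp
qed

section \<open>Iterating the Pieri rule along a tableau\<close>

context eh_pair
begin

text \<open>\<open>J_poly\<close> over a commutative ring, with the product still over a list so
  that it can be compared with \<open>J_poly\<close> factor by factor.\<close>

definition J :: "nat list \<Rightarrow> 'a" where
  "J \<nu> = (\<Sum>\<pi>\<in>{\<pi>. \<pi> permutes {1..first_part \<nu>}}.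
     of_int (sign \<pi>) * (\<Prod>i\<leftarrow>[1..<Suc (first_part \<nu>)]. e (int (conj_part \<nu> i) + int (\<pi> i) - int i)))"

text \<open>The determinant sees only the final column lengths, whereas the index is the whole
  chain; a shape is thus counted once for every chain leading to it.\<close>

lemma prod_h_eq_sum_strips:
  assumes "(\<Sum>i<r. \<alpha> i) \<le> n"
  shows "(\<Prod>i<r. h (int (\<alpha> i))) = (\<Sum>S\<in>strips n r \<alpha>. det (e_mat e n (\<lambda>j. card (column S j))))"
  using assms
proof (induction r)
  case 0
  have "strips n 0 \<alpha> = {\<lambda>_. {}}"
    by (auto simp: strips_def monotone_on_def)
  moreover have "det (e_mat e n (\<lambda>j. 0)) = 1"
    using det_e_mat_stable[of 0 "\<lambda>_. 0" n] by simp
  ultimately show ?case by (simp add: column_def)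
next
  case (Suc r)
  let ?B = "\<lambda>S. {B. B \<subseteq> {0..<n} \<and> card B = \<alpha> r \<and> antimono (\<lambda>j. card (column S j) + of_bool (j \<in> B))}"
  have col: "card (column (S(r := B)) j) = card (column S j) + of_bool (j \<in> B)"
    if "S \<in> strips n r \<alpha>" for S B j
  proof -
    have "column (S(r := B)) j = (if j \<in> B then insert r (column S j) else column S j)"
      using column_subset[OF that, of j] by (auto simp: column_def)
    moreover have "r \<notin> column S j" using column_subset[OF that, of j] by auto
    ultimately show ?thesis using finite_column[OF that, of j] by simp
  qed
  have "(\<Prod>i<Suc r. h (int (\<alpha> i))) =
      (\<Sum>S\<in>strips n r \<alpha>. h (int (\<alpha> r)) * det (e_mat e n (\<lambda>j. card (column S j))))"
    using Suc by (simp add: mult.commute sum_distrib_left)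
  also have "\<dots> = (\<Sum>S\<in>strips n r \<alpha>. \<Sum>B\<in>?B S.
      det (e_mat e n (\<lambda>j. card (column S j) + of_bool (j \<in> B))))"
  proof (rule sum.cong[OF refl])
    fix S assume S: "S \<in> strips n r \<alpha>"
    \<comment> \<open>The number of cells already placed serves as \<open>m\<close>; together with
      the \<open>\<alpha> r\<close> new cells it does not exceed \<open>n\<close>.\<close>
    show "h (int (\<alpha> r)) * det (e_mat e n (\<lambda>j. card (column S j))) =
        (\<Sum>B\<in>?B S. det (e_mat e n (\<lambda>j. card (column S j) + of_bool (j \<in> B))))"
      by (rule pieri[where m = "\<Sum>i<r. \<alpha> i"])
        (use Suc.prems card_column_strips_eq_0[OF S] antimono_card_column[OF S] in auto)
  qed
  also have "\<dots> = (\<Sum>(S, B)\<in>(SIGMA S:strips n r \<alpha>. ?B S).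
      det (e_mat e n (\<lambda>j. card (column S j) + of_bool (j \<in> B))))"
    by (intro sum.Sigma finite_strips ballI) auto
  also have "\<dots> = (\<Sum>(S, B)\<in>(SIGMA S:strips n r \<alpha>. ?B S).
      det (e_mat e n (\<lambda>j. card (column (S(r := B)) j))))"
    by (intro sum.cong[OF refl]) (auto simp: col)
  also have "\<dots> = (\<Sum>S\<in>strips n (Suc r) \<alpha>. det (e_mat e n (\<lambda>j. card (column S j))))"
    using sum.reindex_bij_betw[OF strips_Suc[of r n \<alpha>], of "\<lambda>S. det (e_mat e n (\<lambda>j. card (column S j)))"]
    by (simp add: case_prod_unfold)
  finally show ?case .
qed

text \<open>By stability any \<open>n\<close> from \<open>first_part \<nu>\<close> on is allowed, so
  shapes with different first parts share one matrix size.\<close>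

lemma J_eq_det:
  assumes "\<nu> \<in> partitions" "first_part \<nu> \<le> n"
  shows "J \<nu> = det (e_mat e n (\<lambda>j. conj_part \<nu> (Suc j)))"
proof -
  define m where "m = first_part \<nu>"
  \<comment> \<open>the extra row and column shift the indices from \<open>0, \<dots>, m - 1\<close> to the \<open>1, \<dots>, m\<close> of \<open>J\<close>\<close>
  define M where "M = mat (Suc m) (Suc m) (\<lambda>(i,j). if i = 0 then of_bool (j = 0) else
    e (int (conj_part \<nu> i) + int j - int i))"
  have M: "M \<in> carrier_mat (Suc m) (Suc m)" by (simp add: M_def)
  have M_entry: "M $$ (i, j) = (if i = 0 then of_bool (j = 0) else e (int (conj_part \<nu> i) + int j - int i))"
    if "i < Suc m" "j < Suc m" for i j
    using that by (simp add: M_def)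
  have "conj_part \<nu> (Suc j) = 0" if "j \<ge> m" for j
    using that assms(1)
    by (cases \<nu>) (auto simp: m_def first_part_def conj_part_def partitions_def filter_empty_conv)
  then have "det (e_mat e n (\<lambda>j. conj_part \<nu> (Suc j))) = det (e_mat e m (\<lambda>j. conj_part \<nu> (Suc j)))"
    using assms(2) by (intro det_e_mat_stable) (auto simp: m_def)
  also have "\<dots> = det M"
  proof -
    have "det M = (\<Sum>j<Suc m. M $$ (0, j) * cofactor M 0 j)"
      by (rule laplace_expansion_row[OF M]) simp
    also have "\<dots> = (\<Sum>j\<in>{0}. cofactor M 0 j)"
      by (intro sum.mono_neutral_cong_right) (auto simp: M_entry)
    also have "\<dots> = det (mat_delete M 0 0)"
      by (simp add: cofactor_def)
    also have "mat_delete M 0 0 = e_mat e m (\<lambda>j. conj_part \<nu> (Suc j))"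
      by (rule eq_matI) (auto simp: M_def mat_delete_def e_mat_def algebra_simps)
    finally show ?thesis by simp
  qed
  also have "det M = (\<Sum>\<pi>\<in>{\<pi>. \<pi> permutes {0..<Suc m}}.
      of_int (sign \<pi>) * (\<Prod>i = 0..<Suc m. M $$ (i, \<pi> i)))"
    by (rule det_def'[OF M])
  also have "\<dots> = (\<Sum>\<pi>\<in>{\<pi>. \<pi> permutes {1..m}}.
      of_int (sign \<pi>) * (\<Prod>i\<leftarrow>[1..<Suc m]. e (int (conj_part \<nu> i) + int (\<pi> i) - int i)))"
  proof (rule sum.mono_neutral_cong_right)
    show "{\<pi>. \<pi> permutes {1..m}} \<subseteq> {\<pi>. \<pi> permutes {0..<Suc m}}"
      by (auto intro: permutes_subset)
    \<comment> \<open>Row 0 of \<open>M\<close> is a unit vector, so a permutation that moves 0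
      contributes zero; those fixing 0 are the permutations of \<open>{1..m}\<close>.\<close>
    show "\<forall>\<pi>\<in>{\<pi>. \<pi> permutes {0..<Suc m}} - {\<pi>. \<pi> permutes {1..m}}.
        of_int (sign \<pi>) * (\<Prod>i = 0..<Suc m. M $$ (i, \<pi> i)) = 0"
    proof
      fix \<pi> assume \<pi>: "\<pi> \<in> {\<pi>. \<pi> permutes {0..<Suc m}} - {\<pi>. \<pi> permutes {1..m}}"
      then have perm: "\<pi> permutes {0..<Suc m}" and "\<not> \<pi> permutes {1..m}" by blast+
      have "\<pi> 0 \<noteq> 0"
      proof
        assume "\<pi> 0 = 0"
        have "\<pi> permutes {1..m}"
        proof (rule permutes_superset[OF perm])
          fix x assume "x \<in> {0..<Suc m} - {1..m}"
          then have "x = 0" by auto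
          then show "\<pi> x = x" using \<open>\<pi> 0 = 0\<close> by simp
        qed
        then show False using \<open>\<not> \<pi> permutes {1..m}\<close> by blast
      qed
      moreover have "\<pi> 0 < Suc m"
        using permutes_in_image[OF perm, of 0] by simp
      ultimately have "M $$ (0, \<pi> 0) = 0" by (simp add: M_entry)
      then have "(\<Prod>i = 0..<Suc m. M $$ (i, \<pi> i)) = 0"
        by (intro prod_zero bexI[of _ 0]) simp_all
      then show "of_int (sign \<pi>) * (\<Prod>i = 0..<Suc m. M $$ (i, \<pi> i)) = 0" by (simp only: mult_zero_right)
    qed
    fix \<pi> assume \<pi>: "\<pi> \<in> {\<pi>. \<pi> permutes {1..m}}"
    then have perm: "\<pi> permutes {1..m}" by blast
    have "\<pi> 0 = 0" by (rule permutes_not_in[OF perm]) simp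
    have "(\<Prod>i = 0..<Suc m. M $$ (i, \<pi> i)) = M $$ (0, \<pi> 0) * (\<Prod>i = Suc 0..<Suc m. M $$ (i, \<pi> i))"
      by (rule prod.atLeast_Suc_lessThan) simp
    also have "M $$ (0, \<pi> 0) = 1" by (simp add: M_entry \<open>\<pi> 0 = 0\<close>)
    also have "(\<Prod>i = Suc 0..<Suc m. M $$ (i, \<pi> i)) =
        (\<Prod>i = Suc 0..<Suc m. e (int (conj_part \<nu> i) + int (\<pi> i) - int i))"
    proof (rule prod.cong[OF refl])
      fix i assume "i \<in> {Suc 0..<Suc m}"
      moreover from this have "\<pi> i \<in> {1..m}"
        using permutes_in_image[OF perm, of i] by simp
      ultimately show "M $$ (i, \<pi> i) = e (int (conj_part \<nu> i) + int (\<pi> i) - int i)"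
        by (simp add: M_entry)
    qed
    also have "\<dots> = (\<Prod>i\<leftarrow>[1..<Suc m]. e (int (conj_part \<nu> i) + int (\<pi> i) - int i))"
      by (subst prod.distinct_set_conv_list[symmetric]) (simp_all only: set_upt distinct_upt One_nat_def)
    finally show "of_int (sign \<pi>) * (\<Prod>i = 0..<Suc m. M $$ (i, \<pi> i)) =
        of_int (sign \<pi>) * (\<Prod>i\<leftarrow>[1..<Suc m]. e (int (conj_part \<nu> i) + int (\<pi> i) - int i))"
      by simp
  qed (simp add: finite_permutations)
  finally show ?thesis by (simp add: J_def m_def)
qed

lemma prod_h_eq_sum_schur:
  assumes "Poly_Mapping.keys \<alpha> \<subseteq> {..<r}"
  shows "(\<Prod>i<r. h (int (Poly_Mapping.lookup \<alpha> i))) =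
    (\<Sum>\<nu> | \<nu> \<in> partitions \<and> schur \<nu> \<alpha> \<noteq> 0. of_int (schur \<nu> \<alpha>) * J \<nu>)"
proof -
  define n where "n = (\<Sum>i<r. Poly_Mapping.lookup \<alpha> i)"
  define X where "X = {T. tableau T \<and> seq_expvec (concat T) = \<alpha>}"
  define Y where "Y = {\<nu>. \<nu> \<in> partitions \<and> schur \<nu> \<alpha> \<noteq> 0}"
  have bij: "bij_betw strip X (strips n r (Poly_Mapping.lookup \<alpha>))"
    unfolding X_def by (rule bij_betw_strip) (use assms in \<open>auto simp: n_def\<close>)
  have J: "det (e_mat e n (\<lambda>j. card (column (strip T) j))) = J (map length T)" if "T \<in> X" for T
  proof -
    have T: "tableau T" using that by (simp add: X_def)
    have "first_part (map length T) \<le> n"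
    proof (cases "first_part (map length T)")
      case (Suc p)
      then have "p \<in> strip T (T ! 0 ! p)"
        by (cases T) (auto simp: first_part_def strip_def intro!: exI[of _ 0])
      moreover have "strip T \<in> strips n r (Poly_Mapping.lookup \<alpha>)"
        using bij that by (auto simp: bij_betw_def)
      then have "strip T i \<subseteq> {0..<n}" for i
        by (cases "i < r") (auto simp: strips_def)
      ultimately show ?thesis using Suc by fastforce
    qed simp
    then have "J (map length T) = det (e_mat e n (\<lambda>j. conj_part (map length T) (Suc j)))"
      using T by (intro J_eq_det) (auto simp: tableau_def)
    then show ?thesis by (simp add: conj_part_tableau[OF T])
  qed
  have schur: "schur \<nu> \<alpha> = int (card {T \<in> X. map length T = \<nu>})" if "\<nu> \<in> partitions" for \<nu>
  proof -
    have "{T \<in> SSYT \<nu>. seq_expvec (concat T) = \<alpha>} = {T \<in> X. map length T = \<nu>}"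
      using that by (auto simp: X_def tableau_def) (auto simp: SSYT_def)
    then show ?thesis by (simp add: schur_def)
  qed
  have "finite X" using finite_tableaux[of \<alpha>] by (simp add: X_def)
  have sub: "map length ` X \<subseteq> Y"
  proof clarify
    fix T assume "T \<in> X"
    then have "map length T \<in> partitions" by (simp add: X_def tableau_def)
    moreover have "{U \<in> X. map length U = map length T} \<noteq> {}" using \<open>T \<in> X\<close> by auto
    ultimately show "map length T \<in> Y"
      using \<open>finite X\<close> by (auto simp: Y_def schur)
  qed
  have "(\<Prod>i<r. h (int (Poly_Mapping.lookup \<alpha> i))) =
      (\<Sum>S\<in>strips n r (Poly_Mapping.lookup \<alpha>). det (e_mat e n (\<lambda>j. card (column S j))))"
    by (rule prod_h_eq_sum_strips) (simp add: n_def)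
  also have "\<dots> = (\<Sum>T\<in>X. det (e_mat e n (\<lambda>j. card (column (strip T) j))))"
    by (rule sum.reindex_bij_betw[OF bij, symmetric])
  also have "\<dots> = (\<Sum>T\<in>X. J (map length T))"
    by (intro sum.cong J refl)
  \<comment> \<open>Tableaux are grouped by shape, and the size of each group is the coefficient of
    \<alpha> in \<open>schur \<nu>\<close>.\<close>
  also have "\<dots> = (\<Sum>\<nu>\<in>Y. \<Sum>T | T \<in> X \<and> map length T = \<nu>. J (map length T))"
    using finite_schur_support[of \<alpha>] by (intro sum.group[symmetric] \<open>finite X\<close> sub) (simp add: Y_def)
  also have "\<dots> = (\<Sum>\<nu>\<in>Y. of_int (schur \<nu> \<alpha>) * J \<nu>)"
    by (intro sum.cong[OF refl]) (simp add: Y_def schur)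
  finally show ?thesis by (simp add: Y_def)
qed

end

section \<open>Congruence modulo an ideal\<close>

text \<open>Working with representatives instead of cosets keeps calculations in the type
  \<open>word_alg\<close>, where carrier conditions arise only for products.\<close>

definition ideal_cong :: "word_alg set \<Rightarrow> word_alg \<Rightarrow> word_alg \<Rightarrow> bool" where
  "ideal_cong I a b \<longleftrightarrow> a - b \<in> I"

text \<open>\<open>B \<alpha>\<close> may be any finite set that contains the support, so the exact
  support never has to be determined.\<close>

lemma (in abelian_monoid) has_formal_sumI:
  assumes "\<And>\<alpha>. finite (B \<alpha>)" "\<And>\<alpha>. B \<alpha> \<subseteq> A"
    and "\<And>\<alpha> i. i \<in> B \<alpha> \<Longrightarrow> f i \<alpha> \<in> carrier G" "\<And>\<alpha> i. i \<in> A \<Longrightarrow> i \<notin> B \<alpha> \<Longrightarrow> f i \<alpha> = \<zero>"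
    and "\<And>\<alpha>. S \<alpha> = (\<Oplus>i\<in>B \<alpha>. f i \<alpha>)"
  shows "has_formal_sum G f A S"
  unfolding has_formal_sum_def
proof (intro allI conjI)
  fix \<alpha>
  have sub: "{i \<in> A. f i \<alpha> \<noteq> \<zero>} \<subseteq> B \<alpha>" using assms(4) by blast
  then show "finite {i \<in> A. f i \<alpha> \<noteq> \<zero>}" using assms(1) finite_subset by blast
  have "(\<Oplus>i\<in>{i \<in> A. f i \<alpha> \<noteq> \<zero>}. f i \<alpha>) = (\<Oplus>i\<in>B \<alpha>. f i \<alpha>)"
    by (rule add.finprod_mono_neutral_cong_left) (use assms sub in auto)
  then show "S \<alpha> = (\<Oplus>i\<in>{i \<in> A. f i \<alpha> \<noteq> \<zero>}. f i \<alpha>)" using assms(5) by simp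
qed

text \<open>Summing over the support of the second argument makes linearity in the first one
  evident.\<close>

lemma pairing_eq_sum_right:
  "pairing a \<gamma> = (\<Sum>w\<in>Poly_Mapping.keys \<gamma>. Poly_Mapping.lookup a w * Poly_Mapping.lookup \<gamma> w)"
proof -
  have "pairing a \<gamma> = (\<Sum>w\<in>Poly_Mapping.keys a \<inter> Poly_Mapping.keys \<gamma>.
      Poly_Mapping.lookup a w * Poly_Mapping.lookup \<gamma> w)"
    unfolding pairing_def by (rule sum.mono_neutral_right) (auto simp: in_keys_iff)
  also have "\<dots> = (\<Sum>w\<in>Poly_Mapping.keys \<gamma>. Poly_Mapping.lookup a w * Poly_Mapping.lookup \<gamma> w)"
    by (rule sum.mono_neutral_left) (auto simp: in_keys_iff)
  finally show ?thesis .
qed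

lemma of_int_mult_eq_frag_cmul: "of_int c * x = frag_cmul c (x :: 'a::monoid_add \<Rightarrow>\<^sub>0 int)"
proof -
  have nat: "of_nat n * x = frag_cmul (int n) x" for n
    by (induction n) (simp_all add: distrib_right frag_cmul_distrib)
  show ?thesis
  proof (cases "c \<ge> 0")
    case True
    then show ?thesis using nat[of "nat c"] by simp
  next
    case False
    have "(of_nat (nat (- c)) :: 'a \<Rightarrow>\<^sub>0 int) = - of_int c" using False by simp
    then have "- (of_int c * x) = frag_cmul (- c) x" using nat[of "nat (- c)"] False by simp
    then show ?thesis by (metis minus_frag_cmul neg_equal_iff_equal)
  qed
qed

lemma lookup_of_int_mult:
  "Poly_Mapping.lookup (of_int c * (x :: word_alg)) w = c * Poly_Mapping.lookup x w"
  by (simp add: of_int_mult_eq_frag_cmul)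

lemma pairing_sum: "pairing (\<Sum>i\<in>A. of_int (c i) * a i) \<gamma> = (\<Sum>i\<in>A. c i * pairing (a i) \<gamma>)"
  unfolding pairing_eq_sum_right lookup_sum_pm lookup_of_int_mult sum_distrib_left sum_distrib_right
  by (subst sum.swap) (simp add: mult.assoc)

lemma pairing_diff: "pairing (a - b) \<gamma> = pairing a \<gamma> - pairing b \<gamma>"
  by (simp add: pairing_eq_sum_right lookup_minus left_diff_distrib sum_subtractf)

lemma of_int_mult_carrier: "x \<in> carrier (\<U> N) \<Longrightarrow> of_int k * x \<in> carrier (\<U> N)"
  using keys_cmul[of k x] by (auto simp: of_int_mult_eq_frag_cmul carrier_\<U>)

lemma \<U>_prod_list_closed: "(\<And>x. x \<in> set xs \<Longrightarrow> x \<in> carrier (\<U> N)) \<Longrightarrow> prod_list xs \<in> carrier (\<U> N)"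
  by (induction xs) (auto intro: \<U>_closed)

lemma J_poly_carrier: "J_poly N lt \<nu> \<in> carrier (\<U> N)"
  unfolding J_poly_def
  by (intro \<U>_sum_closed of_int_mult_carrier \<U>_prod_list_closed) (auto intro: e_poly_carrier)

lemma add_pow_\<Z>: "[k] \<cdot>\<^bsub>\<Z>\<^esub> (x::int) = (k::int) * x"
proof -
  have nat: "[n] \<cdot>\<^bsub>\<Z>\<^esub> x = int n * x" for n :: nat
    by (induction n) (simp_all add: add_pow_def nat_pow_def algebra_simps)
  show ?thesis
    by (cases "k \<ge> 0") (simp_all add: add_pow_int_ge add_pow_int_lt nat int_a_inv_eq)
qed

definition centralizer :: "nat \<Rightarrow> word_alg set \<Rightarrow> word_alg \<Rightarrow> word_alg set" where
  "centralizer N I x = {a \<in> carrier (\<U> N). ideal_cong I (x * a) (a * x)}"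

text \<open>The polynomial ring in commuting variables \<open>h\<^sub>1, h\<^sub>2, \<dots>\<close>: a monomial is the multiset of its
  indices.\<close>

type_synonym h_ring = "nat multiset \<Rightarrow>\<^sub>0 int"

section \<open>The universal commutative pair\<close>

definition h_var :: "int \<Rightarrow> h_ring" where
  "h_var k = (if k < 0 then 0 else if k = 0 then 1 else frag_of {#nat k#})"

text \<open>Solving the alternating relation for \<open>e_k\<close> makes the \<open>eh_pair\<close>
  axioms hold by construction. The sign \<open>(-1)^(k+i)\<close> combines the sign
  \<open>(-1)^i\<close> of the relation with the factor \<open>(-1)^k\<close> that isolates
  \<open>e_k\<close>.\<close>

fun e_rec :: "nat \<Rightarrow> h_ring" where
  "e_rec k = (if k = 0 then 1 else - (\<Sum>i<k. (- 1) ^ (k + i) * (h_var (int (k - i)) * e_rec i)))"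

declare e_rec.simps [simp del]

definition e_var :: "int \<Rightarrow> h_ring" where
  "e_var k = (if k < 0 then 0 else e_rec (nat k))"

interpretation univ: eh_pair e_var h_var
proof
  show "e_var k = 0" if "k < 0" for k using that by (simp add: e_var_def)
  show "e_var 0 = 1" by (simp add: e_var_def e_rec.simps)
  show "h_var 0 = 1" by (simp add: h_var_def)
  fix k :: nat assume k: "k > 0"
  have "(\<Sum>i\<le>k. (- 1) ^ i * e_var (int i) * h_var (int (k - i))) =
      (\<Sum>i<k. (- 1) ^ i * e_rec i * h_var (int (k - i))) + (- 1) ^ k * e_rec k"
    by (simp add: e_var_def h_var_def flip: lessThan_Suc_atMost)
  also have "(- 1) ^ k * e_rec k = - (\<Sum>i<k. (- 1) ^ i * e_rec i * h_var (int (k - i)))"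
    using k by (subst e_rec.simps) (simp add: sum_distrib_left power_add mult_ac flip: power_mult_distrib)
  finally show "(\<Sum>i\<le>k. (- 1) ^ i * e_var (int i) * h_var (int (k - i))) = 0" by simp
qed

context
  fixes N :: nat and I :: "word_alg set"
  assumes I: "ideal I (\<U> N)"
begin

lemma ideal_closed:
  "0 \<in> I" "a \<in> I \<Longrightarrow> b \<in> I \<Longrightarrow> a + b \<in> I"
  "a \<in> I \<Longrightarrow> x \<in> carrier (\<U> N) \<Longrightarrow> x * a \<in> I" "a \<in> I \<Longrightarrow> x \<in> carrier (\<U> N) \<Longrightarrow> a * x \<in> I"
  "a \<in> I \<Longrightarrow> - a \<in> I"
proof -
  interpret ideal I "\<U> N" by (rule I)
  show "0 \<in> I" "a \<in> I \<Longrightarrow> b \<in> I \<Longrightarrow> a + b \<in> I"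
    using additive_subgroup.zero_closed[OF additive_subgroup_axioms]
      additive_subgroup.a_closed[OF additive_subgroup_axioms, of a b] by simp_all
  show l: "a \<in> I \<Longrightarrow> x \<in> carrier (\<U> N) \<Longrightarrow> x * a \<in> I" for x
    using I_l_closed[of a x] by simp
  show "a \<in> I \<Longrightarrow> x \<in> carrier (\<U> N) \<Longrightarrow> a * x \<in> I"
    using I_r_closed[of a x] by simp
  show "a \<in> I \<Longrightarrow> - a \<in> I"
    using l[of "- 1"] \<U>_closed(4)[OF \<U>_closed(6)] by simp
qed

lemma ideal_cong_refl: "ideal_cong I a a"
  by (simp add: ideal_cong_def ideal_closed)

lemma ideal_cong_sym: "ideal_cong I a b \<Longrightarrow> ideal_cong I b a"
  using ideal_closed(5)[of "a - b"] by (simp add: ideal_cong_def)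

lemma ideal_cong_trans [trans]: "ideal_cong I a b \<Longrightarrow> ideal_cong I b c \<Longrightarrow> ideal_cong I a c"
  using ideal_closed(2)[of "a - b" "b - c"] by (simp add: ideal_cong_def)

lemma ideal_cong_add: "ideal_cong I a b \<Longrightarrow> ideal_cong I c d \<Longrightarrow> ideal_cong I (a + c) (b + d)"
  using ideal_closed(2)[of "a - b" "c - d"] by (simp add: ideal_cong_def algebra_simps)

lemma ideal_cong_minus: "ideal_cong I a b \<Longrightarrow> ideal_cong I (- a) (- b)"
  using ideal_closed(5)[of "a - b"] by (simp add: ideal_cong_def)

lemma ideal_cong_diff: "ideal_cong I a b \<Longrightarrow> ideal_cong I c d \<Longrightarrow> ideal_cong I (a - c) (b - d)"
  using ideal_cong_add[OF _ ideal_cong_minus] by simp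

text \<open>In \<open>a * c - b * d = a * (c - d) + (a - b) * d\<close> the ideal elements are
  multiplied by \<open>a\<close> and \<open>d\<close> only, hence the two carrier
  conditions.\<close>

lemma ideal_cong_mult:
  assumes "ideal_cong I a b" "ideal_cong I c d" "a \<in> carrier (\<U> N)" "d \<in> carrier (\<U> N)"
  shows "ideal_cong I (a * c) (b * d)"
proof -
  have "a * (c - d) + (a - b) * d \<in> I"
    using assms by (intro ideal_closed) (auto simp: ideal_cong_def)
  then show ?thesis by (simp add: ideal_cong_def algebra_simps)
qed

lemma ideal_cong_sum: "(\<And>i. i \<in> A \<Longrightarrow> ideal_cong I (f i) (g i)) \<Longrightarrow> ideal_cong I (sum f A) (sum g A)"
  by (induction A rule: infinite_finite_induct) (auto intro: ideal_cong_refl ideal_cong_add)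

lemma ideal_cong_sign: "ideal_cong I a b \<Longrightarrow> ideal_cong I ((- 1) ^ i * a) ((- 1) ^ i * b)"
  by (cases "even i") (auto intro: ideal_cong_minus)

lemma ideal_cong_of_int_mult: "ideal_cong I a b \<Longrightarrow> ideal_cong I (of_int k * a) (of_int k * b)"
  using ideal_closed(3)[of "a - b" "of_int k"] of_int_mult_carrier[OF \<U>_closed(6), of k]
  by (simp add: ideal_cong_def right_diff_distrib)

lemma ideal_cong_prod_list:
  assumes "\<And>x. x \<in> set xs \<Longrightarrow> f x \<in> carrier (\<U> N)" "\<And>x. x \<in> set xs \<Longrightarrow> g x \<in> carrier (\<U> N)"
    and "\<And>x. x \<in> set xs \<Longrightarrow> ideal_cong I (f x) (g x)"
  shows "ideal_cong I (prod_list (map f xs)) (prod_list (map g xs))"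
  using assms
  by (induction xs) (auto intro!: ideal_cong_refl ideal_cong_mult \<U>_prod_list_closed)

lemma residue_class_eq_iff:
  assumes "a \<in> carrier (\<U> N)" "b \<in> carrier (\<U> N)"
  shows "residue_class N I a = residue_class N I b \<longleftrightarrow> ideal_cong I a b"
proof -
  have rc: "residue_class N I c = {x. x - c \<in> I}" for c
    by (auto simp: residue_class_def a_r_coset_def' intro!: bexI[of _ "_ - c"])
  show ?thesis
  proof
    assume "residue_class N I a = residue_class N I b"
    moreover have "a \<in> residue_class N I a" by (simp add: rc ideal_closed)
    ultimately show "ideal_cong I a b" by (simp add: rc ideal_cong_def)
  next
    assume "ideal_cong I a b"
    then have "ideal_cong I x a \<longleftrightarrow> ideal_cong I x b" for x
      using ideal_cong_trans ideal_cong_sym by blast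
    then show "residue_class N I a = residue_class N I b" by (simp add: rc ideal_cong_def)
  qed
qed

lemma residue_class_hom: "ring_hom_ring (\<U> N) (\<U> N Quot I) (residue_class N I)"
  using ideal.rcos_ring_hom_ring[OF I] by (simp add: residue_class_def[abs_def])

lemma residue_class_carrier: "a \<in> carrier (\<U> N) \<Longrightarrow> residue_class N I a \<in> carrier (\<U> N Quot I)"
  using ring_hom_ring.homh[OF residue_class_hom] ring_hom_closed by fast

lemma commute_mod_iff:
  assumes "\<And>k. f k \<in> carrier (\<U> N)"
  shows "commute_mod N I f \<longleftrightarrow> (\<forall>k l. ideal_cong I (f k * f l) (f l * f k))"
proof -
  interpret hom: ring_hom_ring "\<U> N" "\<U> N Quot I" "residue_class N I" by (rule residue_class_hom)
  show ?thesis
    unfolding commute_mod_def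
    using residue_class_eq_iff[OF \<U>_closed(1)[OF assms assms] \<U>_closed(1)[OF assms assms]] hom.hom_mult[OF assms assms]
    by simp
qed

lemma residue_class_add_pow:
  fixes k :: int
  assumes a: "a \<in> carrier (\<U> N)"
  shows "[k] \<cdot>\<^bsub>\<U> N Quot I\<^esub> residue_class N I a = residue_class N I (of_int k * a)"
proof -
  interpret hom: ring_hom_ring "\<U> N" "\<U> N Quot I" "residue_class N I" by (rule residue_class_hom)
  have closed: "of_nat n * a \<in> carrier (\<U> N)" for n :: nat
    using of_int_mult_carrier[OF a, of "int n"] by simp
  have nat: "[n] \<cdot>\<^bsub>\<U> N Quot I\<^esub> residue_class N I a = residue_class N I (of_nat n * a)" for n :: nat
  proof (induction n)
    case (Suc n)
    have "residue_class N I (of_nat (Suc n) * a) = residue_class N I (of_nat n * a \<oplus>\<^bsub>\<U> N\<^esub> a)"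
      by (simp add: distrib_right add.commute)
    then show ?case
      using Suc by (simp add: hom.S.add.nat_pow_Suc hom.hom_add closed a del: \<U>_simps)
  qed (use hom.hom_zero in simp)
  show ?thesis
  proof (cases "k \<ge> 0")
    case True
    then show ?thesis using nat[of "nat k"] by (simp add: add_pow_int_ge)
  next
    case False
    have minus: "\<ominus>\<^bsub>\<U> N Quot I\<^esub> residue_class N I b = residue_class N I (- b)" if b: "b \<in> carrier (\<U> N)" for b
    proof (rule hom.S.minus_equality)
      show "residue_class N I (- b) \<oplus>\<^bsub>\<U> N Quot I\<^esub> residue_class N I b = \<zero>\<^bsub>\<U> N Quot I\<^esub>"
        using hom.hom_add[of "- b" b] hom.hom_zero b by (simp add: \<U>_closed)
    qed (use b in \<open>auto intro: residue_class_carrier \<U>_closed\<close>)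
    have "[k] \<cdot>\<^bsub>\<U> N Quot I\<^esub> residue_class N I a = residue_class N I (- (of_nat (nat (- k)) * a))"
      using False by (simp only: add_pow_int_lt nat minus[OF closed] not_le)
    also have "(of_nat (nat (- k)) :: word_alg) = - of_int k"
      using False by simp
    finally show ?thesis by simp
  qed
qed

lemma residue_class_finsum:
  assumes "\<And>i. i \<in> A \<Longrightarrow> f i \<in> carrier (\<U> N)"
  shows "(\<Oplus>\<^bsub>\<U> N Quot I\<^esub>i\<in>A. residue_class N I (f i)) = residue_class N I (\<Sum>i\<in>A. f i)"
proof -
  interpret hom: ring_hom_ring "\<U> N" "\<U> N Quot I" "residue_class N I" by (rule residue_class_hom)
  show ?thesis
    using assms
  proof (induction A rule: infinite_finite_induct)
    case (insert i A)
    have "residue_class N I (f i + sum f A) = residue_class N I (f i \<oplus>\<^bsub>\<U> N\<^esub> sum f A)" by simp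
    also have "\<dots> = residue_class N I (f i) \<oplus>\<^bsub>\<U> N Quot I\<^esub> residue_class N I (sum f A)"
      using insert.prems by (intro hom.hom_add \<U>_sum_closed) auto
    finally show ?case
      using insert by (subst hom.S.finsum_insert) (auto intro!: residue_class_carrier)
  qed (use hom.hom_zero in \<open>simp_all add: hom.S.finsum_infinite\<close>)
qed

text \<open>Reduces a formal sum over the quotient to one congruence in the free algebra for each
  exponent vector.\<close>

lemma has_formal_sum_Quot:
  assumes "\<And>\<alpha>. finite (B \<alpha>)" "\<And>\<alpha>. B \<alpha> \<subseteq> A" "\<And>\<alpha> i. i \<in> A \<Longrightarrow> i \<notin> B \<alpha> \<Longrightarrow> p i \<alpha> = 0"
    and a: "\<And>i. a i \<in> carrier (\<U> N)" and S: "\<And>\<alpha>. S \<alpha> \<in> carrier (\<U> N)"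
    and cong: "\<And>\<alpha>. ideal_cong I (S \<alpha>) (\<Sum>i\<in>B \<alpha>. of_int (p i \<alpha>) * a i)"
  shows "has_formal_sum (\<U> N Quot I) (\<lambda>i. ps_times (\<U> N Quot I) (p i) (residue_class N I (a i))) A
    (\<lambda>\<alpha>. residue_class N I (S \<alpha>))"
proof -
  interpret hom: ring_hom_ring "\<U> N" "\<U> N Quot I" "residue_class N I" by (rule residue_class_hom)
  have zero: "residue_class N I 0 = \<zero>\<^bsub>\<U> N Quot I\<^esub>" using hom.hom_zero by simp
  show ?thesis
  proof (rule hom.S.has_formal_sumI[where B = B])
    fix \<alpha>
    have "residue_class N I (S \<alpha>) = residue_class N I (\<Sum>i\<in>B \<alpha>. of_int (p i \<alpha>) * a i)"
      using cong S a by (subst residue_class_eq_iff) (auto intro!: \<U>_sum_closed of_int_mult_carrier)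
    then show "residue_class N I (S \<alpha>) =
        (\<Oplus>\<^bsub>\<U> N Quot I\<^esub>i\<in>B \<alpha>. ps_times (\<U> N Quot I) (p i) (residue_class N I (a i)) \<alpha>)"
      by (simp add: ps_times_def residue_class_add_pow a residue_class_finsum of_int_mult_carrier)
  qed (use assms in \<open>auto simp: ps_times_def residue_class_add_pow zero intro!: residue_class_carrier of_int_mult_carrier\<close>)
qed

text \<open>The alternating sum can be solved for either family.\<close>

lemma alternating_generates:
  fixes f g :: "nat \<Rightarrow> word_alg"
  assumes alt: "\<And>k. k > 0 \<Longrightarrow> (\<Sum>i\<le>k. (- 1) ^ i * (f (k - i) * g i)) = 0" and "f 0 = 1" "g 0 = 1"
    and P: "P 1" "P 0" "\<And>a b. P a \<Longrightarrow> P b \<Longrightarrow> P (a + b)" "\<And>a b. P a \<Longrightarrow> P b \<Longrightarrow> P (a * b)" "\<And>a. P a \<Longrightarrow> P (- a)"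
  shows "(\<And>k. P (f k)) \<Longrightarrow> P (g k)" "(\<And>k. P (g k)) \<Longrightarrow> P (f k)"
proof -
  have sign: "P ((- 1) ^ i * a)" if "P a" for i a
    using that P(5) by (cases "even i") auto
  have sum: "P (sum F A)" if "\<And>i. i \<in> A \<Longrightarrow> P (F i)" for F and A :: "nat set"
    using that by (induction A rule: infinite_finite_induct) (auto intro: P)
  show "P (g k)" if f: "\<And>k. P (f k)"
  proof (induction k rule: less_induct)
    case (less k)
    show ?case
    proof (cases "k = 0")
      case False
      then have "(\<Sum>i<k. (- 1) ^ i * (f (k - i) * g i)) + (- 1) ^ k * g k = 0"
        using alt[of k] assms(2) by (simp flip: lessThan_Suc_atMost)
      then have "(- 1) ^ k * g k = - (\<Sum>i<k. (- 1) ^ i * (f (k - i) * g i))"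
        by (simp add: eq_neg_iff_add_eq_0 add.commute)
      moreover have "g k = (- 1) ^ k * ((- 1) ^ k * g k)"
        by (cases "even k") auto
      moreover have "P (- (\<Sum>i<k. (- 1) ^ i * (f (k - i) * g i)))"
        using less f by (intro P(5) sum sign P(4)) auto
      ultimately show ?thesis using sign by metis
    qed (use assms(3) P(1) in simp)
  qed
  show "P (f k)" if g: "\<And>k. P (g k)"
  proof (induction k rule: less_induct)
    case (less k)
    show ?case
    proof (cases "k = 0")
      case False
      then have "f k + (\<Sum>i = 1..k. (- 1) ^ i * (f (k - i) * g i)) = 0"
        using alt[of k] assms(3) by (simp add: atMost_atLeast0 sum.atLeast_Suc_atMost)
      then have "f k = - (\<Sum>i = 1..k. (- 1) ^ i * (f (k - i) * g i))"
        by (simp add: eq_neg_iff_add_eq_0)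
      moreover have "P (- (\<Sum>i = 1..k. (- 1) ^ i * (f (k - i) * g i)))"
        using less g by (intro P(5) sum sign P(4)) auto
      ultimately show ?thesis by simp
    qed (use assms(2) P(1) in simp)
  qed
qed

text \<open>For products, \<open>x a b\<close>, \<open>a x b\<close> and \<open>a b x\<close> are
  congruent. These are the closure properties that \<open>alternating_generates\<close>
  demands.\<close>

lemma centralizer_closed:
  assumes x: "x \<in> carrier (\<U> N)"
  shows "1 \<in> centralizer N I x" "0 \<in> centralizer N I x"
    "a \<in> centralizer N I x \<Longrightarrow> b \<in> centralizer N I x \<Longrightarrow> a + b \<in> centralizer N I x"
    "a \<in> centralizer N I x \<Longrightarrow> b \<in> centralizer N I x \<Longrightarrow> a * b \<in> centralizer N I x"
    "a \<in> centralizer N I x \<Longrightarrow> - a \<in> centralizer N I x"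
proof -
  show "1 \<in> centralizer N I x" "0 \<in> centralizer N I x"
    by (simp_all add: centralizer_def ideal_cong_refl \<U>_closed)
  show "a + b \<in> centralizer N I x" if "a \<in> centralizer N I x" "b \<in> centralizer N I x"
    using that ideal_cong_add[of "x * a" "a * x" "x * b" "b * x"]
    by (simp add: centralizer_def \<U>_closed distrib_left distrib_right)
  show "- a \<in> centralizer N I x" if "a \<in> centralizer N I x"
    using that ideal_cong_minus[of "x * a" "a * x"] by (simp add: centralizer_def \<U>_closed)
  show "a * b \<in> centralizer N I x" if "a \<in> centralizer N I x" "b \<in> centralizer N I x"
  proof -
    have ab: "a \<in> carrier (\<U> N)" "b \<in> carrier (\<U> N)" "ideal_cong I (x * a) (a * x)" "ideal_cong I (x * b) (b * x)"
      using that by (simp_all add: centralizer_def)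
    have "ideal_cong I (x * a * b) (a * x * b)"
      by (rule ideal_cong_mult[OF ab(3) ideal_cong_refl \<U>_closed(1)[OF x ab(1)] ab(2)])
    moreover have "ideal_cong I (a * (x * b)) (a * (b * x))"
      by (rule ideal_cong_mult[OF ideal_cong_refl ab(4,1) \<U>_closed(1)[OF ab(2) x]])
    ultimately have "ideal_cong I (x * (a * b)) (a * b * x)"
      unfolding mult.assoc by (rule ideal_cong_trans)
    then show ?thesis using ab by (simp add: centralizer_def \<U>_closed)
  qed
qed

context
  fixes lt :: "letter \<Rightarrow> letter \<Rightarrow> bool"
  assumes so: "shuffle_order N lt"
begin

lemma commute_int_iff_nat:
  assumes "\<And>k. k < 0 \<Longrightarrow> f k = 0"
  shows "(\<forall>k l. ideal_cong I (f k * f l) (f l * f k)) \<longleftrightarrow>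
    (\<forall>k l. ideal_cong I (f (int k) * f (int l)) (f (int l) * f (int k)))"
proof
  assume *: "\<forall>k l. ideal_cong I (f (int k) * f (int l)) (f (int l) * f (int k))"
  have "ideal_cong I (f k * f l) (f l * f k)" for k l
  proof (cases "k < 0 \<or> l < 0")
    case True
    then show ?thesis using assms by (auto intro: ideal_cong_refl)
  next
    case False
    then show ?thesis using *[rule_format, of "nat k" "nat l"] by simp
  qed
  then show "\<forall>k l. ideal_cong I (f k * f l) (f l * f k)" by blast
qed simp

text \<open>Generation is used twice in each direction: the centralizer of one \<open>f l\<close>
  contains all \<open>f k\<close>, hence all \<open>g k\<close>; by symmetry the centralizer of one
  \<open>g k\<close> contains all \<open>f l\<close>, hence all \<open>g l\<close>.\<close>

lemma commute_e_iff_commute_h: "commute_mod N I (e_poly N lt) \<longleftrightarrow> commute_mod N I (h_poly N lt)"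
proof -
  let ?h = "\<lambda>k. h_poly N lt (int k)" and ?e = "\<lambda>k. e_poly N lt (int k)"
  have gen1: "?e k \<in> centralizer N I x" if "x \<in> carrier (\<U> N)" "\<And>k. ?h k \<in> centralizer N I x" for x k
    by (rule alternating_generates(1)[where f = ?h and g = ?e and P = "\<lambda>a. a \<in> centralizer N I x"])
      (simp_all add: h_e_alternating[OF so] centralizer_closed[OF that(1)] that(2) del: of_nat_diff)
  have gen2: "?h k \<in> centralizer N I x" if "x \<in> carrier (\<U> N)" "\<And>k. ?e k \<in> centralizer N I x" for x k
    by (rule alternating_generates(2)[where f = ?h and g = ?e and P = "\<lambda>a. a \<in> centralizer N I x"])
      (simp_all add: h_e_alternating[OF so] centralizer_closed[OF that(1)] that(2) del: of_nat_diff)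
  have transfer: "\<forall>k l. ideal_cong I (g k * g l) (g l * g k)"
    if comm: "\<forall>k l. ideal_cong I (f k * f l) (f l * f k)"
      and gen: "\<And>x k. x \<in> carrier (\<U> N) \<Longrightarrow> (\<And>k. f k \<in> centralizer N I x) \<Longrightarrow> g k \<in> centralizer N I x"
      and f: "\<And>k. f k \<in> carrier (\<U> N)" and g: "\<And>k. g k \<in> carrier (\<U> N)" for f g :: "nat \<Rightarrow> word_alg"
  proof -
    have "f k \<in> centralizer N I (f l)" for k l
      using comm f by (simp add: centralizer_def)
    then have "g k \<in> centralizer N I (f l)" for k l
      using gen[OF f] by blast
    then have "f l \<in> centralizer N I (g k)" for k l
      using f ideal_cong_sym by (simp add: centralizer_def)
    then have "g l \<in> centralizer N I (g k)" for k l
      using gen[OF g] by blast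
    then show ?thesis by (simp add: centralizer_def)
  qed
  have "(\<forall>k l. ideal_cong I (?e k * ?e l) (?e l * ?e k)) \<longleftrightarrow> (\<forall>k l. ideal_cong I (?h k * ?h l) (?h l * ?h k))"
    using transfer[of ?h ?e, OF _ gen1] transfer[of ?e ?h, OF _ gen2] h_poly_carrier e_poly_carrier by blast
  moreover have "(\<forall>k l. ideal_cong I (e_poly N lt k * e_poly N lt l) (e_poly N lt l * e_poly N lt k)) \<longleftrightarrow>
      (\<forall>k l. ideal_cong I (?e k * ?e l) (?e l * ?e k))"
    by (rule commute_int_iff_nat) (simp add: e_poly_def)
  moreover have "(\<forall>k l. ideal_cong I (h_poly N lt k * h_poly N lt l) (h_poly N lt l * h_poly N lt k)) \<longleftrightarrow>
      (\<forall>k l. ideal_cong I (?h k * ?h l) (?h l * ?h k))"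
    by (rule commute_int_iff_nat) (simp add: h_poly_def)
  ultimately show ?thesis
    unfolding commute_mod_iff[OF e_poly_carrier] commute_mod_iff[OF h_poly_carrier] by (simp only:)
qed

end

end

section \<open>Substituting commuting elements\<close>

text \<open>A monomial has no order, so its factors are arranged by increasing index. The choice is
  immaterial only modulo an ideal in which the \<open>h_k\<close> commute.\<close>

definition subst_h :: "nat \<Rightarrow> (letter \<Rightarrow> letter \<Rightarrow> bool) \<Rightarrow> h_ring \<Rightarrow> word_alg" where
  "subst_h N lt = frag_extend (\<lambda>M. h_list N lt (sorted_list_of_multiset M))"

lemma h_list_Cons: "h_list N lt (k # ks) = h_poly N lt (int k) * h_list N lt ks"
  by (simp add: h_list_def)

lemma h_list_append: "h_list N lt (ks @ ls) = h_list N lt ks * h_list N lt ls"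
  by (simp add: h_list_def)

lemma h_list_filter: "h_list N lt (filter (\<lambda>k. k \<noteq> 0) ks) = h_list N lt ks"
  by (induction ks) (simp_all add: h_list_def)

lemma subst_h_carrier: "subst_h N lt p \<in> carrier (\<U> N)"
  using keys_frag_extend[of "\<lambda>M. h_list N lt (sorted_list_of_multiset M)" p]
    h_list_eq_word_sum[of N lt] finite_splits[of N lt]
  by (auto simp: subst_h_def carrier_\<U> keys_word_sum)

lemma subst_h_add: "subst_h N lt (p + q) = subst_h N lt p + subst_h N lt q"
  and subst_h_diff: "subst_h N lt (p - q) = subst_h N lt p - subst_h N lt q"
  and subst_h_minus: "subst_h N lt (- p) = - subst_h N lt p"
  and subst_h_zero: "subst_h N lt 0 = 0"
  by (simp_all add: subst_h_def frag_extend_add frag_extend_diff frag_extend_minus)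

lemma subst_h_sum: "subst_h N lt (\<Sum>i\<in>A. f i) = (\<Sum>i\<in>A. subst_h N lt (f i))"
  by (induction A rule: infinite_finite_induct) (simp_all add: subst_h_add subst_h_zero)

lemma subst_h_of_int_mult: "subst_h N lt (of_int c * p) = of_int c * subst_h N lt p"
  by (simp add: subst_h_def of_int_mult_eq_frag_cmul frag_extend_cmul)

lemma subst_h_sign: "subst_h N lt ((- 1) ^ i * p) = (- 1) ^ i * subst_h N lt p"
  by (cases "even i") (simp_all add: subst_h_minus)

lemma subst_h_one: "subst_h N lt 1 = 1"
proof -
  have one: "(1 :: h_ring) = frag_of {#}" by (simp flip: single_one)
  show ?thesis unfolding subst_h_def one frag_extend_of by (simp add: h_list_def)
qed

lemma subst_h_h_var: "subst_h N lt (h_var k) = h_poly N lt k"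
proof -
  consider "k < 0" | "k = 0" | "k > 0" by linarith
  then show ?thesis
  proof cases
    case 3
    then show ?thesis by (simp add: h_var_def subst_h_def h_list_def)
  qed (simp_all add: h_var_def subst_h_zero subst_h_one, simp add: h_poly_def)
qed

lemma mset_composition:
  "mset (filter (\<lambda>k. k \<noteq> 0) (map (Poly_Mapping.lookup \<alpha>) [0..<Poly_Mapping.degree \<alpha>])) =
    image_mset (Poly_Mapping.lookup \<alpha>) (mset_set (Poly_Mapping.keys (\<alpha> :: expvec)))"
proof -
  let ?is = "filter (\<lambda>i. Poly_Mapping.lookup \<alpha> i \<noteq> 0) [0..<Poly_Mapping.degree \<alpha>]"
  have "set ?is = Poly_Mapping.keys \<alpha>"
  proof (rule Set.set_eqI)
    fix i
    show "i \<in> set ?is \<longleftrightarrow> i \<in> Poly_Mapping.keys \<alpha>"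
      using in_keys_less_degree[of i \<alpha>] in_keys_iff[of i \<alpha>] by auto
  qed
  then have "mset ?is = mset_set (Poly_Mapping.keys \<alpha>)"
    by (metis distinct_filter distinct_upt mset_set_set)
  then show ?thesis
    by (simp only: filter_map mset_map o_def)
qed

text \<open>The nonzero exponents in weakly decreasing order, that is, the only partition whose
  monomial function contains this exponent vector.\<close>

definition parts_of :: "expvec \<Rightarrow> nat list" where
  "parts_of \<alpha> = rev (sorted_list_of_multiset (image_mset (Poly_Mapping.lookup \<alpha>) (mset_set (Poly_Mapping.keys \<alpha>))))"

lemma monomial_sf_partition:
  assumes "\<nu> \<in> partitions"
  shows "monomial_sf \<nu> \<alpha> = of_bool (\<nu> = parts_of \<alpha>)"
proof -
  have "sorted (rev \<nu>)"
    using assms by (simp add: partitions_def sorted_wrt_rev)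
  then have "\<nu> = rev (sorted_list_of_multiset (mset \<nu>))"
    by (metis mset_rev rev_rev_ident sorted_list_of_multiset_mset sorted_sort_id)
  then have "M = mset \<nu> \<longleftrightarrow> \<nu> = rev (sorted_list_of_multiset M)" for M
    by (metis mset_rev mset_sorted_list_of_multiset)
  then show ?thesis by (simp only: monomial_sf_def parts_of_def of_bool_def)
qed

lemma parts_of_partition: "parts_of \<alpha> \<in> partitions"
proof -
  have "sorted (rev (parts_of \<alpha>))"
    by (simp add: parts_of_def)
  then have "sorted_wrt (\<ge>) (parts_of \<alpha>)"
    using sorted_wrt_rev[of "(\<le>)" "parts_of \<alpha>"] by simp
  moreover have "0 \<notin> set (parts_of \<alpha>)"
    by (auto simp: parts_of_def in_keys_iff)
  ultimately show ?thesis by (simp add: partitions_def)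
qed

section \<open>Substitution when the \<open>h_k\<close> commute modulo the ideal\<close>

context
  fixes N :: nat and I :: "word_alg set" and lt :: "letter \<Rightarrow> letter \<Rightarrow> bool"
  assumes I: "ideal I (\<U> N)" and so: "shuffle_order N lt"
    and comm: "\<And>k l. ideal_cong I (h_poly N lt k * h_poly N lt l) (h_poly N lt l * h_poly N lt k)"
begin

lemmas cong_refl = ideal_cong_refl[OF I]
lemmas cong_sym = ideal_cong_sym[OF I]
lemmas cong_trans [trans] = ideal_cong_trans[OF I]
lemmas cong_mult = ideal_cong_mult[OF I]
lemmas h_list_in_carrier = h_list_carrier[OF so]

text \<open>Each step of the insertion exchanges two neighbouring factors, which is one use of the
  commutation hypothesis.\<close>

lemma h_list_insort: "ideal_cong I (h_list N lt (insort k ks)) (h_list N lt (k # ks))"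
proof (induction ks)
  case (Cons a ks)
  show ?case
  proof (cases "k \<le> a")
    case False
    have "ideal_cong I (h_list N lt (insort k (a # ks))) (h_poly N lt (int a) * (h_poly N lt (int k) * h_list N lt ks))"
      using False Cons h_poly_carrier h_list_in_carrier
      by (auto simp: h_list_Cons intro!: cong_mult cong_refl \<U>_closed)
    also have "\<dots> = h_poly N lt (int a) * h_poly N lt (int k) * h_list N lt ks"
      by (simp add: mult.assoc)
    also have "ideal_cong I \<dots> (h_poly N lt (int k) * h_poly N lt (int a) * h_list N lt ks)"
      by (intro cong_mult comm cong_refl \<U>_closed h_poly_carrier h_list_in_carrier)
    finally show ?thesis by (simp add: h_list_Cons mult.assoc)
  qed (simp add: cong_refl)
qed (simp add: cong_refl)

lemma h_list_sort: "ideal_cong I (h_list N lt (sort ks)) (h_list N lt ks)"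
proof (induction ks)
  case (Cons k ks)
  have "ideal_cong I (h_list N lt (sort (k # ks))) (h_list N lt (k # sort ks))"
    using h_list_insort by simp
  also have "ideal_cong I \<dots> (h_list N lt (k # ks))"
    unfolding h_list_Cons by (intro cong_mult cong_refl Cons h_poly_carrier h_list_in_carrier)
  finally show ?case .
qed (simp add: cong_refl)

lemma h_list_mset_cong: "mset ks = mset ls \<Longrightarrow> ideal_cong I (h_list N lt ks) (h_list N lt ls)"
  using cong_trans[OF cong_sym[OF h_list_sort[of ks]]] h_list_sort[of ls]
  by (metis sorted_list_of_multiset_mset)

text \<open>For two monomials both sides multiply the same multiset of \<open>h_k\<close> in
  different orders; additivity in each argument extends this to all elements.\<close>

lemma subst_h_mult: "ideal_cong I (subst_h N lt (p * q)) (subst_h N lt p * subst_h N lt q)"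
proof -
  have 1: "ideal_cong I (subst_h N lt (frag_of L * frag_of M)) (subst_h N lt (frag_of L) * subst_h N lt (frag_of M))" for L M
    by (simp add: subst_h_def mult_single flip: h_list_append) (rule h_list_mset_cong, simp)
  have 2: "ideal_cong I (subst_h N lt (p * frag_of M)) (subst_h N lt p * subst_h N lt (frag_of M))" for p M
    using subset_UNIV[of "Poly_Mapping.keys p"]
  proof (induction p rule: frag_induction)
    case zero
    show ?case by (simp add: subst_h_zero cong_refl)
  next
    case (one L)
    show ?case by (rule 1)
  next
    case (diff p q)
    then show ?case
      by (simp add: left_diff_distrib subst_h_diff ideal_cong_diff[OF I])
  qed
  show ?thesis
    using subset_UNIV[of "Poly_Mapping.keys q"]
  proof (induction q rule: frag_induction)
    case zero
    show ?case by (simp add: subst_h_zero cong_refl)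
  next
    case (one L)
    show ?case by (rule 2)
  next
    case (diff q r)
    then show ?case
      by (simp add: right_diff_distrib subst_h_diff ideal_cong_diff[OF I])
  qed
qed

lemma subst_h_prod_list: "ideal_cong I (subst_h N lt (prod_list ps)) (prod_list (map (subst_h N lt) ps))"
proof (induction ps)
  case (Cons p ps)
  have "ideal_cong I (subst_h N lt (prod_list (p # ps))) (subst_h N lt p * subst_h N lt (prod_list ps))"
    using subst_h_mult by simp
  also have "ideal_cong I \<dots> (subst_h N lt p * prod_list (map (subst_h N lt) ps))"
    by (intro cong_mult cong_refl Cons subst_h_carrier \<U>_prod_list_closed) (auto intro: subst_h_carrier)
  finally show ?case by simp
qed (simp add: subst_h_one cong_refl)

text \<open>The recursion of \<open>e_rec\<close>, valid in the free algebra itself; commutation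
  enters only through \<open>subst_h_mult\<close>.\<close>

lemma e_poly_rec:
  assumes "k > 0"
  shows "e_poly N lt (int k) = - (\<Sum>i<k. (- 1) ^ (k + i) * (h_poly N lt (int (k - i)) * e_poly N lt (int i)))"
proof -
  let ?S = "\<Sum>i<k. (- 1) ^ i * (h_poly N lt (int (k - i)) * e_poly N lt (int i))"
  have "?S + (- 1) ^ k * e_poly N lt (int k) = 0"
    using h_e_alternating[OF so assms] by (simp flip: lessThan_Suc_atMost)
  then have "(- 1) ^ k * e_poly N lt (int k) = - ?S"
    by (simp only: add_eq_0_iff)
  moreover have "(- 1) ^ k * ((- 1) ^ k * e_poly N lt (int k)) = e_poly N lt (int k)"
    by (cases "even k") simp_all
  ultimately have "e_poly N lt (int k) = - ((- 1) ^ k * ?S)"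
    by (simp only: mult_minus_right)
  then show ?thesis
    by (simp only: sum_distrib_left power_add mult.assoc)
qed

lemma subst_h_e_rec: "ideal_cong I (subst_h N lt (e_rec k)) (e_poly N lt (int k))"
proof (induction k rule: less_induct)
  case (less k)
  show ?case
  proof (cases "k = 0")
    case False
    have "ideal_cong I
        (- (\<Sum>i<k. (- 1) ^ (k + i) * subst_h N lt (h_var (int (k - i)) * e_rec i)))
        (- (\<Sum>i<k. (- 1) ^ (k + i) * (h_poly N lt (int (k - i)) * e_poly N lt (int i))))"
    proof (intro ideal_cong_minus[OF I] ideal_cong_sum[OF I] ideal_cong_sign[OF I])
      fix i assume i: "i \<in> {..<k}"
      have "ideal_cong I (subst_h N lt (h_var (int (k - i)) * e_rec i))
          (h_poly N lt (int (k - i)) * subst_h N lt (e_rec i))"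
        using subst_h_mult[of "h_var (int (k - i))" "e_rec i"] by (simp only: subst_h_h_var)
      also have "ideal_cong I \<dots> (h_poly N lt (int (k - i)) * e_poly N lt (int i))"
        using i by (intro cong_mult cong_refl less h_poly_carrier e_poly_carrier) simp
      finally show "ideal_cong I (subst_h N lt (h_var (int (k - i)) * e_rec i))
          (h_poly N lt (int (k - i)) * e_poly N lt (int i))" .
    qed
    moreover have "e_rec k = - (\<Sum>i<k. (- 1) ^ (k + i) * (h_var (int (k - i)) * e_rec i))"
      using False by (subst e_rec.simps) simp
    moreover have "k > 0" using False by simp
    ultimately show ?thesis
      by (simp only: e_poly_rec subst_h_minus subst_h_sum subst_h_sign)
  qed (simp add: e_rec.simps subst_h_one cong_refl)
qed

lemma subst_h_e_var: "ideal_cong I (subst_h N lt (e_var k)) (e_poly N lt k)"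
  using subst_h_e_rec[of "nat k"] by (cases "k < 0") (simp_all add: e_var_def subst_h_zero e_poly_def cong_refl)

lemma subst_h_J: "ideal_cong I (subst_h N lt (univ.J \<nu>)) (J_poly N lt \<nu>)"
proof -
  have "ideal_cong I (subst_h N lt (\<Prod>i\<leftarrow>is. e_var (f i))) (\<Prod>i\<leftarrow>is. e_poly N lt (f i))" for f and "is" :: "nat list"
  proof -
    have "ideal_cong I (subst_h N lt (\<Prod>i\<leftarrow>is. e_var (f i))) (\<Prod>i\<leftarrow>is. subst_h N lt (e_var (f i)))"
      using subst_h_prod_list[of "map (\<lambda>i. e_var (f i)) is"] by (simp add: o_def)
    also have "ideal_cong I \<dots> (\<Prod>i\<leftarrow>is. e_poly N lt (f i))"
      by (intro ideal_cong_prod_list[OF I] subst_h_carrier e_poly_carrier subst_h_e_var)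
    finally show ?thesis .
  qed
  then show ?thesis
    unfolding univ.J_def J_poly_def subst_h_sum subst_h_of_int_mult
    by (intro ideal_cong_sum[OF I] ideal_cong_of_int_mult[OF I])
qed

lemma h_comp_cong_schur:
  "ideal_cong I (h_comp N lt \<alpha>)
    (\<Sum>\<nu> | \<nu> \<in> partitions \<and> schur \<nu> \<alpha> \<noteq> 0. of_int (schur \<nu> \<alpha>) * J_poly N lt \<nu>)"
proof -
  let ?d = "Poly_Mapping.degree \<alpha>"
  have keys: "Poly_Mapping.keys \<alpha> \<subseteq> {..<?d}"
    by (auto dest: in_keys_less_degree)
  have "h_comp N lt \<alpha> = (\<Prod>i\<leftarrow>[0..<?d]. subst_h N lt (h_var (int (Poly_Mapping.lookup \<alpha> i))))"
    by (simp add: h_comp_def h_list_def subst_h_h_var o_def)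
  also have "ideal_cong I \<dots> (subst_h N lt (\<Prod>i\<leftarrow>[0..<?d]. h_var (int (Poly_Mapping.lookup \<alpha> i))))"
    using cong_sym[OF subst_h_prod_list[of "map (\<lambda>i. h_var (int (Poly_Mapping.lookup \<alpha> i))) [0..<?d]"]]
    by (simp add: o_def)
  \<comment> \<open>Inside \<open>subst_h\<close> the ring is commutative, so the ordered product
    may become a product over a set.\<close>
  also have "(\<Prod>i\<leftarrow>[0..<?d]. h_var (int (Poly_Mapping.lookup \<alpha> i))) =
      (\<Prod>i<?d. h_var (int (Poly_Mapping.lookup \<alpha> i)))"
    by (subst prod.distinct_set_conv_list[symmetric]) (simp_all add: lessThan_atLeast0)
  also have "\<dots> = (\<Sum>\<nu> | \<nu> \<in> partitions \<and> schur \<nu> \<alpha> \<noteq> 0. of_int (schur \<nu> \<alpha>) * univ.J \<nu>)"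
    by (rule univ.prod_h_eq_sum_schur[OF keys])
  also have "subst_h N lt \<dots> = (\<Sum>\<nu> | \<nu> \<in> partitions \<and> schur \<nu> \<alpha> \<noteq> 0. of_int (schur \<nu> \<alpha>) * subst_h N lt (univ.J \<nu>))"
    by (simp only: subst_h_sum subst_h_of_int_mult)
  also have "ideal_cong I \<dots> (\<Sum>\<nu> | \<nu> \<in> partitions \<and> schur \<nu> \<alpha> \<noteq> 0. of_int (schur \<nu> \<alpha>) * J_poly N lt \<nu>)"
    by (intro ideal_cong_sum[OF I] ideal_cong_of_int_mult[OF I] subst_h_J)
  finally show ?thesis .
qed

text \<open>Zero exponents drop out exactly because \<open>h_0 = 1\<close>; only the reordering
  needs the ideal.\<close>

lemma h_comp_cong_parts: "ideal_cong I (h_comp N lt \<alpha>) (h_list N lt (parts_of \<alpha>))"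
proof -
  let ?ks = "map (Poly_Mapping.lookup \<alpha>) [0..<Poly_Mapping.degree \<alpha>]"
  have "h_comp N lt \<alpha> = h_list N lt (filter (\<lambda>k. k \<noteq> 0) ?ks)"
    by (simp only: h_comp_def h_list_filter)
  moreover have "mset (filter (\<lambda>k. k \<noteq> 0) ?ks) = mset (parts_of \<alpha>)"
    unfolding mset_composition by (simp add: parts_of_def)
  ultimately show ?thesis using h_list_mset_cong by metis
qed

end

section \<open>The expansions of the series and of its pairings\<close>

lemma h_comp_carrier: "shuffle_order N lt \<Longrightarrow> h_comp N lt \<alpha> \<in> carrier (\<U> N)"
  unfolding h_comp_def by (rule h_list_carrier)

lemma F_series_eq_pairing:
  assumes so: "shuffle_order N lt" and "\<gamma> \<in> carrier (\<U> N)"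
  shows "F_series lt \<gamma> \<alpha> = pairing (\<Omega> N lt \<alpha>) \<gamma>"
  unfolding F_series_def pairing_eq_sum_right
proof (rule sum.cong[OF refl])
  fix w assume "w \<in> Poly_Mapping.keys \<gamma>"
  then have "w \<in> colored_words N" using assms(2) by (auto simp: carrier_\<U>)
  then show "Poly_Mapping.lookup \<gamma> w * Q_series (length w) (Des lt w) \<alpha> =
      Poly_Mapping.lookup (\<Omega> N lt \<alpha>) w * Poly_Mapping.lookup \<gamma> w"
    by (simp add: Q_series_Des[OF so] \<Omega>_eq_h_comp[OF so] h_comp_def h_list_eq_word_sum lookup_word_sum finite_splits)
qed

lemma \<Omega>_formal_sum_words:
  assumes so: "shuffle_order N lt"
  shows "has_formal_sum (\<U> N)
    (\<lambda>w. ps_times (\<U> N) (Q_series (length w) (Des lt w)) (frag_of w)) (colored_words N) (\<Omega> N lt)"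
proof -
  interpret ring "\<U> N" by (rule ring_\<U>)
  let ?B = "\<lambda>\<alpha>. {w \<in> colored_words N. splits lt (map (Poly_Mapping.lookup \<alpha>) [0..<Poly_Mapping.degree \<alpha>]) w}"
  have coeff: "ps_times (\<U> N) (Q_series (length w) (Des lt w)) (frag_of w) \<alpha> = (if w \<in> ?B \<alpha> then frag_of w else 0)"
    if "w \<in> colored_words N" for w \<alpha>
    using that by (simp add: ps_times_def Q_series_Des[OF so] add_pow_\<U> frag_of_carrier)
  show ?thesis
  proof (rule has_formal_sumI[where B = ?B])
    fix \<alpha>
    have "\<Omega> N lt \<alpha> = (\<Sum>w\<in>?B \<alpha>. frag_of w)"
      by (simp add: \<Omega>_eq_h_comp[OF so] h_comp_def h_list_eq_word_sum word_sum_def)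
    also have "\<dots> = (\<Oplus>\<^bsub>\<U> N\<^esub>w\<in>?B \<alpha>. ps_times (\<U> N) (Q_series (length w) (Des lt w)) (frag_of w) \<alpha>)"
      by (subst finsum_\<U>) (auto simp: coeff frag_of_carrier intro!: sum.cong)
    finally show "\<Omega> N lt \<alpha> = \<dots>" .
  qed (auto simp: finite_splits coeff frag_of_carrier)
qed

lemma \<Omega>_formal_sum_compositions:
  assumes so: "shuffle_order N lt"
  shows "has_formal_sum (\<U> N) (\<lambda>\<alpha>. ps_times (\<U> N) (xpow \<alpha>) (h_comp N lt \<alpha>)) UNIV (\<Omega> N lt)"
proof -
  interpret ring "\<U> N" by (rule ring_\<U>)
  have coeff: "ps_times (\<U> N) (xpow \<beta>) (h_comp N lt \<beta>) \<alpha> = (if \<alpha> = \<beta> then h_comp N lt \<beta> else 0)" for \<alpha> \<beta>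
    by (simp add: ps_times_def xpow_def add_pow_\<U> h_comp_carrier[OF so])
  show ?thesis
    by (rule has_formal_sumI[where B = "\<lambda>\<alpha>. {\<alpha>}"])
      (auto simp: coeff h_comp_carrier[OF so] \<Omega>_eq_h_comp[OF so] finsum_\<U>)
qed

theorem theorem8p3:
  fixes N :: nat and lt :: "letter \<Rightarrow> letter \<Rightarrow> bool" and I :: "word_alg set"
  assumes "shuffle_order N lt"
    and "ideal I (\<U> N)"
  shows
    \<comment> \<open>(i)\<close>
    "(has_formal_sum (\<U> N)
        (\<lambda>w. ps_times (\<U> N) (Q_series (length w) (Des lt w)) (frag_of w)) (colored_words N) (\<Omega> N lt) \<and>
      has_formal_sum (\<U> N)
        (\<lambda>\<alpha>. ps_times (\<U> N) (xpow \<alpha>) (h_comp N lt \<alpha>)) UNIV (\<Omega> N lt) \<and>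
      (\<forall>\<gamma>\<in>carrier (\<U> N). F_series lt \<gamma> = (\<lambda>\<alpha>. pairing (\<Omega> N lt \<alpha>) \<gamma>))) \<and>
     \<comment> \<open>(ii)\<close>
     (commute_mod N I (e_poly N lt) \<longleftrightarrow> commute_mod N I (h_poly N lt)) \<and>
     \<comment> \<open>(iii)\<close>
     (commute_mod N I (h_poly N lt) \<longrightarrow>
      has_formal_sum (\<U> N Quot I)
        (\<lambda>\<nu>. ps_times (\<U> N Quot I) (monomial_sf \<nu>) (residue_class N I (h_list N lt \<nu>))) partitions
        (\<lambda>\<alpha>. residue_class N I (\<Omega> N lt \<alpha>)) \<and>
      has_formal_sum (\<U> N Quot I)
        (\<lambda>\<nu>. ps_times (\<U> N Quot I) (schur \<nu>) (residue_class N I (J_poly N lt \<nu>))) partitions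
        (\<lambda>\<alpha>. residue_class N I (\<Omega> N lt \<alpha>)) \<and>
      (\<forall>\<gamma>\<in>perp N I.
         F_series lt \<gamma> = (\<lambda>\<alpha>. pairing (\<Omega> N lt \<alpha>) \<gamma>) \<and>
         has_formal_sum \<Z>
           (\<lambda>\<nu>. ps_times \<Z> (schur \<nu>) (pairing (J_poly N lt \<nu>) \<gamma>)) partitions
           (\<lambda>\<alpha>. pairing (\<Omega> N lt \<alpha>) \<gamma>)))"
proof -
  note so = assms(1) and I = assms(2)
  note \<Omega> = \<Omega>_eq_h_comp[OF so]
  have pairing: "F_series lt \<gamma> = (\<lambda>\<alpha>. pairing (\<Omega> N lt \<alpha>) \<gamma>)" if "\<gamma> \<in> carrier (\<U> N)" for \<gamma>
    using F_series_eq_pairing[OF so that] by blast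
  let ?K = "\<lambda>\<alpha>. {\<nu>. \<nu> \<in> partitions \<and> schur \<nu> \<alpha> \<noteq> 0}"
  have "has_formal_sum (\<U> N Quot I)
      (\<lambda>\<nu>. ps_times (\<U> N Quot I) (monomial_sf \<nu>) (residue_class N I (h_list N lt \<nu>))) partitions
      (\<lambda>\<alpha>. residue_class N I (\<Omega> N lt \<alpha>)) \<and>
    has_formal_sum (\<U> N Quot I)
      (\<lambda>\<nu>. ps_times (\<U> N Quot I) (schur \<nu>) (residue_class N I (J_poly N lt \<nu>))) partitions
      (\<lambda>\<alpha>. residue_class N I (\<Omega> N lt \<alpha>)) \<and>
    (\<forall>\<gamma>\<in>perp N I.
       F_series lt \<gamma> = (\<lambda>\<alpha>. pairing (\<Omega> N lt \<alpha>) \<gamma>) \<and>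
       has_formal_sum \<Z>
         (\<lambda>\<nu>. ps_times \<Z> (schur \<nu>) (pairing (J_poly N lt \<nu>) \<gamma>)) partitions
         (\<lambda>\<alpha>. pairing (\<Omega> N lt \<alpha>) \<gamma>))"
    if "commute_mod N I (h_poly N lt)"
  proof (intro conjI ballI)
    have comm: "ideal_cong I (h_poly N lt k * h_poly N lt l) (h_poly N lt l * h_poly N lt k)" for k l
      using that commute_mod_iff[OF I, of "h_poly N lt"] h_poly_carrier by blast
    note schur = h_comp_cong_schur[OF I so comm]
    show "has_formal_sum (\<U> N Quot I)
        (\<lambda>\<nu>. ps_times (\<U> N Quot I) (monomial_sf \<nu>) (residue_class N I (h_list N lt \<nu>))) partitions
        (\<lambda>\<alpha>. residue_class N I (\<Omega> N lt \<alpha>))"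
    proof (rule has_formal_sum_Quot[OF I, where B = "\<lambda>\<alpha>. {parts_of \<alpha>}"])
      show "ideal_cong I (\<Omega> N lt \<alpha>) (\<Sum>\<nu>\<in>{parts_of \<alpha>}. of_int (monomial_sf \<nu> \<alpha>) * h_list N lt \<nu>)" for \<alpha>
        using h_comp_cong_parts[OF I so comm, of \<alpha>]
        by (simp add: \<Omega> monomial_sf_partition parts_of_partition)
    qed (auto simp: \<Omega> monomial_sf_partition parts_of_partition h_list_carrier[OF so] h_comp_carrier[OF so])
    show "has_formal_sum (\<U> N Quot I)
        (\<lambda>\<nu>. ps_times (\<U> N Quot I) (schur \<nu>) (residue_class N I (J_poly N lt \<nu>))) partitions
        (\<lambda>\<alpha>. residue_class N I (\<Omega> N lt \<alpha>))"
      by (rule has_formal_sum_Quot[OF I, where B = ?K])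
        (use schur in \<open>auto simp: \<Omega> finite_schur_support J_poly_carrier h_comp_carrier[OF so]\<close>)
    fix \<gamma> assume \<gamma>: "\<gamma> \<in> perp N I"
    then show "F_series lt \<gamma> = (\<lambda>\<alpha>. pairing (\<Omega> N lt \<alpha>) \<gamma>)"
      by (intro pairing) (simp add: perp_def)
    show "has_formal_sum \<Z> (\<lambda>\<nu>. ps_times \<Z> (schur \<nu>) (pairing (J_poly N lt \<nu>) \<gamma>)) partitions
        (\<lambda>\<alpha>. pairing (\<Omega> N lt \<alpha>) \<gamma>)"
    proof (rule abelian_monoid.has_formal_sumI[where B = ?K])
      show "abelian_monoid \<Z>" by (rule int.abelian_monoid_axioms)
      fix \<alpha>
      \<comment> \<open>The difference lies in the ideal and \<gamma> is orthogonal to it, so the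
        congruence becomes an equality of integers.\<close>
      have "pairing (\<Omega> N lt \<alpha> - (\<Sum>\<nu>\<in>?K \<alpha>. of_int (schur \<nu> \<alpha>) * J_poly N lt \<nu>)) \<gamma> = 0"
        using \<gamma> schur[of \<alpha>] by (simp add: perp_def ideal_cong_def \<Omega>)
      then show "pairing (\<Omega> N lt \<alpha>) \<gamma> =
          (\<Oplus>\<^bsub>\<Z>\<^esub>\<nu>\<in>?K \<alpha>. ps_times \<Z> (schur \<nu>) (pairing (J_poly N lt \<nu>) \<gamma>) \<alpha>)"
        by (simp add: pairing_diff pairing_sum int_finsum_eq ps_times_def add_pow_\<Z>)
    qed (auto simp: finite_schur_support ps_times_def add_pow_\<Z>)
  qed
  then show ?thesis
    using \<Omega>_formal_sum_words[OF so] \<Omega>_formal_sum_compositions[OF so] pairing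
      commute_e_iff_commute_h[OF I so] by blast
qed

end
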